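(* The $t$-Closeness problem can be solved exactly in $2^{O(n)}\cdot O(m)$ time, where $n$ is the number of rows and $m$ the number of quasi-identifier columns of the input table.
   Context: A table $\mathcal{T}$ with $m$ quasi-identifier (QI) attributes and one sensitive attribute (SA) is a multiset of $n$ vectors (rows) in $\Sigma^{m+1}$, $\Sigma$ a finite alphabet; coordinates $1,\dots,m$ are QIs and coordinate $m+1$ is the SA, with values in $\Sigma_s\subseteq\Sigma$. For a nonempty group $M\subseteq\mathcal{T}$, its suppression cost is $|M|$ times the number of QI coordinates on which not all rows of $M$ agree; a partition into nonempty groups has cost the sum of its groups' costs. An SA space is a metric $d$ on $\Sigma_s$ with maximum distance $1$. $P(M)$ is the distribution of SA values in $M$. $\mathrm{EMD}(X,Y)$ is the minimum of $\sum_{i,j}d(i,j)f(i,j)$ over $f\ge0$ with $\sum_j f(i,j)=X[i]$, $\sum_i f(i,j)=Y[j]$. A group $M$ is $t$-close if $\mathrm{EMD}(P(M),P(\mathcal{T}))\le t$. The $t$-Closeness problem: given $\mathcal{T}$, an SA space $(\Sigma_s,d)$ and $t\in[0,1]$, find a partition of $\mathcal{T}$ in which every group is $t$-close, of minimum cost. *)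

theory Defs
  imports "HOL-Analysis.Abstract_Metric_Spaces" "HOL-Library.Multiset" "HOL-Library.Landau_Symbols"
begin

section \<open>Tables and t-closeness\<close>

text \<open>
  Symbols are natural numbers and an alphabet is a finite set of them. In a row with \<open>m\<close>
  quasi-identifiers the positions \<open>0, \<dots>, m - 1\<close> are the quasi-identifiers and position \<open>m\<close>
  is the sensitive attribute.
\<close>

type_synonym row = "nat list"

type_synonym table = "row multiset"

definition is_table :: "nat \<Rightarrow> nat set \<Rightarrow> nat set \<Rightarrow> table \<Rightarrow> bool" where
  "is_table m \<Sigma> S T \<longleftrightarrow> finite \<Sigma> \<and> S \<subseteq> \<Sigma> \<and>
     (\<forall>r\<in>#T. length r = m + 1 \<and> set r \<subseteq> \<Sigma> \<and> r ! m \<in> S)"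

definition sa_space :: "nat set \<Rightarrow> (nat \<Rightarrow> nat \<Rightarrow> real) \<Rightarrow> bool" where
  "sa_space S d \<longleftrightarrow> finite S \<and> S \<noteq> {} \<and> Metric_space S d \<and> Max {d a b | a b. a \<in> S \<and> b \<in> S} = 1"

definition suppression_cost :: "nat \<Rightarrow> table \<Rightarrow> nat" where
  "suppression_cost m M =
     size M * card {j. j < m \<and> \<not> (\<forall>r\<in>#M. \<forall>r'\<in>#M. r ! j = r' ! j)}"

definition is_partition :: "table \<Rightarrow> table multiset \<Rightarrow> bool" where
  "is_partition T P \<longleftrightarrow> {#} \<notin># P \<and> \<Sum>\<^sub># P = T"

definition partition_cost :: "nat \<Rightarrow> table multiset \<Rightarrow> nat" where
  "partition_cost m P = (\<Sum>M\<in>#P. suppression_cost m M)"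

definition sa_distribution :: "nat \<Rightarrow> table \<Rightarrow> nat \<Rightarrow> real" where
  "sa_distribution m M a = real (count (image_mset (\<lambda>r. r ! m) M) a) / real (size M)"

definition is_flow ::
  "nat set \<Rightarrow> (nat \<Rightarrow> real) \<Rightarrow> (nat \<Rightarrow> real) \<Rightarrow> (nat \<Rightarrow> nat \<Rightarrow> real) \<Rightarrow> bool" where
  "is_flow S X Y f \<longleftrightarrow> (\<forall>i\<in>S. \<forall>j\<in>S. f i j \<ge> 0) \<and>
     (\<forall>i\<in>S. (\<Sum>j\<in>S. f i j) = X i) \<and> (\<forall>j\<in>S. (\<Sum>i\<in>S. f i j) = Y j)"

text \<open>
  For two distributions on a finite \<open>S\<close> the infimum is a minimum: the flows form a nonempty
  compact polytope and the objective is linear.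
\<close>

definition EMD ::
  "nat set \<Rightarrow> (nat \<Rightarrow> nat \<Rightarrow> real) \<Rightarrow> (nat \<Rightarrow> real) \<Rightarrow> (nat \<Rightarrow> real) \<Rightarrow> real" where
  "EMD S d X Y = Inf {(\<Sum>i\<in>S. \<Sum>j\<in>S. d i j * f i j) | f. is_flow S X Y f}"

definition t_close ::
  "nat \<Rightarrow> nat set \<Rightarrow> (nat \<Rightarrow> nat \<Rightarrow> real) \<Rightarrow> real \<Rightarrow> table \<Rightarrow> table \<Rightarrow> bool" where
  "t_close m S d t T M \<longleftrightarrow> EMD S d (sa_distribution m M) (sa_distribution m T) \<le> t"

definition t_close_partition ::
  "nat \<Rightarrow> nat set \<Rightarrow> (nat \<Rightarrow> nat \<Rightarrow> real) \<Rightarrow> real \<Rightarrow> table \<Rightarrow> table multiset \<Rightarrow> bool" where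
  "t_close_partition m S d t T P \<longleftrightarrow> is_partition T P \<and> (\<forall>M\<in>#P. t_close m S d t T M)"

definition optimal_t_close_partition ::
  "nat \<Rightarrow> nat set \<Rightarrow> (nat \<Rightarrow> nat \<Rightarrow> real) \<Rightarrow> real \<Rightarrow> table \<Rightarrow> table multiset \<Rightarrow> bool" where
  "optimal_t_close_partition m S d t T P \<longleftrightarrow> t_close_partition m S d t T P \<and>
     (\<forall>Q. t_close_partition m S d t T Q \<longrightarrow> partition_cost m P \<le> partition_cost m Q)"

section \<open>A random access machine with running times\<close>

text \<open>
  Programs are while-programs over a memory of natural-number cells and a memory of real cells,
  both organised as named, unbounded two-dimensional arrays (a scalar is the cell at index 0, 0).
  Every operation has unit cost. To keep the unit-cost measure honest, the only arithmetic is
  addition and subtraction (truncated on naturals), real numbers can only be added, subtracted and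
  compared, and no real constants other than naturals are available, so that a program cannot
  carry infinite information and computes within the rationals on rational inputs.
\<close>

type_synonym name = string

datatype nexp = Num nat | Cell name nexp nexp | Plus nexp nexp | Minus nexp nexp

datatype rexp = OfNat nexp | RCell name nexp nexp | RPlus rexp rexp | RMinus rexp rexp

datatype bexp = LessN nexp nexp | LessR rexp rexp | NotB bexp | AndB bexp bexp

datatype com =
    Skip
  | Assign name nexp nexp nexp
  | RAssign name nexp nexp rexp
  | Seq com com
  | Cond bexp com com
  | While bexp com

record state =
  nmem :: "name \<Rightarrow> nat \<Rightarrow> nat \<Rightarrow> nat"
  rmem :: "name \<Rightarrow> nat \<Rightarrow> nat \<Rightarrow> real"

fun nval :: "nexp \<Rightarrow> state \<Rightarrow> nat" where
  "nval (Num k) s = k"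
| "nval (Cell x i j) s = nmem s x (nval i s) (nval j s)"
| "nval (Plus a b) s = nval a s + nval b s"
| "nval (Minus a b) s = nval a s - nval b s"

fun rval :: "rexp \<Rightarrow> state \<Rightarrow> real" where
  "rval (OfNat a) s = real (nval a s)"
| "rval (RCell x i j) s = rmem s x (nval i s) (nval j s)"
| "rval (RPlus a b) s = rval a s + rval b s"
| "rval (RMinus a b) s = rval a s - rval b s"

fun bval :: "bexp \<Rightarrow> state \<Rightarrow> bool" where
  "bval (LessN a b) s \<longleftrightarrow> nval a s < nval b s"
| "bval (LessR a b) s \<longleftrightarrow> rval a s < rval b s"
| "bval (NotB b) s \<longleftrightarrow> \<not> bval b s"
| "bval (AndB b c) s \<longleftrightarrow> bval b s \<and> bval c s"

fun ncost :: "nexp \<Rightarrow> nat" where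
  "ncost (Num k) = 1"
| "ncost (Cell x i j) = ncost i + ncost j + 1"
| "ncost (Plus a b) = ncost a + ncost b + 1"
| "ncost (Minus a b) = ncost a + ncost b + 1"

fun rcost :: "rexp \<Rightarrow> nat" where
  "rcost (OfNat a) = ncost a + 1"
| "rcost (RCell x i j) = ncost i + ncost j + 1"
| "rcost (RPlus a b) = rcost a + rcost b + 1"
| "rcost (RMinus a b) = rcost a + rcost b + 1"

fun bcost :: "bexp \<Rightarrow> nat" where
  "bcost (LessN a b) = ncost a + ncost b + 1"
| "bcost (LessR a b) = rcost a + rcost b + 1"
| "bcost (NotB b) = bcost b + 1"
| "bcost (AndB b c) = bcost b + bcost c + 1"

definition set_ncell :: "name \<Rightarrow> nat \<Rightarrow> nat \<Rightarrow> nat \<Rightarrow> state \<Rightarrow> state" where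
  "set_ncell x i j v s = s\<lparr>nmem := (nmem s)(x := (nmem s x)(i := (nmem s x i)(j := v)))\<rparr>"

definition set_rcell :: "name \<Rightarrow> nat \<Rightarrow> nat \<Rightarrow> real \<Rightarrow> state \<Rightarrow> state" where
  "set_rcell x i j v s = s\<lparr>rmem := (rmem s)(x := (rmem s x)(i := (rmem s x i)(j := v)))\<rparr>"

text \<open>\<open>exec c s k s'\<close>: started in \<open>s\<close>, program \<open>c\<close> halts in \<open>s'\<close> after \<open>k\<close> steps.\<close>

inductive exec :: "com \<Rightarrow> state \<Rightarrow> nat \<Rightarrow> state \<Rightarrow> bool" where
  Skip: "exec Skip s 1 s"
| Assign: "exec (Assign x i j a) s (ncost i + ncost j + ncost a + 1)
             (set_ncell x (nval i s) (nval j s) (nval a s) s)"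
| RAssign: "exec (RAssign x i j a) s (ncost i + ncost j + rcost a + 1)
             (set_rcell x (nval i s) (nval j s) (rval a s) s)"
| Seq: "exec c1 s k1 s' \<Longrightarrow> exec c2 s' k2 s'' \<Longrightarrow> exec (Seq c1 c2) s (k1 + k2) s''"
| CondTrue: "bval b s \<Longrightarrow> exec c1 s k s' \<Longrightarrow> exec (Cond b c1 c2) s (bcost b + k + 1) s'"
| CondFalse: "\<not> bval b s \<Longrightarrow> exec c2 s k s' \<Longrightarrow> exec (Cond b c1 c2) s (bcost b + k + 1) s'"
| WhileFalse: "\<not> bval b s \<Longrightarrow> exec (While b c) s (bcost b + 1) s"
| WhileTrue: "bval b s \<Longrightarrow> exec c s k1 s' \<Longrightarrow> exec (While b c) s' k2 s'' \<Longrightarrow>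
              exec (While b c) s (bcost b + k1 + k2 + 1) s''"

inductive_cases exec_SkipE: "exec Skip s k s'"
inductive_cases exec_AssignE: "exec (Assign x i j a) s k s'"
inductive_cases exec_RAssignE: "exec (RAssign x i j a) s k s'"
inductive_cases exec_SeqE: "exec (Seq c1 c2) s k s'"
inductive_cases exec_CondE: "exec (Cond b c1 c2) s k s'"
inductive_cases exec_WhileE: "exec (While b c) s k s'"

lemma exec_deterministic:
  "exec c s k s' \<Longrightarrow> exec c s l s'' \<Longrightarrow> k = l \<and> s' = s''"
proof (induction arbitrary: l s'' rule: exec.induct)
  case (Skip s)
  then show ?case by (rule exec_SkipE) simp
next
  case (Assign x i j a s)
  then show ?case by (rule exec_AssignE) simp
next
  case (RAssign x i j a s)
  then show ?case by (rule exec_RAssignE) simp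
next
  case (Seq c1 s k1 s1 c2 k2 s2)
  from Seq.prems obtain a b u where "exec c1 s a u" "exec c2 u b s''" "l = a + b"
    by (rule exec_SeqE)
  with Seq.IH(1)[of a u] Seq.IH(2)[of b s''] show ?case by simp
next
  case (CondTrue b s c1 k s1 c2)
  from CondTrue.prems CondTrue.hyps(1) obtain a where "exec c1 s a s''" "l = Suc (bcost b + a)"
    by (elim exec_CondE) simp_all
  with CondTrue.IH[of a s''] show ?case by simp
next
  case (CondFalse b s c2 k s1 c1)
  from CondFalse.prems CondFalse.hyps(1) obtain a where "exec c2 s a s''" "l = Suc (bcost b + a)"
    by (elim exec_CondE) simp_all
  with CondFalse.IH[of a s''] show ?case by simp
next
  case (WhileFalse b s c)
  from WhileFalse.prems show ?case by (rule exec_WhileE) (simp_all add: WhileFalse.hyps)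
next
  case (WhileTrue b s c k1 s1 k2 s2)
  from WhileTrue.prems show ?case
  proof (rule exec_WhileE)
    assume "\<not> bval b s"
    with WhileTrue.hyps(1) show ?thesis by simp
  next
    fix a u e
    assume "exec c s a u" "exec (While b c) u e s''" "l = Suc (bcost b + a + e)"
    with WhileTrue.IH(1)[of a u] WhileTrue.IH(2)[of e s''] show ?thesis by simp
  qed
qed

section \<open>Input and output\<close>

text \<open>
  The rows of the table are presented in some order. The distances are stored only on the
  sensitive values, so nothing outside the space is visible to the program; all cells not
  mentioned are 0.
\<close>

definition input_state ::
  "nat \<Rightarrow> row list \<Rightarrow> nat set \<Rightarrow> (nat \<Rightarrow> nat \<Rightarrow> real) \<Rightarrow> real \<Rightarrow> state" where
  "input_state m rs S d t = \<lparr>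
     nmem = (\<lambda>x i j.
       if x = ''n'' \<and> i = 0 \<and> j = 0 then length rs
       else if x = ''m'' \<and> i = 0 \<and> j = 0 then m
       else if x = ''T'' \<and> i < length rs \<and> j \<le> m then rs ! i ! j
       else if x = ''S'' \<and> i = 0 \<and> j \<in> S then 1
       else 0),
     rmem = (\<lambda>x i j.
       if x = ''d'' \<and> i \<in> S \<and> j \<in> S then d i j
       else if x = ''t'' \<and> i = 0 \<and> j = 0 then t
       else 0)\<rparr>"

text \<open>
  The answer is read off the array \<open>''out''\<close>: rows \<open>i\<close> and \<open>j\<close> lie in the same group iff
  they carry the same label.
\<close>

definition group_of_label :: "row list \<Rightarrow> (nat \<Rightarrow> nat) \<Rightarrow> nat \<Rightarrow> table" where
  "group_of_label rs g l = image_mset ((!) rs) (mset_set {i. i < length rs \<and> g i = l})"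

definition partition_of_labels :: "row list \<Rightarrow> (nat \<Rightarrow> nat) \<Rightarrow> table multiset" where
  "partition_of_labels rs g =
     image_mset (group_of_label rs g) (mset_set (g ` {..<length rs}))"

definition output_partition :: "row list \<Rightarrow> state \<Rightarrow> table multiset" where
  "output_partition rs s = partition_of_labels rs (\<lambda>i. nmem s ''out'' 0 i)"

end

theory Submission
  imports Defs "HOL-Library.Nat_Bijection"
begin

text \<open>
  An optimal partition is found by the subset recursion that splits off one admissible group at a
  time, over all \<open>2\<^sup>n\<close> sets of rows. What has to be shown is that \<open>t\<close>-closeness of a single set
  \<open>B\<close> of rows can be decided in exponential time with additions and comparisons only, although the
  alphabet is unbounded. Scaled by \<open>n |B|\<close>, the earth mover's distance becomes a transshipment
  problem between the rows themselves, where row \<open>i\<close> has the integral excess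
  \<open>n [i \<in> B] - |B|\<close>. An optimal flow may be taken on a spanning tree: if every row has degree at
  least 2 there are at least as many edges as rows, so a nonzero circulation lives on the
  support, and shifting along it removes an edge without raising the cost. On a tree the
  flow over an edge is the total excess below it, so the minimum over all rooted trees
  is again given by a recursion over subsets. Conversely, the triangle inequality turns every tree
  flow into a transport plan of no greater cost.
\<close>

section \<open>Optimal transport along trees\<close>

text \<open>The time bound may depend on \<open>n\<close> and \<open>m\<close> only, while
  \<open>S\<close> may be arbitrarily large, so no loop can range over the sensitive values. Values
  that do not occur in the table carry no mass, and the rows take over as nodes. Ordinary linear
  programming is barred as well, since the machine neither divides nor multiplies. Scaling by
  \<open>n * card B\<close> makes every edge flow of a tree an integer of absolute value at most
  \<open>n * n\<close>, so flow times distance is a repeated addition of an input distance; division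
  occurs only in existence arguments. The infimum in \<open>EMD\<close> is never shown to be
  attained: plans of cost at most \<open>c\<close> are compared with trees directly, and finitely
  many table entries supply the minimum that is needed. The number \<open>m\<close> enters the time
  through the suppression costs alone, by one loop over the columns that is not nested in another
  one. Everything else is absorbed into \<open>2 ^ (a * (n + 1))\<close>.\<close>

lemma homogeneous_system:
  fixes a :: "'c \<Rightarrow> 'e \<Rightarrow> real"
  assumes "finite C" "finite E" "card C < card E"
  shows "\<exists>z. (\<exists>e\<in>E. z e \<noteq> 0) \<and> (\<forall>c\<in>C. (\<Sum>e\<in>E. a c e * z e) = 0)"
  using assms
proof (induction C arbitrary: E a rule: finite_induct)
  case empty
  then have "E \<noteq> {}" by auto
  then show ?case by (intro exI[of _ "\<lambda>_. 1"]) auto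
next
  case (insert c C)
  show ?case
  proof (cases "\<forall>e\<in>E. a c e = 0")
    case True
    have "card C < card E" using insert by simp
    then obtain z where "\<exists>e\<in>E. z e \<noteq> 0" "\<forall>c\<in>C. (\<Sum>e\<in>E. a c e * z e) = 0"
      using insert.IH[OF \<open>finite E\<close>, of a] by blast
    then show ?thesis using True by (intro exI[of _ z]) auto
  next
    case False
    then obtain x where x: "x \<in> E" "a c x \<noteq> 0" by blast
    let ?E = "E - {x}"
    \<comment> \<open>Gaussian elimination with pivot \<open>a c x\<close>: a multiple of equation
      \<open>c\<close> removes the unknown \<open>x\<close> from the other equations, and
      \<open>y x\<close> is afterwards chosen so that equation \<open>c\<close> holds too.\<close>
    let ?a = "\<lambda>k e. a k e - a k x * a c e / a c x"
    have "card C < card ?E" using insert x by simp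
    then obtain z where z: "\<exists>e\<in>?E. z e \<noteq> 0" "\<forall>k\<in>C. (\<Sum>e\<in>?E. ?a k e * z e) = 0"
      using insert.IH[of ?E ?a] insert.prems by blast
    define y where "y = z(x := - (\<Sum>e\<in>?E. a c e * z e) / a c x)"
    have sum_y: "(\<Sum>e\<in>E. a k e * y e) = (\<Sum>e\<in>?E. a k e * z e) - a k x * (\<Sum>e\<in>?E. a c e * z e) / a c x" for k
    proof -
      have "(\<Sum>e\<in>E. a k e * y e) = a k x * y x + (\<Sum>e\<in>?E. a k e * y e)"
        using x insert.prems by (simp add: sum.remove)
      also have "(\<Sum>e\<in>?E. a k e * y e) = (\<Sum>e\<in>?E. a k e * z e)"
        by (rule sum.cong) (auto simp: y_def)
      finally show ?thesis by (simp add: y_def)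
    qed
    have "(\<Sum>e\<in>E. a k e * y e) = 0" if "k \<in> C" for k
    proof -
      have "(\<Sum>e\<in>?E. ?a k e * z e) = (\<Sum>e\<in>?E. a k e * z e) - a k x * (\<Sum>e\<in>?E. a c e * z e) / a c x"
        by (simp add: left_diff_distrib sum_subtractf sum_distrib_left sum_divide_distrib mult.assoc)
      then show ?thesis using z(2) that sum_y[of k] by simp
    qed
    moreover have "(\<Sum>e\<in>E. a c e * y e) = 0" using sum_y[of c] x by simp
    moreover have "\<exists>e\<in>E. y e \<noteq> 0" using z(1) by (auto simp: y_def)
    ultimately show ?thesis by blast
  qed
qed

section \<open>Rooted trees that carry a flow\<close>

text \<open>\<open>b\<close> is the net supply of the nodes, so the edge from \<open>r\<close> to \<open>q\<close> carries \<open>sum b B\<close>.\<close>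

inductive tree_cost :: "('a \<Rightarrow> real) \<Rightarrow> ('a \<Rightarrow> 'a \<Rightarrow> real) \<Rightarrow> 'a set \<Rightarrow> 'a \<Rightarrow> real \<Rightarrow> bool"
  for b D where
  single: "tree_cost b D {r} r 0"
| join: "tree_cost b D A r c \<Longrightarrow> tree_cost b D B q c' \<Longrightarrow> A \<inter> B = {} \<Longrightarrow>
         tree_cost b D (A \<union> B) r (c + c' + \<bar>sum b B\<bar> * D r q)"

lemma tree_cost_root: "tree_cost b D A r c \<Longrightarrow> r \<in> A"
  by (induction rule: tree_cost.induct) auto

lemma tree_cost_finite: "tree_cost b D A r c \<Longrightarrow> finite A"
  by (induction rule: tree_cost.induct) auto

lemma tree_cost_nonneg:
  "tree_cost b D A r c \<Longrightarrow> (\<And>i j. i \<in> A \<Longrightarrow> j \<in> A \<Longrightarrow> 0 \<le> D i j) \<Longrightarrow> 0 \<le> c"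
proof (induction rule: tree_cost.induct)
  case (join A r c B q c')
  have "0 \<le> D r q" using join tree_cost_root by (metis UnI1 UnI2)
  with join show ?case by simp
qed simp

lemma tree_cost_cong:
  "tree_cost b D A r c \<Longrightarrow> (\<And>i. i \<in> A \<Longrightarrow> b' i = b i) \<Longrightarrow> tree_cost b' D A r c"
proof (induction rule: tree_cost.induct)
  case (single r)
  show ?case by (rule tree_cost.single)
next
  case (join A r c B q c')
  have "sum b' B = sum b B" using join.prems by (intro sum.cong) auto
  then show ?case using tree_cost.join[of b' D A r c B q c'] join by simp
qed

text \<open>Contracting the leaf \<open>v\<close> into its neighbour \<open>p\<close> keeps all
  other edge flows: a subtree containing \<open>p\<close> has the same total under \<open>b'\<close>
  as it has under \<open>b\<close> once \<open>v\<close> is added. The new edge carries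
  \<open>b v\<close>.\<close>

lemma tree_cost_attach_leaf:
  assumes "tree_cost b' D A r c" "p \<in> A" "v \<notin> A"
    and "b' p = b p + b v" "\<And>i. i \<in> A \<Longrightarrow> i \<noteq> p \<Longrightarrow> b' i = b i"
  shows "tree_cost b D (insert v A) r (c + \<bar>b v\<bar> * D p v)"
  using assms
proof (induction rule: tree_cost.induct)
  case (single r)
  then show ?case using tree_cost.join[OF tree_cost.single[of b D r] tree_cost.single[of b D v]] by simp
next
  case (join A r c B q c')
  show ?case
  proof (cases "p \<in> A")
    case True
    then have nB: "p \<notin> B" using join by auto
    have B: "tree_cost b D B q c'" by (rule tree_cost_cong[OF join.hyps(2)]) (use join nB in force)
    have s: "sum b' B = sum b B" using join nB by (intro sum.cong) auto
    have "tree_cost b D (insert v A) r (c + \<bar>b v\<bar> * D p v)" using join True by simp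
    from tree_cost.join[OF this B] show ?thesis using join by (simp add: s algebra_simps)
  next
    case False
    then have pB: "p \<in> B" using join by auto
    have A: "tree_cost b D A r c" by (rule tree_cost_cong[OF join.hyps(1)]) (use join False in force)
    have fin: "finite B" by (rule tree_cost_finite[OF join.hyps(2)])
    have "sum b' (B - {p}) = sum b (B - {p})" using join by (intro sum.cong) auto
    then have s: "sum b' B = sum b (insert v B)" using join fin pB
      by (simp add: sum.remove[OF fin pB])
    have "tree_cost b D (insert v B) q (c' + \<bar>b v\<bar> * D p v)" using join pB by simp
    from tree_cost.join[OF A this] show ?thesis using join s by (simp add: algebra_simps)
  qed
qed

text \<open>The ratio test of the simplex method: from the positive \<open>g\<close> one moves along
  \<open>z\<close> or \<open>-z\<close>, whichever does not raise the cost, until the first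
  coordinate reaches zero.\<close>

lemma reduce_support:
  fixes g z :: "'e \<Rightarrow> real"
  assumes "finite E" "\<And>e. e \<in> E \<Longrightarrow> 0 < g e" "\<exists>e\<in>E. z e \<noteq> 0" "\<And>e. e \<in> E \<Longrightarrow> 0 \<le> w e"
  shows "\<exists>l. (\<forall>e\<in>E. 0 \<le> g e + l * z e) \<and> (\<exists>e\<in>E. g e + l * z e = 0) \<and> l * (\<Sum>e\<in>E. w e * z e) \<le> 0"
proof -
  have main: "\<exists>l. (\<forall>e\<in>E. 0 \<le> g e + l * y e) \<and> (\<exists>e\<in>E. g e + l * y e = 0) \<and> l * (\<Sum>e\<in>E. w e * y e) \<le> 0"
    if y: "\<exists>e\<in>E. y e < 0" "(\<Sum>e\<in>E. w e * y e) \<le> 0" for y :: "'e \<Rightarrow> real"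
  proof -
    let ?E = "{e\<in>E. y e < 0}"
    have "\<exists>x. is_arg_min (\<lambda>e. g e / - y e) (\<lambda>e. e \<in> ?E) x"
      using ex_is_arg_min_if_finite[of ?E "\<lambda>e. g e / - y e"] assms(1) y by auto
    then obtain x where x: "x \<in> E" "y x < 0" and min: "\<And>e. e \<in> E \<Longrightarrow> y e < 0 \<Longrightarrow> g x / - y x \<le> g e / - y e"
      unfolding is_arg_min_linorder by blast
    define l where "l = g x / - y x"
    have l: "0 \<le> l" using x assms(2)[OF x(1)] unfolding l_def by (intro divide_nonneg_nonneg) auto
    have "0 \<le> g e + l * y e" if e: "e \<in> E" for e
    proof (cases "y e < 0")
      case True
      have "l * - y e \<le> g e" using min[OF e True] True unfolding l_def[symmetric]
        by (simp only: pos_le_divide_eq neg_0_less_iff_less)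
      then show ?thesis by simp
    next
      case False
      then show ?thesis using l assms(2)[OF e] by (simp add: add_nonneg_nonneg)
    qed
    moreover have "g x + l * y x = 0" using x by (simp add: l_def)
    ultimately show ?thesis using x l y(2) by (intro exI[of _ l]) (auto simp: mult_nonneg_nonpos)
  qed
  show ?thesis
  \<comment> \<open>The direction also needs a negative entry, or no coordinate would ever reach
    zero. If \<open>z\<close> fails, \<open>-z\<close> works: a \<open>z\<close> without negative
    entries has nonnegative cost and some positive entry, and a positive cost forces a positive
    entry.\<close>
  proof (cases "(\<Sum>e\<in>E. w e * z e) \<le> 0 \<and> (\<exists>e\<in>E. z e < 0)")
    case True
    then show ?thesis using main by blast
  next
    case False
    have neg: "(\<Sum>e\<in>E. w e * - z e) \<le> 0"
    proof (cases "(\<Sum>e\<in>E. w e * z e) \<le> 0")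
      case True
      with False have "\<And>e. e \<in> E \<Longrightarrow> 0 \<le> z e" by force
      then have "0 \<le> (\<Sum>e\<in>E. w e * z e)" using assms(4) by (intro sum_nonneg) auto
      then show ?thesis by (simp add: sum_negf)
    qed (simp add: sum_negf)
    have "\<exists>e\<in>E. - z e < 0"
    proof (rule ccontr)
      assume a: "\<not> ?thesis"
      then have le: "\<And>e. e \<in> E \<Longrightarrow> z e \<le> 0" by force
      then have "(\<Sum>e\<in>E. w e * z e) \<le> 0" using assms(4) by (intro sum_nonpos) (auto simp: mult_nonneg_nonpos)
      moreover have "\<exists>e\<in>E. z e < 0" using assms(3) le by force
      ultimately show False using False by blast
    qed
    from main[of "\<lambda>e. - z e", OF this neg] obtain l where
      l: "\<forall>e\<in>E. 0 \<le> g e + l * - z e" "\<exists>e\<in>E. g e + l * - z e = 0" "l * (\<Sum>e\<in>E. w e * - z e) \<le> 0" by blast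
    then show ?thesis by (intro exI[of _ "-l"]) (auto simp: sum_negf)
  qed
qed

text \<open>Induction on the number of nodes plus support edges: a node with at most one support
  edge is cut off as a leaf, otherwise a circulation deletes an edge. Edges are directed, so flow in
  both directions between two nodes counts twice and forms a cycle of its own. Loops
  \<open>g i i\<close> change no balance and are left out of the support.\<close>

lemma tree_cost_le_flow_cost:
  fixes g :: "'a \<Rightarrow> 'a \<Rightarrow> real"
  assumes "finite A" "A \<noteq> {}"
    and "\<And>i j. i \<in> A \<Longrightarrow> j \<in> A \<Longrightarrow> 0 \<le> D i j"
    and "\<And>i j. i \<in> A \<Longrightarrow> j \<in> A \<Longrightarrow> D i j = D j i"
    and "\<And>i j. i \<in> A \<Longrightarrow> j \<in> A \<Longrightarrow> 0 \<le> g i j"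
    and "\<And>v. v \<in> A \<Longrightarrow> (\<Sum>j\<in>A. g v j) - (\<Sum>j\<in>A. g j v) = b v"
  shows "\<exists>r c. tree_cost b D A r c \<and> c \<le> (\<Sum>i\<in>A. \<Sum>j\<in>A. D i j * g i j)"
  using assms
proof (induction "card A + card {e \<in> A \<times> A. fst e \<noteq> snd e \<and> 0 < g (fst e) (snd e)}"
    arbitrary: A g b rule: less_induct)
  case less
  note finA = less.prems(1) and D0 = less.prems(3) and Dsym = less.prems(4)
    and g0 = less.prems(5) and net = less.prems(6)
  define E where "E = {e \<in> A \<times> A. fst e \<noteq> snd e \<and> 0 < g (fst e) (snd e)}"
  have finE: "finite E" using finA by (simp add: E_def)
  define inc where "inc v = {e \<in> E. fst e = v \<or> snd e = v}" for v
  have fininc: "finite (inc v)" for v using finE by (simp add: inc_def)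
  show ?case
  proof (cases "\<exists>v\<in>A. card (inc v) \<le> 1")
    case True
    then obtain v where v: "v \<in> A" "card (inc v) \<le> 1" by blast
    show ?thesis
    proof (cases "A = {v}")
      case True
      have "0 \<le> (\<Sum>i\<in>A. \<Sum>j\<in>A. D i j * g i j)"
        by (intro sum_nonneg mult_nonneg_nonneg D0 g0)
      then show ?thesis using tree_cost.single[of b D v] True by blast
    next
      case False
      \<comment> \<open>The only possible partner of \<open>v\<close>. An isolated \<open>v\<close>
        may be attached to any other node, since the edge then carries 0.\<close>
      obtain p where p: "p \<in> A" "p \<noteq> v" and only_p: "\<And>e. e \<in> inc v \<Longrightarrow> fst e = p \<or> snd e = p"
      proof (cases "inc v = {}")
        case True
        from False v(1) obtain p where "p \<in> A" "p \<noteq> v" by blast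
        then show ?thesis using that True by blast
      next
        case False
        then have "card (inc v) = 1" using v fininc[of v] by (simp add: le_Suc_eq)
        then obtain e where e: "inc v = {e}" by (auto simp: card_1_singleton_iff)
        then have "e \<in> inc v" by simp
        then have e': "e \<in> A \<times> A" "fst e \<noteq> snd e" "fst e = v \<or> snd e = v" by (auto simp: inc_def E_def)
        show ?thesis
          using that[of "if fst e = v then snd e else fst e"] e' e by (auto split: if_splits)
      qed
      let ?A = "A - {v}"
      have zero: "g v j = 0 \<and> g j v = 0" if j: "j \<in> A" "j \<noteq> v" "j \<noteq> p" for j
      proof (rule ccontr)
        assume "\<not> ?thesis"
        then have "0 < g v j \<or> 0 < g j v" using g0 j v by (metis order_le_less)
        then have "(v, j) \<in> inc v \<or> (j, v) \<in> inc v" using j v by (auto simp: inc_def E_def)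
        then show False using only_p j p by fastforce
      qed
      have split: "(\<Sum>j\<in>A. f j) = f v + (\<Sum>j\<in>?A. f j)" for f :: "'a \<Rightarrow> real"
        using finA v by (simp add: sum.remove)
      have to_p: "(\<Sum>j\<in>?A. f j) = f p" if "\<And>j. j \<in> ?A \<Longrightarrow> j \<noteq> p \<Longrightarrow> f j = 0" for f :: "'a \<Rightarrow> real"
      proof -
        have "(\<Sum>j\<in>?A. f j) = (\<Sum>j\<in>{p}. f j)"
          using that finA p by (intro sum.mono_neutral_right) auto
        then show ?thesis by simp
      qed
      have bv: "b v = g v p - g p v"
        using net[OF v(1)] split[of "\<lambda>j. g v j"] split[of "\<lambda>j. g j v"]
          to_p[of "\<lambda>j. g v j"] to_p[of "\<lambda>j. g j v"] zero by simp
      define b' where "b' = b(p := b p + b v)"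
      have net': "(\<Sum>j\<in>?A. g w j) - (\<Sum>j\<in>?A. g j w) = b' w" if w: "w \<in> ?A" for w
        using net[of w] split[of "\<lambda>j. g w j"] split[of "\<lambda>j. g j w"] zero[of w] w bv
        by (auto simp: b'_def)
      have "{e \<in> ?A \<times> ?A. fst e \<noteq> snd e \<and> 0 < g (fst e) (snd e)} \<subseteq> E" by (auto simp: E_def)
      then have "card {e \<in> ?A \<times> ?A. fst e \<noteq> snd e \<and> 0 < g (fst e) (snd e)} \<le> card E"
        using finE by (rule card_mono[rotated])
      moreover have "card ?A < card A" using finA v(1) by (rule card_Diff1_less)
      ultimately have lt: "card ?A + card {e \<in> ?A \<times> ?A. fst e \<noteq> snd e \<and> 0 < g (fst e)
        (snd e)} < card A + card E"
        by simp
      have "\<exists>r c. tree_cost b' D ?A r c \<and> c \<le> (\<Sum>i\<in>?A. \<Sum>j\<in>?A. D i j * g i j)"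
        by (rule less.hyps[OF lt[unfolded E_def]]) (use finA p D0 Dsym g0 net' in auto)
      then obtain r c where rc: "tree_cost b' D ?A r c" "c \<le> (\<Sum>i\<in>?A. \<Sum>j\<in>?A. D i j * g i j)" by blast
      have "tree_cost b D (insert v ?A) r (c + \<bar>b v\<bar> * D p v)"
        by (rule tree_cost_attach_leaf[OF rc(1)]) (use p in \<open>auto simp: b'_def\<close>)
      moreover have "insert v ?A = A" using v by blast
      moreover have "c + \<bar>b v\<bar> * D p v \<le> (\<Sum>i\<in>A. \<Sum>j\<in>A. D i j * g i j)"
      proof -
        \<comment> \<open>Opposite flows between \<open>v\<close> and \<open>p\<close> cancel on the
          tree edge, so it costs at most as much as both together; the symmetry of \<open>D\<close>
          prices them alike.\<close>
        have "\<bar>b v\<bar> * D p v \<le> (g v p + g p v) * D p v"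
          using bv g0[of v p] g0[of p v] p v D0[of p v] by (intro mult_right_mono) auto
        also have "\<dots> = D v p * g v p + D p v * g p v"
          using Dsym[of p v] p v by (simp add: algebra_simps)
        also have "\<dots> = (\<Sum>j\<in>?A. D v j * g v j) + (\<Sum>j\<in>?A. D j v * g j v)"
          using to_p[of "\<lambda>j. D v j * g v j"] to_p[of "\<lambda>j. D j v * g j v"] zero by simp
        finally have "\<bar>b v\<bar> * D p v \<le> (\<Sum>j\<in>?A. D v j * g v j) + (\<Sum>j\<in>?A. D j v * g j v)" .
        moreover have "0 \<le> D v v * g v v" using D0 g0 v by simp
        moreover have "(\<Sum>i\<in>A. \<Sum>j\<in>A. D i j * g i j) = D v v * g v v + (\<Sum>j\<in>?A. D v j * g v j)
            + ((\<Sum>j\<in>?A. D j v * g j v) + (\<Sum>i\<in>?A. \<Sum>j\<in>?A. D i j * g i j))"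
          by (simp add: split sum.distrib)
        ultimately show ?thesis using rc(2) by simp
      qed
      ultimately show ?thesis by metis
    qed
  next
    case False
    then have deg: "2 \<le> card (inc v)" if "v \<in> A" for v using that by force
    \<comment> \<open>Double counting: every degree is at least 2 and every edge has two ends, hence
      there are at least as many edges as nodes.\<close>
    have "2 * card A = (\<Sum>v\<in>A. 2)" by simp
    also have "\<dots> \<le> (\<Sum>v\<in>A. card (inc v))" by (intro sum_mono deg)
    also have "\<dots> \<le> (\<Sum>v\<in>A. \<Sum>e\<in>E. of_bool (fst e = v) + of_bool (snd e = v))"
    proof (rule sum_mono)
      fix v
      have "card {e \<in> E. P e} = (\<Sum>e\<in>E. of_bool (P e))" for P
        using finE by (simp add: Int_def)
      then have "card (inc v) = (\<Sum>e\<in>E. of_bool (fst e = v \<or> snd e = v))"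
        by (simp only: inc_def)
      also have "\<dots> \<le> (\<Sum>e\<in>E. of_bool (fst e = v) + of_bool (snd e = v))"
        by (intro sum_mono) simp
      finally show "card (inc v) \<le> (\<Sum>e\<in>E. of_bool (fst e = v) + of_bool (snd e = v))" .
    qed
    also have "\<dots> = (\<Sum>e\<in>E. \<Sum>v\<in>A. of_bool (fst e = v) + of_bool (snd e = v))" by (rule sum.swap)
    also have "\<dots> = (\<Sum>e\<in>E. 2)"
      using finA by (intro sum.cong) (auto simp: E_def sum.distrib of_bool_def)
    finally have AE: "card A \<le> card E" by simp
    obtain v0 where v0: "v0 \<in> A" using less.prems(2) by blast
    define a :: "'a \<Rightarrow> 'a \<times> 'a \<Rightarrow> real" where "a v e = of_bool (fst e = v) - of_bool (snd e = v)" for v e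
    \<comment> \<open>The balance at \<open>v0\<close> follows from the other balances, since each
      edge contributes 0 in total. Omitting it leaves fewer equations than edges even if
      \<open>card E = card A\<close>.\<close>
    have "card (A - {v0}) < card E" using AE finA v0 by (meson card_Diff1_less less_le_trans)
    then obtain z where z: "\<exists>e\<in>E. z e \<noteq> 0" and zA: "\<forall>v\<in>A-{v0}. (\<Sum>e\<in>E. a v e * z e) = 0"
      using homogeneous_system[of "A - {v0}" E a] finA finE by blast
    have "(\<Sum>v\<in>A. \<Sum>e\<in>E. a v e * z e) = (\<Sum>e\<in>E. \<Sum>v\<in>A. a v e * z e)" by (rule sum.swap)
    also have "\<dots> = 0"
    proof (rule sum.neutral, rule ballI)
      fix e assume "e \<in> E"
      then have "(\<Sum>v\<in>A. a v e) = 0"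
        using finA by (auto simp: a_def E_def sum_subtractf of_bool_def)
      then show "(\<Sum>v\<in>A. a v e * z e) = 0" by (simp flip: sum_distrib_right)
    qed
    finally have "(\<Sum>e\<in>E. a v0 e * z e) = 0" using zA finA v0 by (simp add: sum.remove)
    then have circ: "(\<Sum>e\<in>E. a v e * z e) = 0" if "v \<in> A" for v using zA that by blast
    have "\<exists>l. (\<forall>e\<in>E. 0 \<le> case_prod g e + l * z e) \<and> (\<exists>e\<in>E. case_prod g e + l * z e = 0) \<and>
        l * (\<Sum>e\<in>E. case_prod D e * z e) \<le> 0"
      using finE z D0 by (intro reduce_support) (auto simp: E_def)
    then obtain l where l: "\<forall>e\<in>E. 0 \<le> case_prod g e + l * z e"
      "\<exists>e\<in>E. case_prod g e + l * z e = 0" "l * (\<Sum>e\<in>E. case_prod D e * z e) \<le> 0" by blast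
    define h where "h i j = (if (i, j) \<in> E then z (i, j) else 0)" for i j
    define g' where "g' i j = g i j + l * h i j" for i j
    have sumE: "(\<Sum>i\<in>A. \<Sum>j\<in>A. w i j * h i j) = (\<Sum>e\<in>E. case_prod w e * z e)" for w
    proof -
      have "(\<Sum>i\<in>A. \<Sum>j\<in>A. w i j * h i j) = (\<Sum>e\<in>A \<times> A. case_prod w e * case_prod h e)"
        using finA by (simp add: sum.cartesian_product case_prod_unfold)
      also have "\<dots> = (\<Sum>e\<in>E. case_prod w e * z e)"
        using finA by (intro sum.mono_neutral_cong_right) (auto simp: E_def h_def split: if_splits)
      finally show ?thesis .
    qed
    have h_net: "(\<Sum>j\<in>A. h v j) - (\<Sum>j\<in>A. h j v) = 0" if v: "v \<in> A" for v
    proof -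
      have "(\<Sum>i\<in>A. \<Sum>j\<in>A. of_bool (i = v) * h i j) = (\<Sum>i\<in>A. if i = v then \<Sum>j\<in>A. h i j else 0)"
        by (intro sum.cong) auto
      then have "(\<Sum>j\<in>A. h v j) = (\<Sum>i\<in>A. \<Sum>j\<in>A. of_bool (i = v) * h i j)"
        using v finA by simp
      moreover have "(\<Sum>i\<in>A. \<Sum>j\<in>A. of_bool (j = v) * h i j) = (\<Sum>i\<in>A. \<Sum>j\<in>A. if j = v then h i j else 0)"
        by (intro sum.cong) auto
      then have "(\<Sum>j\<in>A. h j v) = (\<Sum>i\<in>A. \<Sum>j\<in>A. of_bool (j = v) * h i j)"
        using v finA by simp
      ultimately have "(\<Sum>j\<in>A. h v j) - (\<Sum>j\<in>A. h j v) = (\<Sum>i\<in>A. \<Sum>j\<in>A. (of_bool (i = v) - of_bool (j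
        = v)) * h i j)"
        by (simp add: sum_subtractf left_diff_distrib)
      also have "\<dots> = (\<Sum>e\<in>E. a v e * z e)" by (subst sumE) (simp add: a_def case_prod_unfold)
      finally show ?thesis using circ[OF v] by simp
    qed
    have net': "(\<Sum>j\<in>A. g' v j) - (\<Sum>j\<in>A. g' j v) = b v" if v: "v \<in> A" for v
    proof -
      have "(\<Sum>j\<in>A. g' v j) - (\<Sum>j\<in>A. g' j v) =
          ((\<Sum>j\<in>A. g v j) - (\<Sum>j\<in>A. g j v)) + l * ((\<Sum>j\<in>A. h v j) - (\<Sum>j\<in>A. h j v))"
        by (simp add: g'_def sum.distrib sum_distrib_left right_diff_distrib)
      then show ?thesis using h_net[OF v] net[OF v] by simp
    qed
    have g'0: "0 \<le> g' i j" if "i \<in> A" "j \<in> A" for i j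
      using l(1) g0[OF that] by (auto simp: g'_def h_def)
    let ?E' = "{e \<in> A \<times> A. fst e \<noteq> snd e \<and> 0 < g' (fst e) (snd e)}"
    obtain x where x: "x \<in> E" "case_prod g x + l * z x = 0" using l(2) by blast
    \<comment> \<open>Pairs outside \<open>E\<close> keep their flow and \<open>x\<close> loses all
      of its own, so the measure drops.\<close>
    have "?E' \<subseteq> E - {x}"
    proof
      fix e assume e: "e \<in> ?E'"
      have "e \<in> E"
      proof (rule ccontr)
        assume "e \<notin> E"
        then show False using e by (cases e) (auto simp: g'_def h_def E_def)
      qed
      moreover have "e \<noteq> x" using e x by (cases x) (auto simp: g'_def h_def)
      ultimately show "e \<in> E - {x}" by simp
    qed
    then have "card ?E' \<le> card (E - {x})" using finE by (intro card_mono) auto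
    also have "\<dots> < card E" using finE x by (meson card_Diff1_less)
    finally have lt: "card A + card ?E' < card A + card E" by simp
    have "\<exists>r c. tree_cost b D A r c \<and> c \<le> (\<Sum>i\<in>A. \<Sum>j\<in>A. D i j * g' i j)"
      by (rule less.hyps[OF lt[unfolded E_def]]) (use finA less.prems(2) D0 Dsym g'0 net' in auto)
    moreover have "(\<Sum>i\<in>A. \<Sum>j\<in>A. D i j * g' i j) \<le> (\<Sum>i\<in>A. \<Sum>j\<in>A. D i j * g i j)"
    proof -
      have "(\<Sum>i\<in>A. \<Sum>j\<in>A. D i j * g' i j) = (\<Sum>i\<in>A. \<Sum>j\<in>A. D i j * g i j) + l * (\<Sum>i\<in>A. \<Sum>j\<in>A. D i j * h i j)"
        by (simp add: g'_def sum.distrib sum_distrib_left algebra_simps)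
      then show ?thesis using l(3) sumE[of D] by simp
    qed
    ultimately show ?thesis by (meson order_trans)
  qed
qed

section \<open>Transport plans of bounded cost\<close>

text \<open>The cost is only bounded by \<open>c\<close>, so plans compose without reference to an
  attained minimum. Separate index sets admit plans from rows to sensitive values.\<close>

definition transport ::
  "'a set \<Rightarrow> 'b set \<Rightarrow> ('a \<Rightarrow> 'b \<Rightarrow> real) \<Rightarrow> ('a \<Rightarrow> real) \<Rightarrow> ('b \<Rightarrow> real) \<Rightarrow> real \<Rightarrow> bool" where
  "transport I J D X Y c \<longleftrightarrow> (\<exists>f. (\<forall>i\<in>I. \<forall>j\<in>J. 0 \<le> f i j) \<and> (\<forall>i\<in>I. (\<Sum>j\<in>J. f i j) = X i) \<and>
     (\<forall>j\<in>J. (\<Sum>i\<in>I. f i j) = Y j) \<and> (\<Sum>i\<in>I. \<Sum>j\<in>J. D i j * f i j) \<le> c)"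

lemma transportI:
  assumes "\<And>i j. i \<in> I \<Longrightarrow> j \<in> J \<Longrightarrow> 0 \<le> f i j" "\<And>i. i \<in> I \<Longrightarrow> (\<Sum>j\<in>J. f i j) = X i"
    "\<And>j. j \<in> J \<Longrightarrow> (\<Sum>i\<in>I. f i j) = Y j" "(\<Sum>i\<in>I. \<Sum>j\<in>J. D i j * f i j) \<le> c"
  shows "transport I J D X Y c"
  unfolding transport_def using assms by blast

text \<open>The gluing lemma of optimal transport: the three-index plan
  \<open>f i j * g j k / Y j\<close> has both given plans as marginals, and forgetting the middle
  index costs no more by the triangle inequality.\<close>

lemma transport_glue:
  assumes fin: "finite I" "finite J" "finite K"
    and XY: "transport I J D X Y c" and YZ: "transport J K D' Y Z c'"
    and tri: "\<And>i j k. i \<in> I \<Longrightarrow> j \<in> J \<Longrightarrow> k \<in> K \<Longrightarrow> D'' i k \<le> D i j + D' j k"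
  shows "transport I K D'' X Z (c + c')"
proof -
  from XY obtain f where f0: "\<And>i j. i \<in> I \<Longrightarrow> j \<in> J \<Longrightarrow> 0 \<le> f i j"
    and fX: "\<And>i. i \<in> I \<Longrightarrow> (\<Sum>j\<in>J. f i j) = X i" and fY: "\<And>j. j \<in> J \<Longrightarrow> (\<Sum>i\<in>I. f i j) = Y j"
    and fc: "(\<Sum>i\<in>I. \<Sum>j\<in>J. D i j * f i j) \<le> c"
    unfolding transport_def by blast
  from YZ obtain g where g0: "\<And>j k. j \<in> J \<Longrightarrow> k \<in> K \<Longrightarrow> 0 \<le> g j k"
    and gY: "\<And>j. j \<in> J \<Longrightarrow> (\<Sum>k\<in>K. g j k) = Y j" and gZ: "\<And>k. k \<in> K \<Longrightarrow> (\<Sum>j\<in>J. g j k) = Z k"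
    and gc: "(\<Sum>j\<in>J. \<Sum>k\<in>K. D' j k * g j k) \<le> c'"
    unfolding transport_def by blast
  have Y0: "0 \<le> Y j" if "j \<in> J" for j using sum_nonneg[of I "\<lambda>i. f i j"] fY[OF that] f0 that by simp
  define h where "h i j k = f i j * g j k / Y j" for i j k
  have h0: "0 \<le> h i j k" if "i \<in> I" "j \<in> J" "k \<in> K" for i j k
    using that f0 g0 Y0 by (simp add: h_def)
  have hK: "(\<Sum>k\<in>K. h i j k) = f i j" if "i \<in> I" "j \<in> J" for i j
  \<comment> \<open>Where the middle mass is zero both plans vanish, which agrees with the value
    \<open>x / 0 = 0\<close> in \<open>h\<close>.\<close>
  proof (cases "Y j = 0")
    case True
    then have "f i j = 0"
      using fY[OF that(2)] f0[OF _ that(2)] that(1) sum_nonneg_eq_0_iff[OF fin(1), of "\<lambda>i. f i j"] by simp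
    then show ?thesis by (simp add: h_def)
  next
    case False
    then show ?thesis using gY[OF that(2)]
      by (simp add: h_def flip: sum_divide_distrib sum_distrib_left)
  qed
  have hI: "(\<Sum>i\<in>I. h i j k) = g j k" if "j \<in> J" "k \<in> K" for j k
  proof (cases "Y j = 0")
    case True
    then have "g j k = 0"
      using gY[OF that(1)] g0[OF that(1)] that(2) sum_nonneg_eq_0_iff[OF fin(3), of "\<lambda>k. g j k"] by simp
    then show ?thesis by (simp add: h_def)
  next
    case False
    then show ?thesis using fY[OF that(1)]
      by (simp add: h_def flip: sum_divide_distrib sum_distrib_right)
  qed
  show ?thesis
  proof (rule transportI[where f = "\<lambda>i k. \<Sum>j\<in>J. h i j k"])
    show "(\<Sum>k\<in>K. \<Sum>j\<in>J. h i j k) = X i" if "i \<in> I" for i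
      using that by (subst sum.swap) (simp add: hK fX)
    show "(\<Sum>i\<in>I. \<Sum>j\<in>J. h i j k) = Z k" if "k \<in> K" for k
      using that by (subst sum.swap) (simp add: hI gZ)
    have "(\<Sum>i\<in>I. \<Sum>k\<in>K. D'' i k * (\<Sum>j\<in>J. h i j k)) \<le>
        (\<Sum>i\<in>I. \<Sum>k\<in>K. \<Sum>j\<in>J. D i j * h i j k + D' j k * h i j k)"
      unfolding sum_distrib_left
    proof (intro sum_mono)
      fix i k j assume a: "i \<in> I" "k \<in> K" "j \<in> J"
      have "D'' i k * h i j k \<le> (D i j + D' j k) * h i j k"
        by (rule mult_right_mono[OF tri[OF a(1,3,2)] h0[OF a(1,3,2)]])
      then show "D'' i k * h i j k \<le> D i j * h i j k + D' j k * h i j k" by (simp add: algebra_simps)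
    qed
    also have "\<dots> = (\<Sum>i\<in>I. \<Sum>k\<in>K. \<Sum>j\<in>J. D i j * h i j k) + (\<Sum>i\<in>I. \<Sum>k\<in>K. \<Sum>j\<in>J. D' j k * h i j k)"
      by (simp add: sum.distrib)
    also have "(\<Sum>i\<in>I. \<Sum>k\<in>K. \<Sum>j\<in>J. D i j * h i j k) = (\<Sum>i\<in>I. \<Sum>j\<in>J. D i j * f i j)"
    proof (rule sum.cong[OF refl])
      fix i assume i: "i \<in> I"
      have "(\<Sum>k\<in>K. \<Sum>j\<in>J. D i j * h i j k) = (\<Sum>j\<in>J. \<Sum>k\<in>K. D i j * h i j k)" by (rule sum.swap)
      also have "\<dots> = (\<Sum>j\<in>J. D i j * f i j)"
        using hK[OF i] by (intro sum.cong) (simp_all flip: sum_distrib_left)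
      finally show "(\<Sum>k\<in>K. \<Sum>j\<in>J. D i j * h i j k) = (\<Sum>j\<in>J. D i j * f i j)" .
    qed
    also have "(\<Sum>i\<in>I. \<Sum>k\<in>K. \<Sum>j\<in>J. D' j k * h i j k) = (\<Sum>k\<in>K. \<Sum>j\<in>J. \<Sum>i\<in>I. D' j k * h i j k)"
      by (subst sum.swap, rule sum.cong[OF refl], rule sum.swap)
    also have "\<dots> = (\<Sum>k\<in>K. \<Sum>j\<in>J. D' j k * g j k)"
      using hI by (intro sum.cong) (simp_all flip: sum_distrib_left)
    also have "\<dots> = (\<Sum>j\<in>J. \<Sum>k\<in>K. D' j k * g j k)" by (rule sum.swap)
    finally show "(\<Sum>i\<in>I. \<Sum>k\<in>K. D'' i k * (\<Sum>j\<in>J. h i j k)) \<le> c + c'" using fc gc by simp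
  qed (use h0 in \<open>auto intro: sum_nonneg\<close>)
qed

lemma transport_sym:
  assumes "transport I J D X Y c" "\<And>i j. i \<in> I \<Longrightarrow> j \<in> J \<Longrightarrow> D' j i = D i j"
  shows "transport J I D' Y X c"
proof -
  from assms(1) obtain f where f: "\<forall>i\<in>I. \<forall>j\<in>J. 0 \<le> f i j" "\<forall>i\<in>I. (\<Sum>j\<in>J. f i j) = X i"
    "\<forall>j\<in>J. (\<Sum>i\<in>I. f i j) = Y j" "(\<Sum>i\<in>I. \<Sum>j\<in>J. D i j * f i j) \<le> c"
    unfolding transport_def by blast
  show ?thesis
  proof (rule transportI[where f = "\<lambda>j i. f i j"])
    have "(\<Sum>j\<in>J. \<Sum>i\<in>I. D' j i * f i j) = (\<Sum>i\<in>I. \<Sum>j\<in>J. D i j * f i j)"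
      by (subst sum.swap) (simp add: assms(2))
    then show "(\<Sum>j\<in>J. \<Sum>i\<in>I. D' j i * f i j) \<le> c" using f(4) by simp
  qed (use f in auto)
qed

lemma transport_mono: "transport I J D X Y c \<Longrightarrow> c \<le> c' \<Longrightarrow> transport I J D X Y c'"
  unfolding transport_def using order_trans[of _ c c'] by fast

lemma transport_scale:
  assumes "transport I J D X Y c" "0 \<le> a"
  shows "transport I J D (\<lambda>i. a * X i) (\<lambda>j. a * Y j) (a * c)"
proof -
  from assms(1) obtain f where f: "\<forall>i\<in>I. \<forall>j\<in>J. 0 \<le> f i j" "\<forall>i\<in>I. (\<Sum>j\<in>J. f i j) = X i"
    "\<forall>j\<in>J. (\<Sum>i\<in>I. f i j) = Y j" "(\<Sum>i\<in>I. \<Sum>j\<in>J. D i j * f i j) \<le> c"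
    unfolding transport_def by blast
  show ?thesis
  proof (rule transportI[where f = "\<lambda>i j. a * f i j"])
    have "(\<Sum>i\<in>I. \<Sum>j\<in>J. D i j * (a * f i j)) = a * (\<Sum>i\<in>I. \<Sum>j\<in>J. D i j * f i j)"
      by (simp add: sum_distrib_left mult.left_commute)
    then show "(\<Sum>i\<in>I. \<Sum>j\<in>J. D i j * (a * f i j)) \<le> a * c"
      using f(4) assms(2) by (simp add: mult_left_mono)
  qed (use f assms(2) in \<open>simp_all flip: sum_distrib_left\<close>)
qed

text \<open>Row masses turn into masses of sensitive values for free this way: \<open>\<phi>\<close>
  will send a row to its sensitive value, and the second marginal is the pushforward of
  \<open>X\<close>.\<close>

lemma transport_graph:
  assumes "finite I" "finite J" "\<And>i. i \<in> I \<Longrightarrow> \<phi> i \<in> J \<and> D i (\<phi> i) = 0" "\<And>i. i \<in> I \<Longrightarrow> 0 \<le> X i"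
  shows "transport I J D X (\<lambda>j. \<Sum>i\<in>{i\<in>I. \<phi> i = j}. X i) 0"
proof (rule transportI[where f = "\<lambda>i j. if \<phi> i = j then X i else 0"])
  have "(\<Sum>i\<in>I. \<Sum>j\<in>J. D i j * (if \<phi> i = j then X i else 0)) = 0"
    using assms(3) by (intro sum.neutral ballI) auto
  then show "(\<Sum>i\<in>I. \<Sum>j\<in>J. D i j * (if \<phi> i = j then X i else 0)) \<le> 0" by simp
qed (use assms in \<open>auto simp: sum.If_cases Int_def\<close>)

lemma transport_refl:
  assumes "finite I" "\<And>i. i \<in> I \<Longrightarrow> D i i = 0" "\<And>i. i \<in> I \<Longrightarrow> 0 \<le> X i"
  shows "transport I I D X X 0"
proof (rule transportI[where f = "\<lambda>i j. if i = j then X i else 0"])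
  have "(\<Sum>i\<in>I. \<Sum>j\<in>I. D i j * (if i = j then X i else 0)) = 0"
    using assms by (intro sum.neutral ballI) auto
  then show "(\<Sum>i\<in>I. \<Sum>j\<in>I. D i j * (if i = j then X i else 0)) \<le> 0" by simp
qed (use assms in auto)

lemma transport_union:
  assumes A: "transport A A D X Y c" and B: "transport B B D X Y c'"
    and fin: "finite A" "finite B" "A \<inter> B = {}"
  shows "transport (A \<union> B) (A \<union> B) D X Y (c + c')"
proof -
  from A obtain f where f: "\<forall>i\<in>A. \<forall>j\<in>A. 0 \<le> f i j" "\<forall>i\<in>A. (\<Sum>j\<in>A. f i j) = X i"
    "\<forall>j\<in>A. (\<Sum>i\<in>A. f i j) = Y j" "(\<Sum>i\<in>A. \<Sum>j\<in>A. D i j * f i j) \<le> c"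
    unfolding transport_def by blast
  from B obtain g where g: "\<forall>i\<in>B. \<forall>j\<in>B. 0 \<le> g i j" "\<forall>i\<in>B. (\<Sum>j\<in>B. g i j) = X i"
    "\<forall>j\<in>B. (\<Sum>i\<in>B. g i j) = Y j" "(\<Sum>i\<in>B. \<Sum>j\<in>B. D i j * g i j) \<le> c'"
    unfolding transport_def by blast
  define h where "h i j = (if i \<in> A \<and> j \<in> A then f i j else if i \<in> B \<and> j \<in> B then g i j else 0)" for i j
  have un: "(\<Sum>i\<in>A\<union>B. k i) = (\<Sum>i\<in>A. k i) + (\<Sum>i\<in>B. k i)" for k :: "'a \<Rightarrow> real"
    using fin by (rule sum.union_disjoint)
  have dis: "i \<in> A \<Longrightarrow> i \<notin> B" for i using fin by blast
  have hA: "h i j = f i j" if "i \<in> A" "j \<in> A" for i j using that by (simp add: h_def)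
  have hB: "h i j = g i j" if "i \<in> B" "j \<in> B" for i j using that dis by (auto simp: h_def)
  have hAB: "h i j = 0" "h j i = 0" if "i \<in> A" "j \<in> B" for i j using that dis by (auto simp: h_def)
  show ?thesis
  proof (rule transportI[where f = h])
    show "(\<Sum>i\<in>A\<union>B. \<Sum>j\<in>A\<union>B. D i j * h i j) \<le> c + c'"
      using f(4) g(4) by (simp add: un hA hB hAB)
    show "0 \<le> h i j" for i j using f(1) g(1) by (simp add: h_def)
  qed (use f g in \<open>auto simp: un hA hB hAB\<close>)
qed

text \<open>The flow over a single tree edge: the surplus \<open>\<beta>\<close> travels from
  \<open>q\<close> to \<open>r\<close>, and all other mass rests at no cost.\<close>

lemma transport_move:
  assumes "finite I" "q \<in> I" "r \<in> I" "q \<noteq> r" "0 \<le> \<beta>" "\<And>i. i \<in> I \<Longrightarrow> D i i = 0"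
    and "\<And>i. i \<in> I \<Longrightarrow> 0 \<le> X i"
  shows "transport I I D (X(q := X q + \<beta>)) (X(r := X r + \<beta>)) (\<beta> * D q r)"
proof (rule transportI[where f = "\<lambda>i j. (if i = j then X i else 0) + (if i = q then if j
  = r then \<beta> else 0 else 0)"])
  have "(\<Sum>i\<in>I. \<Sum>j\<in>I. D i j * ((if i = j then X i else 0) + (if i = q then if j = r then \<beta> else 0 else 0)))
      = (\<Sum>i\<in>I. if i = q then \<beta> * D q r else 0)"
  proof (rule sum.cong[OF refl])
    fix i assume i: "i \<in> I"
    have "(\<Sum>j\<in>I. D i j * ((if i = j then X i else 0) + (if i = q then if j = r then \<beta> else 0 else 0)))
      = (\<Sum>j\<in>I. if j = r then (if i = q then \<beta> * D q r else 0) else 0)"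
      using i assms by (intro sum.cong) auto
    then show "(\<Sum>j\<in>I. D i j * ((if i = j then X i else 0) + (if i = q then if j = r then \<beta> else 0 else 0)))
      = (if i = q then \<beta> * D q r else 0)" using assms by simp
  qed
  then show "(\<Sum>i\<in>I. \<Sum>j\<in>I. D i j * ((if i = j then X i else 0) + (if i = q then if j
    = r then \<beta> else 0 else 0)))
     \<le> \<beta> * D q r" using assms by simp
qed (use assms in \<open>auto simp: sum.distrib\<close>)

text \<open>The flow of a \<open>join\<close> is realised in three glued stages: inside the hanging
  part, across its edge, and inside the root part. No balance is prescribed at \<open>r\<close>,
  because the edge changes the load of the root; it is determined by the equal totals. The sign
  \<open>s\<close> allows source and target to be swapped when the edge flow points into the hanging
  part.\<close>

lemma tree_cost_transport:
  assumes "tree_cost b D A r c"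
    and "\<And>i. i \<in> A \<Longrightarrow> D i i = 0"
    and "\<And>i j. i \<in> A \<Longrightarrow> j \<in> A \<Longrightarrow> D i j = D j i"
    and "\<And>i j k. i \<in> A \<Longrightarrow> j \<in> A \<Longrightarrow> k \<in> A \<Longrightarrow> D i k \<le> D i j + D j k"
    and "\<And>i. i \<in> A \<Longrightarrow> 0 \<le> X i" "\<And>i. i \<in> A \<Longrightarrow> 0 \<le> Y i"
    and "\<And>i. i \<in> A \<Longrightarrow> i \<noteq> r \<Longrightarrow> X i - Y i = s * b i" "\<bar>s\<bar> = 1"
    and "sum X A = sum Y A"
  shows "transport A A D X Y c"
  using assms
proof (induction arbitrary: X Y s rule: tree_cost.induct)
  case (single r)
  have "X r = Y r" using single by simp
  then have "transport {r} {r} D X Y 0 = transport {r} {r} D X X 0" by (simp add: transport_def)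
  then show ?case using transport_refl[of "{r}" D X] single by simp
next
  case (join A r c B q c')
  have fin: "finite A" "finite B"
    using tree_cost_finite[OF join.hyps(1)] tree_cost_finite[OF join.hyps(2)] by auto
  have rA: "r \<in> A" and qB: "q \<in> B"
    using tree_cost_root[OF join.hyps(1)] tree_cost_root[OF join.hyps(2)] by auto
  have dis: "\<And>i. i \<in> A \<Longrightarrow> i \<notin> B" using join.hyps by blast
  have un: "(\<Sum>i\<in>A\<union>B. k i) = (\<Sum>i\<in>A. k i) + (\<Sum>i\<in>B. k i)" for k :: "'a \<Rightarrow> real"
    using fin join.hyps(3) by (rule sum.union_disjoint)
  have upd: "sum (k(p := k p + x)) J = sum k J + x" if "finite J" "p \<in> J" for k :: "'a \<Rightarrow> real" and p x J
  proof -
    have "sum (k(p := k p + x)) J = (\<Sum>i\<in>J. k i + (if i = p then x else 0))"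
      by (rule sum.cong) auto
    then show ?thesis using that by (simp add: sum.distrib)
  qed
  note D0 = join.prems(1) and Dsym = join.prems(2) and tri = join.prems(3)
  have main: "transport (A \<union> B) (A \<union> B) D X Y (c + c' + \<bar>sum b B\<bar> * D r q)"
    if X0: "\<And>i. i \<in> A \<union> B \<Longrightarrow> 0 \<le> X i" and Y0: "\<And>i. i \<in> A \<union> B \<Longrightarrow> 0 \<le> Y i"
      and bal: "\<And>i. i \<in> A \<union> B \<Longrightarrow> i \<noteq> r \<Longrightarrow> X i - Y i = s * b i" and s: "\<bar>s\<bar> = 1"
      and tot: "sum X (A \<union> B) = sum Y (A \<union> B)" and pos: "0 \<le> s * sum b B" for X Y s
  proof -
    define \<beta> where "\<beta> = s * sum b B"
    have \<beta>: "0 \<le> \<beta>" "\<bar>sum b B\<bar> = \<beta>" using pos s by (auto simp: \<beta>_def abs_if split: if_splits)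
    have "sum X B - sum Y B = (\<Sum>i\<in>B. X i - Y i)" by (simp add: sum_subtractf)
    also have "\<dots> = (\<Sum>i\<in>B. s * b i)" using bal dis rA by (intro sum.cong) auto
    finally have XYB: "sum X B = sum Y B + \<beta>" by (simp add: \<beta>_def sum_distrib_left)
    then have XYA: "sum X A + \<beta> = sum Y A" using tot by (simp add: un)
    \<comment> \<open>The intermediate mass: \<open>B\<close> has reached its target and
      \<open>A\<close> is untouched, while the surplus \<open>\<beta>\<close> sits first at
      \<open>q\<close> and then at \<open>r\<close>. All masses along the way are
      nonnegative.\<close>
    define Z where "Z i = (if i \<in> A then X i else Y i)" for i
    have Z0: "\<And>i. i \<in> A \<union> B \<Longrightarrow> 0 \<le> Z i" using X0 Y0 by (auto simp: Z_def)
    have ZB: "Z i = Y i" if "i \<in> B" for i using that dis by (auto simp: Z_def)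
    have sZA: "sum Z A = sum X A" by (rule sum.cong) (auto simp: Z_def)
    have sZB: "sum Z B = sum Y B" by (rule sum.cong) (auto simp: ZB)
    have qr: "q \<noteq> r" using dis rA qB by blast
    have cong: "transport J J D U V x \<Longrightarrow> (\<And>i. i \<in> J \<Longrightarrow> U i = U' i) \<Longrightarrow> (\<And>i. i \<in> J \<Longrightarrow> V i = V' i) \<Longrightarrow>
        transport J J D U' V' x" for J U V U' V' x by (simp add: transport_def)
    have "transport B B D X (Z(q := Z q + \<beta>)) c'"
    proof (rule join.IH(2)[of X _ s])
      show "sum X B = sum (Z(q := Z q + \<beta>)) B" using XYB upd[OF fin(2) qB, of Z \<beta>] sZB by simp
      show "X i - (Z(q := Z q + \<beta>)) i = s * b i" if "i \<in> B" "i \<noteq> q" for i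
        using that bal[of i] ZB dis rA by auto
      show "0 \<le> (Z(q := Z q + \<beta>)) i" if "i \<in> B" for i using that Z0[of i] \<beta> by auto
    qed (use D0 Dsym tri X0 s in auto)
    moreover have "transport A A D X (Z(q := Z q + \<beta>)) 0"
      by (rule cong[OF transport_refl[of A D X]]) (use fin D0 X0 qB dis in \<open>auto simp: Z_def\<close>)
    ultimately have 1: "transport (A \<union> B) (A \<union> B) D X (Z(q := Z q + \<beta>)) (0 + c')"
      using transport_union fin join.hyps(3) by blast
    have 2: "transport (A \<union> B) (A \<union> B) D (Z(q := Z q + \<beta>)) (Z(r := Z r + \<beta>)) (\<beta> * D q r)"
      by (rule transport_move) (use fin rA qB qr \<beta> D0 Z0 in auto)
    have "transport A A D (Z(r := Z r + \<beta>)) Y c"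
    proof (rule join.IH(1)[of _ Y s])
      show "sum (Z(r := Z r + \<beta>)) A = sum Y A" using XYA upd[OF fin(1) rA, of Z \<beta>] sZA by simp
      show "(Z(r := Z r + \<beta>)) i - Y i = s * b i" if "i \<in> A" "i \<noteq> r" for i
        using that bal[of i] by (auto simp: Z_def)
      show "0 \<le> (Z(r := Z r + \<beta>)) i" if "i \<in> A" for i using that Z0[of i] \<beta> by auto
    qed (use D0 Dsym tri Y0 s in auto)
    moreover have "transport B B D (Z(r := Z r + \<beta>)) Y 0"
      by (rule cong[OF transport_refl[of B D Y]]) (use fin D0 Y0 rA dis in \<open>auto simp: ZB\<close>)
    ultimately have 3: "transport (A \<union> B) (A \<union> B) D (Z(r := Z r + \<beta>)) Y (c + 0)"
      using transport_union fin join.hyps(3) by blast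
    have "transport (A \<union> B) (A \<union> B) D X Y ((0 + c') + (\<beta> * D q r + (c + 0)))"
      by (intro transport_glue[OF _ _ _ 1] transport_glue[OF _ _ _ 2 3]) (use fin tri in auto)
    moreover have "D q r = D r q" using Dsym rA qB by simp
    ultimately show ?thesis using \<beta>(2) by (simp add: algebra_simps)
  qed
  show ?case
  proof (cases "0 \<le> s * sum b B")
    case True
    then show ?thesis using main[of X Y s] join.prems by simp
  next
    case False
    then have "transport (A \<union> B) (A \<union> B) D Y X (c + c' + \<bar>sum b B\<bar> * D r q)"
    proof (intro main[of Y X "-s"])
      show "Y i - X i = - s * b i" if "i \<in> A \<union> B" "i \<noteq> r" for i
        using join.prems(6)[OF that] by simp
      show "\<bar>- s\<bar> = 1" using join.prems(7) by simp
    qed (use join.prems(4,5,8) False in auto)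
    then show ?thesis by (rule transport_sym) (use Dsym in auto)
  qed
qed

lemma transport_tree_cost:
  fixes D :: "'a \<Rightarrow> 'a \<Rightarrow> real"
  assumes "transport A A D X Y c" "finite A" "A \<noteq> {}"
    and "\<And>i j. i \<in> A \<Longrightarrow> j \<in> A \<Longrightarrow> 0 \<le> D i j"
    and "\<And>i j. i \<in> A \<Longrightarrow> j \<in> A \<Longrightarrow> D i j = D j i"
  shows "\<exists>r c'. tree_cost (\<lambda>i. X i - Y i) D A r c' \<and> c' \<le> c"
proof -
  from assms(1) obtain f where f: "\<forall>i\<in>A. \<forall>j\<in>A. 0 \<le> f i j" "\<forall>i\<in>A. (\<Sum>j\<in>A. f i j) = X i"
    "\<forall>j\<in>A. (\<Sum>i\<in>A. f i j) = Y j" "(\<Sum>i\<in>A. \<Sum>j\<in>A. D i j * f i j) \<le> c"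
    unfolding transport_def by blast
  have "\<exists>r c'. tree_cost (\<lambda>i. X i - Y i) D A r c' \<and> c' \<le> (\<Sum>i\<in>A. \<Sum>j\<in>A. D i j * f i j)"
    by (rule tree_cost_le_flow_cost) (use assms f in auto)
  then show ?thesis using f(4) order_trans by blast
qed

text \<open>Groups are handled as sets of row positions: equal rows stay distinguishable, and a
  group can be coded by a bit mask.\<close>

definition subtable :: "row list \<Rightarrow> nat set \<Rightarrow> table" where
  "subtable rs B = image_mset ((!) rs) (mset_set B)"

lemma sa_distribution_subtable:
  assumes "finite B"
  shows "sa_distribution m (subtable rs B) a = real (card {i \<in> B. rs ! i ! m = a}) / real (card B)"
proof -
  have "count (image_mset (\<lambda>i. rs ! i ! m) (mset_set B)) a = card {i \<in> B. rs ! i ! m = a}"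
    using assms by (simp add: count_image_mset' Collect_conj_eq[symmetric] conj_commute eq_commute)
  then show ?thesis
    by (simp add: sa_distribution_def subtable_def image_mset.compositionality comp_def)
qed

lemma mset_eq_subtable: "mset rs = subtable rs {..<length rs}"
  unfolding subtable_def by (metis map_nth mset_map mset_upt lessThan_atLeast0)

section \<open>Running times of while-programs\<close>

abbreviation V :: "name \<Rightarrow> nexp" where "V x \<equiv> Cell x (Num 0) (Num 0)"

definition For :: "name \<Rightarrow> nexp \<Rightarrow> com \<Rightarrow> com" where
  "For x e c = Seq (Assign x (Num 0) (Num 0) (Num 0))
     (While (LessN (V x) e) (Seq c (Assign x (Num 0) (Num 0) (Plus (V x) (Num 1)))))"

text \<open>
  Loops over the columns run \<open>m\<close> times. All other loops run at most \<open>n\<^sup>2\<close> or \<open>2\<^sup>n\<close> times, hence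
  at most \<open>4\<^sup>n\<close> times; \<open>n\<^sup>2\<close> occurs because products are computed by repeated addition.
\<close>

definition column_loop :: "bexp \<Rightarrow> bool" where
  "column_loop b \<longleftrightarrow> (\<exists>x. b = LessN (V x) (V ''m''))"

definition iterations :: "nat \<Rightarrow> nat \<Rightarrow> bexp \<Rightarrow> nat" where
  "iterations n m b = (if column_loop b then m else 4 ^ n)"

text \<open>Read off the syntax alone, so that one function of \<open>n\<close> and \<open>m\<close>
  bounds the runs on all instances. Both branches of a conditional are charged, which avoids a
  maximum.\<close>

fun time_bound :: "nat \<Rightarrow> nat \<Rightarrow> com \<Rightarrow> nat" where
  "time_bound n m Skip = 1"
| "time_bound n m (Assign x i j a) = ncost i + ncost j + ncost a + 1"
| "time_bound n m (RAssign x i j a) = ncost i + ncost j + rcost a + 1"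
| "time_bound n m (Seq c c') = time_bound n m c + time_bound n m c'"
| "time_bound n m (Cond b c c') = bcost b + time_bound n m c + time_bound n m c' + 1"
| "time_bound n m (While b c) =
     iterations n m b * (bcost b + time_bound n m c + 1) + bcost b + 1"

fun writes :: "com \<Rightarrow> name set" where
  "writes Skip = {}"
| "writes (Assign x i j a) = {x}"
| "writes (RAssign x i j a) = {x}"
| "writes (Seq c c') = writes c \<union> writes c'"
| "writes (Cond b c c') = writes c \<union> writes c'"
| "writes (While b c) = writes c"

lemma writes_For [simp]: "writes (For x e c) = insert x (writes c)"
  by (auto simp: For_def)

definition agree :: "name set \<Rightarrow> state \<Rightarrow> state \<Rightarrow> bool" where
  "agree X s s' \<longleftrightarrow> (\<forall>y. y \<notin> X \<longrightarrow> nmem s' y = nmem s y \<and> rmem s' y = rmem s y)"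

lemma agree_nmem: "agree X s s' \<Longrightarrow> y \<notin> X \<Longrightarrow> nmem s' y = nmem s y"
  by (simp add: agree_def)

lemma agree_refl: "agree X s s"
  by (simp add: agree_def)

lemma agree_trans: "agree X s s' \<Longrightarrow> agree X s' s'' \<Longrightarrow> agree X s s''"
  by (simp add: agree_def)

lemma agree_mono: "agree X s s' \<Longrightarrow> X \<subseteq> Y \<Longrightarrow> agree Y s s'"
  by (auto simp: agree_def)

lemma nmem_set_ncell [simp]:
  "nmem (set_ncell x i j v s) y a b = (if y = x \<and> a = i \<and> b = j then v else nmem s y a b)"
  "y \<noteq> x \<Longrightarrow> nmem (set_ncell x i j v s) y = nmem s y"
  "rmem (set_ncell x i j v s) = rmem s"
  by (auto simp: set_ncell_def)

lemma rmem_set_rcell [simp]: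
  "rmem (set_rcell x i j v s) y a b = (if y = x \<and> a = i \<and> b = j then v else rmem s y a b)"
  "y \<noteq> x \<Longrightarrow> rmem (set_rcell x i j v s) y = rmem s y"
  "nmem (set_rcell x i j v s) = nmem s"
  by (auto simp: set_rcell_def)

lemma agree_set_ncell: "x \<in> X \<Longrightarrow> agree X s (set_ncell x i j v s)"
  and agree_set_rcell: "x \<in> X \<Longrightarrow> agree X s (set_rcell x i j w s)"
  by (auto simp: agree_def set_ncell_def set_rcell_def)

lemma exec_agree: "exec c s k s' \<Longrightarrow> agree (writes c) s s'"
proof (induction rule: exec.induct)
  case (Seq c1 s k1 s' c2 k2 s'')
  then show ?case by (auto intro: agree_trans agree_mono)
qed (auto simp: agree_refl agree_set_ncell agree_set_rcell intro: agree_mono agree_trans)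

locale time_bounds =
  fixes n m :: nat
begin

text \<open>Total correctness together with the syntactic time bound. With the rules below no part
  of the program has to count steps; only the number of rounds of each loop is checked.\<close>

definition wp :: "com \<Rightarrow> (state \<Rightarrow> bool) \<Rightarrow> state \<Rightarrow> bool" where
  "wp c Q s \<longleftrightarrow> (\<exists>k s'. exec c s k s' \<and> k \<le> time_bound n m c \<and> Q s')"

lemma wpI: "exec c s k s' \<Longrightarrow> k \<le> time_bound n m c \<Longrightarrow> Q s' \<Longrightarrow> wp c Q s"
  unfolding wp_def by blast

lemma wp_conseq:
  assumes "wp c Q s" "\<And>s'. agree (writes c) s s' \<Longrightarrow> Q s' \<Longrightarrow> R s'"
  shows "wp c R s"
  using assms exec_agree unfolding wp_def by blast

lemma wp_Skip: "Q s \<Longrightarrow> wp Skip Q s"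
  by (rule wpI[OF exec.Skip]) auto

lemma wp_Assign: "Q (set_ncell x (nval i s) (nval j s) (nval a s) s) \<Longrightarrow> wp (Assign x i j a) Q s"
  by (rule wpI[OF exec.Assign]) auto

lemma wp_RAssign: "Q (set_rcell x (nval i s) (nval j s) (rval a s) s) \<Longrightarrow> wp (RAssign x i j a) Q s"
  by (rule wpI[OF exec.RAssign]) auto

lemma wp_Seq:
  assumes "wp c (wp c' Q) s"
  shows "wp (Seq c c') Q s"
proof -
  from assms obtain k1 s1 k2 s2 where "exec c s k1 s1" "k1 \<le> time_bound n m c"
    "exec c' s1 k2 s2" "k2 \<le> time_bound n m c'" "Q s2" unfolding wp_def by blast
  then show ?thesis by (intro wpI[OF exec.Seq]) auto
qed

lemma wp_Cond:
  assumes "bval b s \<Longrightarrow> wp c Q s" "\<not> bval b s \<Longrightarrow> wp c' Q s"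
  shows "wp (Cond b c c') Q s"
proof (cases "bval b s")
  case True
  with assms(1) obtain k s' where "exec c s k s'" "k \<le> time_bound n m c" "Q s'"
    unfolding wp_def by blast
  with wpI[OF exec.CondTrue[OF True this(1)]] show ?thesis by simp
next
  case False
  with assms(2) obtain k s' where "exec c' s k s'" "k \<le> time_bound n m c'" "Q s'"
    unfolding wp_def by blast
  with wpI[OF exec.CondFalse[OF False this(1)]] show ?thesis by simp
qed

lemmas wp_intros = wp_Skip wp_Assign wp_RAssign wp_Seq wp_Cond

text \<open>The guard must fail exactly at index \<open>N\<close>, so there are exactly
  \<open>N\<close> rounds. The time is counted by the rounds still to come, each of which costs at
  most \<open>K\<close>.\<close>

lemma wp_While:
  fixes N :: nat and b c
  defines "K \<equiv> bcost b + time_bound n m c + 1"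
  assumes bound: "N \<le> iterations n m b"
    and init: "I 0 s"
    and guard: "\<And>i s'. I i s' \<Longrightarrow> i \<le> N \<Longrightarrow> bval b s' \<longleftrightarrow> i < N"
    and body: "\<And>i s'. i < N \<Longrightarrow> I i s' \<Longrightarrow> wp c (I (Suc i)) s'"
  shows "wp (While b c) (I N) s"
proof -
  have "\<exists>k s''. exec (While b c) s' k s'' \<and> k \<le> (N - i) * K + bcost b + 1 \<and> I N s''"
    if "i \<le> N" "I i s'" for i s'
    using that
  proof (induction i arbitrary: s' rule: inc_induct)
    case base
    then have "\<not> bval b s'" using guard by blast
    from exec.WhileFalse[OF this, of c] show ?case using base by (intro exI conjI) auto
  next
    case (step i)
    then have b: "bval b s'" using guard[of i s'] by simp
    from body[OF step.hyps(2) step.prems] obtain k1 s1 where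
      1: "exec c s' k1 s1" "k1 \<le> time_bound n m c" "I (Suc i) s1" unfolding wp_def by blast
    from step.IH[OF 1(3)] obtain k2 s2 where
      2: "exec (While b c) s1 k2 s2" "k2 \<le> (N - Suc i) * K + bcost b + 1" "I N s2" by blast
    have "N - i = Suc (N - Suc i)" using step.hyps by simp
    then have "bcost b + k1 + k2 + 1 \<le> (N - i) * K + bcost b + 1"
      using 1(2) 2(2) by (simp add: K_def)
    with exec.WhileTrue[OF b 1(1) 2(1)] 2(3) show ?case by blast
  qed
  from this[OF _ init] obtain k s'' where k: "exec (While b c) s k s''" "k \<le> N * K + bcost b + 1" "I N s''"
    by auto
  have "N * K \<le> iterations n m b * K" using bound by (rule mult_right_mono) simp
  with k show ?thesis by (intro wpI[OF k(1)]) (auto simp: K_def)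
qed

text \<open>The invariant must ignore the counter cell, which the loop itself resets and increments;
  the value of the counter and all untouched arrays are supplied separately, the latter by
  \<open>agree\<close>. When \<open>goal_cases\<close> follows this rule, case 4 is the entry of the
  loop, case 6 the body and case 7 the exit.\<close>

lemma wp_For:
  assumes x: "x \<notin> writes c"
    and e: "\<And>s'. agree (insert x (writes c)) s s' \<Longrightarrow> nval e s' = N"
    and bound: "N \<le> iterations n m (LessN (V x) e)"
    and init: "I 0 s"
    and indep: "\<And>i v s'. I i s' \<Longrightarrow> I i (set_ncell x 0 0 v s')"
    and body: "\<And>i s'. i < N \<Longrightarrow> I i s' \<Longrightarrow> nmem s' x 0 0 = i \<Longrightarrow>
                agree (insert x (writes c)) s s' \<Longrightarrow> wp c (I (Suc i)) s'"
    and final: "\<And>s'. I N s' \<Longrightarrow> agree (insert x (writes c)) s s' \<Longrightarrow> Q s'"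
  shows "wp (For x e c) Q s"
proof -
  let ?X = "insert x (writes c)"
  let ?I = "\<lambda>i s'. I i s' \<and> nmem s' x 0 0 = i \<and> agree ?X s s'"
  have "wp (While (LessN (V x) e) (Seq c (Assign x (Num 0) (Num 0) (Plus (V x) (Num 1)))))
      (?I N) (set_ncell x 0 0 0 s)"
  proof (rule wp_While)
    show "?I 0 (set_ncell x 0 0 0 s)" using init indep agree_set_ncell[of x ?X] by auto
    show "bval (LessN (V x) e) s' = (i < N)" if "?I i s'" for i s' using that e by auto
    show "wp (Seq c (Assign x (Num 0) (Num 0) (Plus (V x) (Num 1)))) (?I (Suc i)) s'"
      if i: "i < N" and s': "?I i s'" for i s'
    proof (rule wp_Seq, rule wp_conseq)
      show "wp c (I (Suc i)) s'" using body i s' by blast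
      fix s'' assume s'': "agree (writes c) s' s''" "I (Suc i) s''"
      have nx: "nmem s'' x 0 0 = i" using agree_nmem[OF s''(1) x] s' by simp
      have "agree ?X s s''" using s' agree_mono[OF s''(1), of ?X] agree_trans by blast
      then have "agree ?X s (set_ncell x 0 0 (Suc i) s'')"
        using agree_set_ncell[of x ?X s''] agree_trans by blast
      then show "wp (Assign x (Num 0) (Num 0) (Plus (V x) (Num 1))) (?I (Suc i)) s''"
        using indep[OF s''(2)] nx by (intro wp_Assign) simp
    qed
  qed (rule bound)
  then have "wp (While (LessN (V x) e) (Seq c (Assign x (Num 0) (Num 0) (Plus (V x) (Num 1))))) Q
      (set_ncell x 0 0 0 s)"
    by (rule wp_conseq) (use final in blast)
  then show ?thesis unfolding For_def by (intro wp_Seq wp_Assign) simp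
qed

end

section \<open>A syntactic criterion for time exponential in \<open>n\<close> and linear in
  \<open>m\<close>\<close>

fun column_free :: "com \<Rightarrow> bool" where
  "column_free (Seq c c') \<longleftrightarrow> column_free c \<and> column_free c'"
| "column_free (Cond b c c') \<longleftrightarrow> column_free c \<and> column_free c'"
| "column_free (While b c) \<longleftrightarrow> \<not> column_loop b \<and> column_free c"
| "column_free _ \<longleftrightarrow> True"

text \<open>A column loop may sit inside other loops, but its own body must be column-free: nested
  column loops would produce a higher power of \<open>m\<close>.\<close>

fun column_linear :: "com \<Rightarrow> bool" where
  "column_linear (Seq c c') \<longleftrightarrow> column_linear c \<and> column_linear c'"
| "column_linear (Cond b c c') \<longleftrightarrow> column_linear c \<and> column_linear c'"
| "column_linear (While b c) \<longleftrightarrow> (if column_loop b then column_free c else column_linear c)"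
| "column_linear _ \<longleftrightarrow> True"

text \<open>Functions of the form \<open>2 ^ O(n)\<close>. The exponent has \<open>n + 1\<close> so
  that constants fit at \<open>n = 0\<close> as well, which closes the class under sums and products
  without exceptions.\<close>

definition exp_bounded :: "(nat \<Rightarrow> nat) \<Rightarrow> bool" where
  "exp_bounded F \<longleftrightarrow> (\<exists>a. \<forall>n. F n \<le> 2 ^ (a * (n + 1)))"

lemma exp_bounded_const: "exp_bounded (\<lambda>n. k)"
  unfolding exp_bounded_def
proof (intro exI allI)
  fix n
  have "k \<le> k * (n + 1)" by simp
  also have "\<dots> \<le> 2 ^ (k * (n + 1))" by (simp add: less_imp_le)
  finally show "k \<le> 2 ^ (k * (n + 1))" .
qed

lemma exp_bounded_mult:
  assumes "exp_bounded F" "exp_bounded G"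
  shows "exp_bounded (\<lambda>n. F n * G n)"
proof -
  from assms obtain a b where "\<forall>n. F n \<le> 2 ^ (a * (n + 1))" "\<forall>n. G n \<le> 2 ^ (b * (n + 1))"
    unfolding exp_bounded_def by blast
  then have "F n * G n \<le> 2 ^ (a * (n + 1)) * 2 ^ (b * (n + 1))" for n
    by (intro mult_mono) auto
  then have "\<forall>n. F n * G n \<le> 2 ^ ((a + b) * (n + 1))"
    by (simp only: distrib_right power_add simp_thms)
  then show ?thesis unfolding exp_bounded_def by blast
qed

lemma exp_bounded_add:
  assumes "exp_bounded F" "exp_bounded G"
  shows "exp_bounded (\<lambda>n. F n + G n)"
proof -
  from assms obtain a b where ab: "(\<forall>n. F n \<le> 2 ^ (a * (n + 1))) \<and> (\<forall>n. G n \<le> 2 ^ (b * (n + 1)))"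
    unfolding exp_bounded_def by blast
  have "F n + G n \<le> 2 ^ ((a + b + 1) * (n + 1))" for n
  proof -
    have "(2::nat) ^ (a * (n + 1)) \<le> 2 ^ ((a + b) * (n + 1))"
      and "(2::nat) ^ (b * (n + 1)) \<le> 2 ^ ((a + b) * (n + 1))"
      by (intro power_increasing mult_right_mono; simp)+
    then have "F n + G n \<le> 2 * 2 ^ ((a + b) * (n + 1))"
      using ab[THEN conjunct1, THEN spec, of n] ab[THEN conjunct2, THEN spec, of n] by linarith
    also have "\<dots> = 2 ^ ((a + b) * (n + 1) + 1)" by simp
    also have "\<dots> \<le> 2 ^ ((a + b + 1) * (n + 1))" by (intro power_increasing) auto
    finally show ?thesis .
  qed
  then show ?thesis unfolding exp_bounded_def by blast
qed

lemma exp_bounded_four: "exp_bounded (\<lambda>n. 4 ^ n)"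
  unfolding exp_bounded_def
proof (intro exI allI)
  fix n
  have "(4::nat) ^ n = 2 ^ (2 * n)" by (simp add: power_mult)
  also have "\<dots> \<le> 2 ^ (2 * (n + 1))" by (intro power_increasing) auto
  finally show "(4::nat) ^ n \<le> 2 ^ (2 * (n + 1))" .
qed

lemmas exp_bounded_intros = exp_bounded_const exp_bounded_mult exp_bounded_add exp_bounded_four

lemma time_bound_column_free:
  "column_free c \<Longrightarrow> \<exists>F. exp_bounded F \<and> (\<forall>n m. time_bound n m c = F n)"
proof (induction c)
  case (Seq c c')
  then obtain F G where "exp_bounded F" "\<forall>n m. time_bound n m c = F n"
    "exp_bounded G" "\<forall>n m. time_bound n m c' = G n" by auto
  then show ?case by (intro exI[of _ "\<lambda>n. F n + G n"]) (auto intro: exp_bounded_intros)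
next
  case (Cond b c c')
  then obtain F G where "exp_bounded F" "\<forall>n m. time_bound n m c = F n"
    "exp_bounded G" "\<forall>n m. time_bound n m c' = G n" by auto
  then show ?case
    by (intro exI[of _ "\<lambda>n. bcost b + F n + G n + 1"] conjI exp_bounded_intros) auto
next
  case (While b c)
  then obtain F where "exp_bounded F" "\<forall>n m. time_bound n m c = F n" by auto
  then show ?case using While.prems
    by (intro exI[of _ "\<lambda>n. 4 ^ n * (bcost b + F n + 1) + bcost b + 1"] conjI exp_bounded_intros)
      (auto simp: iterations_def)
qed (auto intro: exp_bounded_const)

lemma time_bound_column_free':
  assumes "column_free c"
  shows "\<exists>F. exp_bounded F \<and> (\<forall>n m. time_bound n m c \<le> F n * (m + 1))"
proof -
  obtain F where "exp_bounded F" "\<forall>n m. time_bound n m c = F n"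
    using time_bound_column_free[OF assms] by blast
  then show ?thesis by (intro exI[of _ F]) simp
qed

text \<open>The factor \<open>m + 1\<close> pays for the parts outside column loops, which take time
  even for \<open>m = 0\<close>. The body of a column loop has a bound free of \<open>m\<close>, so
  only one factor arises.\<close>

lemma time_bound_column_linear:
  "column_linear c \<Longrightarrow> \<exists>F. exp_bounded F \<and> (\<forall>n m. time_bound n m c \<le> F n * (m + 1))"
proof (induction c)
  case (Seq c c')
  then obtain F G where FG: "exp_bounded F" "\<forall>n m. time_bound n m c \<le> F n * (m + 1)"
    "exp_bounded G" "\<forall>n m. time_bound n m c' \<le> G n * (m + 1)" by auto
  have "time_bound n m (Seq c c') \<le> (F n + G n) * (m + 1)" for n m
    using FG(2)[rule_format, of n m] FG(4)[rule_format, of n m] by (simp add: algebra_simps)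
  with FG(1,3) show ?case by (blast intro: exp_bounded_intros)
next
  case (Cond b c c')
  then obtain F G where FG: "exp_bounded F" "\<forall>n m. time_bound n m c \<le> F n * (m + 1)"
    "exp_bounded G" "\<forall>n m. time_bound n m c' \<le> G n * (m + 1)" by auto
  have "time_bound n m (Cond b c c') \<le> (bcost b + F n + G n + 1) * (m + 1)" for n m
    using FG(2)[rule_format, of n m] FG(4)[rule_format, of n m] by (simp add: algebra_simps)
  moreover have "exp_bounded (\<lambda>n. bcost b + F n + G n + 1)" by (intro exp_bounded_intros FG)
  ultimately show ?case by blast
next
  case (While b c)
  show ?case
  proof (cases "column_loop b")
    case True
    with While.prems have "column_free c" by simp
    then obtain F where F: "exp_bounded F" "\<forall>n m. time_bound n m c = F n"
      using time_bound_column_free by blast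
    have "time_bound n m (While b c) \<le> (bcost b + F n + 1) * (m + 1)" for n m
      using F(2) True by (simp add: iterations_def algebra_simps)
    moreover have "exp_bounded (\<lambda>n. bcost b + F n + 1)" by (intro exp_bounded_intros F)
    ultimately show ?thesis by blast
  next
    case False
    with While obtain F where F: "exp_bounded F" "\<forall>n m. time_bound n m c \<le> F n * (m + 1)" by auto
    have "time_bound n m (While b c) \<le> (4 ^ n * (bcost b + F n + 1) + bcost b + 1) * (m + 1)" for n m
    proof -
      have "bcost b + time_bound n m c + 1 \<le> (bcost b + F n + 1) * (m + 1)"
        using F(2)[rule_format, of n m] by (simp add: algebra_simps)
      then have "4 ^ n * (bcost b + time_bound n m c + 1) \<le> 4 ^ n * ((bcost b + F n + 1) * (m + 1))"
        by (rule mult_left_mono) simp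
      moreover have "bcost b + 1 \<le> (bcost b + 1) * (m + 1)" by simp
      ultimately have "4 ^ n * (bcost b + time_bound n m c + 1) + (bcost b + 1)
          \<le> 4 ^ n * ((bcost b + F n + 1) * (m + 1)) + (bcost b + 1) * (m + 1)" by (rule add_mono)
      also have "\<dots> = (4 ^ n * (bcost b + F n + 1) + bcost b + 1) * (m + 1)"
        by (simp only: distrib_right mult.assoc add.assoc)
      finally show ?thesis using False by (simp add: iterations_def)
    qed
    moreover have "exp_bounded (\<lambda>n. 4 ^ n * (bcost b + F n + 1) + bcost b + 1)"
      by (intro exp_bounded_intros F)
    ultimately show ?thesis by blast
  qed
qed (rule time_bound_column_free', simp)+

section \<open>The program\<close>

text \<open>
  A set of rows is coded by the number \<open>x < 2\<^sup>n\<close> whose binary digits mark its members, so that for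
  \<open>B \<subseteq> A\<close> the code of \<open>A - B\<close> is a difference of numbers. The arrays are: \<open>b x i\<close>, digit \<open>i\<close> of
  \<open>x\<close>; \<open>p 0 i\<close>, the power \<open>2\<^sup>i\<close>; \<open>s B A\<close>, inclusion; \<open>c 0 B\<close>, suppression cost; \<open>o 0 B\<close>,
  t-closeness; for a fixed group \<open>M\<close>, \<open>w 0 B\<close>, the absolute total excess of \<open>B\<close>, and \<open>F A r\<close>, the
  least cost of a tree on \<open>A\<close> with root \<open>r\<close>; finally \<open>v 0 A\<close>, the least cost of a partition of \<open>A\<close>,
  and \<open>h 0 A\<close>, its first group. The cell \<open>g\<close> holds a number that serves as infinity.
\<close>

definition copy_row :: com where
  "copy_row = For ''i'' (V ''n'')
     (Assign ''b'' (Plus (V ''N'') (V ''A'')) (V ''i'') (Cell ''b'' (V ''A'') (V ''i'')))"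

definition double_rows :: com where
  "double_rows = For ''A'' (V ''N'')
     (Seq copy_row (Assign ''b'' (Plus (V ''N'') (V ''A'')) (V ''j'') (Num 1)))"

text \<open>Digits are tabulated by doubling, as the machine cannot halve: the rows for the codes
  below \<open>2 ^ j\<close> are copied above themselves with digit \<open>j\<close> set to
  1.\<close>

definition bits_prog :: com where
  "bits_prog = Seq (Assign ''N'' (Num 0) (Num 0) (Num 1)) (For ''j'' (V ''n'')
     (Seq (Assign ''p'' (Num 0) (V ''j'') (V ''N''))
     (Seq double_rows (Assign ''N'' (Num 0) (Num 0) (Plus (V ''N'') (V ''N''))))))"

lemma writes_copy_row [simp]: "writes copy_row = {''i'', ''b''}"
  and writes_double_rows [simp]: "writes double_rows = {''A'', ''i'', ''b''}"
  and writes_bits_prog [simp]: "writes bits_prog = {''N'', ''j'', ''p'', ''A'', ''i'', ''b''}"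
  by (auto simp: copy_row_def double_rows_def bits_prog_def)

definition in_code :: "name \<Rightarrow> name \<Rightarrow> bexp" where
  "in_code A i = LessN (Num 0) (Cell ''b'' (V A) (V i))"

definition subset_test :: com where
  "subset_test = Seq (Assign ''s'' (V ''B'') (V ''A'') (Num 1)) (For ''i'' (V ''n'')
     (Cond (AndB (in_code ''B'' ''i'') (NotB (in_code ''A'' ''i''))) (Assign ''s'' (V ''B'')
       (V ''A'') (Num 0)) Skip))"

definition subset_prog :: com where
  "subset_prog = For ''B'' (V ''N'') (For ''A'' (V ''N'') subset_test)"

lemma writes_subset_test [simp]: "writes subset_test = {''s'', ''i''}"
  and writes_subset_prog [simp]: "writes subset_prog = {''A'', ''B'', ''s'', ''i''}"
  by (auto simp: subset_test_def subset_prog_def)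

definition find_difference :: com where
  "find_difference = Seq (Assign ''f'' (Num 0) (Num 0) (Num 0)) (For ''i'' (V ''n'') (For ''q'' (V ''n'')
     (Cond (AndB (in_code ''A'' ''i'') (AndB (in_code ''A'' ''q'')
        (LessN (Cell ''T'' (V ''i'') (V ''j'')) (Cell ''T'' (V ''q'') (V ''j'')))))
      (Assign ''f'' (Num 0) (Num 0) (Num 1)) Skip)))"

definition add_column :: com where
  "add_column = For ''i'' (V ''n'') (Cond (in_code ''A'' ''i'')
     (Assign ''c'' (Num 0) (V ''A'') (Plus (Cell ''c'' (Num 0) (V ''A'')) (V ''f''))) Skip)"

definition cost_prog :: com where
  "cost_prog = For ''A'' (V ''N'') (Seq (Assign ''c'' (Num 0) (V ''A'') (Num 0))
     (For ''j'' (V ''m'') (Seq find_difference add_column)))"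

lemma writes_find_difference [simp]: "writes find_difference = {''f'', ''i'', ''q''}"
  and writes_add_column [simp]: "writes add_column = {''i'', ''c''}"
  and writes_cost_prog [simp]: "writes cost_prog = {''A'', ''j'', ''f'', ''i'', ''q'', ''c''}"
  by (auto simp: find_difference_def add_column_def cost_prog_def)

definition count_rows :: com where
  "count_rows = Seq (Assign ''k'' (Num 0) (Num 0) (Num 0)) (For ''i'' (V ''n'')
     (Cond (in_code ''M'' ''i'') (Assign ''k'' (Num 0) (Num 0) (Plus (V ''k'') (Num 1))) Skip))"

text \<open>With sets written for their codes, \<open>y\<close> becomes
  \<open>n * card (M \<inter> B)\<close> and \<open>z\<close> becomes
  \<open>card M * card B\<close>, both by repeated addition. Subtraction truncates, so the absolute
  difference is the sum of the differences in both orders.\<close>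

definition weigh :: com where
  "weigh = Seq (Assign ''y'' (Num 0) (Num 0) (Num 0)) (Seq (Assign ''z'' (Num 0) (Num 0) (Num 0))
     (Seq (For ''i'' (V ''n'') (Cond (in_code ''B'' ''i'')
        (Seq (Assign ''z'' (Num 0) (Num 0) (Plus (V ''z'') (V ''k'')))
           (Cond (in_code ''M'' ''i'') (Assign ''y'' (Num 0) (Num 0) (Plus (V ''y'')
             (V ''n''))) Skip)) Skip))
      (Assign ''w'' (Num 0) (V ''B'') (Plus (Minus (V ''y'') (V ''z'')) (Minus (V ''z'') (V ''y''))))))"

definition weights_prog :: com where
  "weights_prog = Seq count_rows (For ''B'' (V ''N'') weigh)"

lemma writes_count_rows [simp]: "writes count_rows = {''k'', ''i''}"
  and writes_weigh [simp]: "writes weigh = {''y'', ''z'', ''i'', ''w''}"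
  and writes_weights_prog [simp]: "writes weights_prog = {''k'', ''B'', ''y'', ''z'', ''i'', ''w''}"
  by (auto simp: count_rows_def weigh_def weights_prog_def)

definition infinity_prog :: com where
  "infinity_prog = Seq (Assign ''g'' (Num 0) (Num 0) (Num 1)) (For ''i'' (V ''n'')
     (Assign ''g'' (Num 0) (Num 0) (Plus (V ''g'') (V ''n''))))"

lemma writes_infinity_prog [simp]: "writes infinity_prog = {''g'', ''i''}"
  by (auto simp: infinity_prog_def)

text \<open>
  No test that \<open>r\<close> and \<open>q\<close> lie in the right sets is needed, since \<open>F x r\<close> is infinite unless
  \<open>r\<close> belongs to \<open>x\<close>. The test \<open>B < A\<close> keeps away from entries left over from an earlier group.
\<close>

definition relax :: com where
  "relax = Cond (AndB (LessN (Num 0) (V ''B'')) (AndB (LessN (V ''B'') (V ''A'')) (LessN (Num 0)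
    (Cell ''s'' (V ''B'') (V ''A'')))))
     (Seq (RAssign ''e'' (Num 0) (Num 0) (RPlus (RCell ''F'' (Minus (V ''A'') (V ''B'')) (V ''r''))
       (RCell ''F'' (V ''B'') (V ''q''))))
     (Seq (For ''i'' (Cell ''w'' (Num 0) (V ''B'')) (RAssign ''e'' (Num 0) (Num 0) (RPlus
       (RCell ''e'' (Num 0) (Num 0))
         (RCell ''d'' (Cell ''T'' (V ''r'') (V ''m'')) (Cell ''T'' (V ''q'') (V ''m''))))))
     (Cond (LessR (RCell ''e'' (Num 0) (Num 0)) (RCell ''F'' (V ''A'') (V ''r'')))
         (RAssign ''F'' (V ''A'') (V ''r'') (RCell ''e'' (Num 0) (Num 0))) Skip))) Skip"

definition tree_init :: com where
  "tree_init = Cond (AndB (NotB (LessN (V ''A'') (Cell ''p'' (Num 0) (V ''r'')))) (NotB (LessN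
    (Cell ''p'' (Num 0) (V ''r'')) (V ''A''))))
     (RAssign ''F'' (V ''A'') (V ''r'') (OfNat (Num 0))) (RAssign ''F'' (V ''A'') (V ''r'') (OfNat
       (V ''g'')))"

definition tree_entry :: com where
  "tree_entry = Seq tree_init (For ''B'' (V ''N'') (For ''q'' (V ''n'') relax))"

definition tree_prog :: com where
  "tree_prog = For ''A'' (V ''N'') (For ''r'' (V ''n'') tree_entry)"

lemma writes_relax [simp]: "writes relax = {''e'', ''i'', ''F''}"
  and writes_tree_init [simp]: "writes tree_init = {''F''}"
  and writes_tree_entry [simp]: "writes tree_entry = {''e'', ''i'', ''F'', ''B'', ''q''}"
  and writes_tree_prog [simp]: "writes tree_prog = {''e'', ''i'', ''F'', ''B'', ''q'', ''A'', ''r''}"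
  by (auto simp: relax_def tree_init_def tree_entry_def tree_prog_def)

text \<open>Reals cannot be multiplied, so \<open>n * card M * t\<close> is accumulated by adding
  \<open>t\<close> once for each pair of a member of the group and a row.\<close>

definition threshold :: com where
  "threshold = Seq (RAssign ''u'' (Num 0) (Num 0) (OfNat (Num 0))) (For ''i'' (V ''n'') (Cond
    (in_code ''M'' ''i'')
     (For ''q'' (V ''n'') (RAssign ''u'' (Num 0) (Num 0) (RPlus (RCell ''u'' (Num 0) (Num 0))
       (RCell ''t'' (Num 0) (Num 0))))) Skip))"

definition close_test :: com where
  "close_test = Seq threshold (Seq (Assign ''o'' (Num 0) (V ''M'') (Num 0)) (For ''r'' (V ''n'')
     (Cond (NotB (LessR (RCell ''u'' (Num 0) (Num 0)) (RCell ''F'' (Minus (V ''N'') (Num 1)) (V ''r''))))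
       (Assign ''o'' (Num 0) (V ''M'') (Num 1)) Skip)))"

definition close_prog :: com where
  "close_prog = Seq infinity_prog (For ''M'' (V ''N'') (Seq weights_prog (Seq tree_prog close_test)))"

lemma writes_threshold [simp]: "writes threshold = {''u'', ''i'', ''q''}"
  and writes_close_test [simp]: "writes close_test = {''u'', ''i'', ''q'', ''o'', ''r''}"
  and writes_close_prog [simp]: "writes close_prog = {''g'', ''i'', ''M'', ''k'', ''B'', ''y'',
    ''z'', ''w'',
     ''e'', ''F'', ''q'', ''A'', ''r'', ''u'', ''o''}"
  by (auto simp: threshold_def close_test_def close_prog_def)

text \<open>\<open>n * m + 1\<close> exceeds the cost of any single group and hence the optimum.
  Adding the number \<open>m\<close> as a whole, \<open>n\<close> times, takes no loop over the
  columns.\<close>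

definition best_infinity :: com where
  "best_infinity = Seq (Assign ''g'' (Num 0) (Num 0) (Num 1)) (For ''i'' (V ''n'')
     (Assign ''g'' (Num 0) (Num 0) (Plus (V ''g'') (V ''m''))))"

definition best_init :: com where
  "best_init = Cond (LessN (Num 0) (V ''A'')) (Assign ''v'' (Num 0) (V ''A'') (V ''g''))
     (Seq (Assign ''v'' (Num 0) (V ''A'') (Num 0)) (Assign ''h'' (Num 0) (V ''A'') (Num 0)))"

definition best_relax :: com where
  "best_relax = Cond (AndB (LessN (Num 0) (V ''B'')) (AndB (LessN (Num 0) (Cell ''s'' (V ''B'') (V ''A'')))
      (AndB (LessN (Num 0) (Cell ''o'' (Num 0) (V ''B'')))
        (LessN (Plus (Cell ''c'' (Num 0) (V ''B'')) (Cell ''v'' (Num 0) (Minus (V ''A'')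
          (V ''B'')))) (Cell ''v'' (Num 0) (V ''A''))))))
     (Seq (Assign ''v'' (Num 0) (V ''A'') (Plus (Cell ''c'' (Num 0) (V ''B'')) (Cell ''v'' (Num 0)
       (Minus (V ''A'') (V ''B'')))))
       (Assign ''h'' (Num 0) (V ''A'') (V ''B''))) Skip"

definition best_prog :: com where
  "best_prog = Seq best_infinity (For ''A'' (V ''N'') (Seq best_init (For ''B'' (V ''N'') best_relax)))"

lemma writes_best_infinity [simp]: "writes best_infinity = {''g'', ''i''}"
  and writes_best_init [simp]: "writes best_init = {''v'', ''h''}"
  and writes_best_relax [simp]: "writes best_relax = {''v'', ''h''}"
  and writes_best_prog [simp]: "writes best_prog = {''g'', ''i'', ''A'', ''B'', ''v'', ''h''}"
  by (auto simp: best_infinity_def best_init_def best_relax_def best_prog_def)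

definition label_group :: com where
  "label_group = For ''i'' (V ''n'') (Cond (LessN (Num 0) (Cell ''b'' (Cell ''h'' (Num 0) (V ''x''))
    (V ''i'')))
     (Assign ''out'' (Num 0) (V ''i'') (V ''l'')) Skip)"

text \<open>Always \<open>n\<close> rounds: each splits off a nonempty group as long as rows are
  left. Once \<open>x\<close> is 0, \<open>h\<close> yields the code of the empty set, and the
  remaining rounds write no label.\<close>

definition extract_prog :: com where
  "extract_prog = Seq (Assign ''x'' (Num 0) (Num 0) (Minus (V ''N'') (Num 1))) (For ''l'' (V ''n'')
     (Seq label_group (Assign ''x'' (Num 0) (Num 0) (Minus (V ''x'') (Cell ''h'' (Num 0) (V ''x''))))))"

lemma writes_label_group [simp]: "writes label_group = {''i'', ''out''}"
  and writes_extract_prog [simp]: "writes extract_prog = {''x'', ''l'', ''i'', ''out''}"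
  by (auto simp: label_group_def extract_prog_def)

definition t_closeness_prog :: com where
  "t_closeness_prog = Seq bits_prog (Seq subset_prog (Seq cost_prog (Seq close_prog
    (Seq best_prog extract_prog))))"

section \<open>Correctness of the program\<close>

lemma set_decode_bounded: "x < 2 ^ n \<Longrightarrow> set_decode x \<subseteq> {..<n}"
proof
  fix i assume "x < 2 ^ n" "i \<in> set_decode x"
  moreover have "x < 2 ^ i" if "n \<le> i"
    using that \<open>x < 2 ^ n\<close> power_increasing[of n i "2::nat"] by linarith
  ultimately show "i \<in> {..<n}" by (cases "n \<le> i") (auto simp: set_decode_def)
qed

lemma set_decode_add_power: "x < 2 ^ j \<Longrightarrow> set_decode (2 ^ j + x) = insert j (set_decode x)"
  using set_decode_bounded[of x j] by (intro set_decode_plus_power_2) auto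

text \<open>Under inclusion, subtraction has no borrows: a code is a sum of powers of 2 over its
  set, and such sums subtract along with the sets.\<close>

lemma set_decode_diff:
  assumes "set_decode y \<subseteq> set_decode x"
  shows "set_decode (x - y) = set_decode x - set_decode y"
proof -
  have "set_encode (set_decode x - set_decode y) = x - y"
    using sum_diff_nat[OF finite_set_decode assms, of "(^) 2"]
    by (simp flip: set_encode_def)
  then show ?thesis by (metis finite_Diff finite_set_decode set_encode_inverse)
qed

lemma set_decode_full: "set_decode (2 ^ n - 1) = {..<n}"
proof -
  have "set_encode {..<n} = 2 ^ n - 1"
    using sum_power2[of n] by (simp add: set_encode_def lessThan_atLeast0)
  then show ?thesis by (metis finite_lessThan set_encode_inverse)
qed

lemma set_decode_singleton_iff: "set_decode x = {r} \<longleftrightarrow> x = 2 ^ r"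
  by (metis finite.emptyI finite_insert set_decode_inverse set_encode_inverse set_encode_empty
      set_encode_insert empty_iff add_0_right)

lemma subtable_diff:
  assumes "finite A" "B \<subseteq> A"
  shows "subtable rs A = subtable rs B + subtable rs (A - B)"
proof -
  have "mset_set A = mset_set B + mset_set (A - B)"
    using assms mset_set_Union[of B "A - B"] finite_subset[of B A] by (simp add: Un_absorb1)
  then show ?thesis by (simp add: subtable_def)
qed

text \<open>Meant for competing partitions, whose groups are multisets of rows and name no
  positions. A sub-multiset of an image lifts to a sub-multiset \<open>P\<close> of positions, which
  is a set because no position occurs twice.\<close>

lemma subtable_sub_multiset:
  assumes "finite A" "M \<subseteq># subtable rs A"
  obtains B where "B \<subseteq> A" "subtable rs B = M"
proof -
  from assms(2) obtain K where "image_mset ((!) rs) (mset_set A) = M + K"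
    unfolding subtable_def by (metis subset_mset.le_iff_add)
  then obtain P R where P: "mset_set A = P + R" "image_mset ((!) rs) P = M"
    by (metis image_mset_eq_plusD)
  have "P = mset_set (set_mset P)"
  proof (rule multiset_eqI)
    fix x
    have "count P x \<le> count (mset_set A) x" by (simp add: P(1))
    also have "\<dots> \<le> 1" by (cases "x \<in> A") (simp_all add: assms(1))
    finally show "count P x = count (mset_set (set_mset P)) x"
      by (cases "x \<in># P") (auto simp: le_Suc_eq count_eq_zero_iff)
  qed
  moreover have "set_mset P \<subseteq> A"
    using assms(1) by (metis P(1) finite_set_mset_mset_set set_mset_union sup_ge1)
  ultimately show thesis using that P(2) unfolding subtable_def by metis
qed

lemma sum_subtable_classes:
  assumes "finite A"
  shows "(\<Sum>a\<in>g ` A. subtable rs {i \<in> A. g i = a}) = subtable rs A"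
proof -
  have eq: "subtable rs B = (\<Sum>i\<in>B. {#rs ! i#})" if "finite B" for B
    using that by (induction B rule: finite_induct) (auto simp: subtable_def)
  have "subtable rs A = (\<Sum>a\<in>g ` A. \<Sum>i\<in>{i \<in> A. g i = a}. {#rs ! i#})"
    unfolding eq[OF assms] using assms by (rule sum.image_gen)
  then show ?thesis using assms by (simp add: eq)
qed

section \<open>t-closeness of a set of rows in terms of tree costs\<close>

locale t_closeness_instance =
  fixes m :: nat and \<Sigma> S :: "nat set" and d :: "nat \<Rightarrow> nat \<Rightarrow> real" and t :: real
    and rs :: "row list"
  assumes table: "is_table m \<Sigma> S (mset rs)" and space: "sa_space S d"
    and t01: "0 \<le> t" "t \<le> 1"
begin

definition n :: nat where "n = length rs"

definition sa :: "nat \<Rightarrow> nat" where "sa i = rs ! i ! m"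

definition sa_dist :: "nat \<Rightarrow> nat \<Rightarrow> real" where "sa_dist i j = d (sa i) (sa j)"

text \<open>The net supply of row \<open>i\<close> when each member of \<open>B\<close> offers
  \<open>n\<close> and each row demands \<open>card B\<close>. Both sides total
  \<open>n * card B\<close>, so this is the difference of the two distributions on the level of
  rows, scaled to integers.\<close>

definition excess :: "nat set \<Rightarrow> nat \<Rightarrow> real" where
  "excess B i = real n * of_bool (i \<in> B) - real (card B)"

abbreviation close :: "nat set \<Rightarrow> bool" where
  "close B \<equiv> t_close m S d t (mset rs) (subtable rs B)"

lemma finite_S: "finite S"
  using space by (simp add: sa_space_def)

lemma metric: "Metric_space S d"
  using space by (simp add: sa_space_def)

lemma sa_in: "i < n \<Longrightarrow> sa i \<in> S"
  using table by (auto simp: is_table_def n_def sa_def)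

lemma d_nonneg: "0 \<le> d a b" and d_sym: "d a b = d b a"
  and d_self: "a \<in> S \<Longrightarrow> d a a = 0"
  and d_triangle: "a \<in> S \<Longrightarrow> b \<in> S \<Longrightarrow> c \<in> S \<Longrightarrow> d a c \<le> d a b + d b c"
  using metric by (auto simp: Metric_space_def)

text \<open>A row and its sensitive value are at distance 0, so gluing free plans at both ends
  converts plans between rows into plans between values and back. The pushforwards of the row masses
  are \<open>K\<close> times the two distributions.\<close>

lemma transport_rows_iff:
  assumes "B \<subseteq> {..<n}" "B \<noteq> {}"
  shows "transport {..<n} {..<n} sa_dist (\<lambda>i. real n * of_bool (i \<in> B)) (\<lambda>_. real (card B))
    (real n * real (card B) * c)
    \<longleftrightarrow> transport S S d (sa_distribution m (subtable rs B)) (sa_distribution m (mset rs)) c"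
proof -
  let ?V = "{..<n}" and ?X = "\<lambda>i. real n * of_bool (i \<in> B)" and ?Y = "\<lambda>_. real (card B)"
  define K where "K = real n * real (card B)"
  have finB: "finite B" using assms(1) finite_subset by blast
  then have "0 < card B" using assms(2) by (simp add: card_gt_0_iff)
  moreover have "0 < n" using assms by (cases n) auto
  ultimately have K: "0 < K" by (simp add: K_def)
  let ?push = "\<lambda>X a. \<Sum>i\<in>{i\<in>?V. sa i = a}. X i"
  have push_X: "?push ?X = (\<lambda>a. K * sa_distribution m (subtable rs B) a)"
  proof
    fix a
    have "?push ?X a = real n * (\<Sum>i\<in>{i\<in>?V. sa i = a}. of_bool (i \<in> B))" by (simp add: sum_distrib_left)
    also have "\<dots> = real n * real (card {i \<in> B. sa i = a})"
      using assms(1) by (subst sum_of_bool_eq) (auto intro!: arg_cong[of _ _ card])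
    finally show "?push ?X a = K * sa_distribution m (subtable rs B) a"
      using finB K by (simp add: sa_distribution_subtable K_def sa_def)
  qed
  have push_Y: "?push ?Y = (\<lambda>a. K * sa_distribution m (mset rs) a)"
    using K by (auto simp: mset_eq_subtable sa_distribution_subtable K_def sa_def n_def)
  let ?D = "\<lambda>i a. d (sa i) a" and ?D' = "\<lambda>a i. d a (sa i)"
  have graph: "transport ?V S ?D X (?push X) 0" if "\<And>i. 0 \<le> X i" for X
    by (rule transport_graph) (use finite_S sa_in d_self that in auto)
  have graph': "transport S ?V ?D' (?push X) X 0" if "\<And>i. 0 \<le> X i" for X
    by (rule transport_sym[OF graph[OF that]]) (rule d_sym)
  show ?thesis
  proof
    assume "transport ?V ?V sa_dist ?X ?Y (real n * real (card B) * c)"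
    then have 1: "transport ?V ?V sa_dist ?X ?Y (K * c)" by (simp add: K_def)
    have 2: "transport ?V S ?D ?X (?push ?Y) (K * c + 0)"
      by (rule transport_glue[OF _ _ _ 1 graph]) (use finite_S sa_in d_triangle in \<open>auto simp: sa_dist_def\<close>)
    have "transport S S d (?push ?X) (?push ?Y) (0 + (K * c + 0))"
      by (rule transport_glue[OF _ _ _ graph' 2]) (use finite_S sa_in d_triangle in auto)
    then have "transport S S d (\<lambda>a. K * sa_distribution m (subtable rs B) a)
        (\<lambda>a. K * sa_distribution m (mset rs) a) (K * c)" unfolding push_X push_Y by simp
    from transport_scale[OF this, of "1 / K"] K
    show "transport S S d (sa_distribution m (subtable rs B)) (sa_distribution m (mset rs)) c" by simp
  next
    assume a: "transport S S d (sa_distribution m (subtable rs B)) (sa_distribution m (mset rs)) c"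
    have 1: "transport S S d (?push ?X) (?push ?Y) (K * c)"
      unfolding push_X push_Y by (rule transport_scale[OF a]) (use K in simp)
    have 2: "transport S ?V ?D' (?push ?X) ?Y (K * c + 0)"
      by (rule transport_glue[OF _ _ _ 1 graph']) (use finite_S sa_in d_triangle in auto)
    have "transport ?V ?V sa_dist ?X ?Y (0 + (K * c + 0))"
      by (rule transport_glue[OF _ _ _ graph 2]) (use finite_S sa_in d_triangle in \<open>auto simp: sa_dist_def\<close>)
    then show "transport ?V ?V sa_dist ?X ?Y (real n * real (card B) * c)" by (simp add: K_def)
  qed
qed

lemma close_if_tree_cost:
  assumes "B \<subseteq> {..<n}" "B \<noteq> {}" "tree_cost (excess B) sa_dist {..<n} r c"
    and "c \<le> real n * real (card B) * t"
  shows "close B"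
proof -
  have finB: "finite B" using assms(1) finite_subset by blast
  have "transport {..<n} {..<n} sa_dist (\<lambda>i. real n * of_bool (i \<in> B)) (\<lambda>_. real (card B)) c"
  proof (rule tree_cost_transport[OF assms(3)])
    have "(\<Sum>i<n. of_bool (i \<in> B)) = real (card B)"
      using assms(1) by (subst sum_of_bool_eq) (auto intro!: arg_cong[of _ _ card])
    then show "(\<Sum>i<n. real n * of_bool (i \<in> B)) = (\<Sum>i<n. real (card B))"
      by (simp flip: sum_distrib_left)
    show "\<bar>1\<bar> = (1::real)" by simp
  qed (use sa_in d_self d_sym d_triangle in \<open>auto simp: sa_dist_def excess_def\<close>)
  then have "transport {..<n} {..<n} sa_dist (\<lambda>i. real n * of_bool (i \<in> B)) (\<lambda>_. real (card B))
    (real n * real (card B) * t)"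
    using assms(4) transport_mono by blast
  then have "transport S S d (sa_distribution m (subtable rs B)) (sa_distribution m (mset rs)) t"
    using transport_rows_iff[OF assms(1,2)] by blast
  then obtain f where f: "is_flow S (sa_distribution m (subtable rs B)) (sa_distribution m (mset rs)) f"
    "(\<Sum>i\<in>S. \<Sum>j\<in>S. d i j * f i j) \<le> t" unfolding transport_def is_flow_def by blast
  have "bdd_below {(\<Sum>i\<in>S. \<Sum>j\<in>S. d i j * f i j) |f.
      is_flow S (sa_distribution m (subtable rs B)) (sa_distribution m (mset rs)) f}"
    by (rule bdd_belowI[of _ 0]) (auto simp: is_flow_def d_nonneg intro!: sum_nonneg mult_nonneg_nonneg)
  then show ?thesis unfolding t_close_def EMD_def using f by (intro cInf_lower2) auto
qed

text \<open>A lower bound \<open>x\<close> of all tree costs stands in for the least one. If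
  \<open>x\<close> exceeded the threshold, some flow would cost less than \<open>x / K\<close> by
  the nature of an infimum, and the tree obtained from it would undercut \<open>x\<close>.\<close>

lemma tree_cost_bound_if_close:
  assumes "B \<subseteq> {..<n}" "B \<noteq> {}" "close B"
    and "\<And>r c. tree_cost (excess B) sa_dist {..<n} r c \<Longrightarrow> x \<le> c"
  shows "x \<le> real n * real (card B) * t"
proof (rule ccontr)
  assume "\<not> ?thesis"
  then have x: "real n * real (card B) * t < x" by simp
  define K where "K = real n * real (card B)"
  have finB: "finite B" using assms(1) finite_subset by blast
  then have "0 < card B" using assms(2) by (simp add: card_gt_0_iff)
  moreover have n: "0 < n" using assms by (cases n) auto
  ultimately have K: "0 < K" by (simp add: K_def)
  let ?T = "\<lambda>c. transport S S d (sa_distribution m (subtable rs B)) (sa_distribution m (mset rs)) c"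
  let ?C = "{(\<Sum>i\<in>S. \<Sum>j\<in>S. d i j * f i j) |f.
      is_flow S (sa_distribution m (subtable rs B)) (sa_distribution m (mset rs)) f}"
  \<comment> \<open>The product plan, in which each member of \<open>B\<close> sends one unit to
    every row, shows that flows exist; the infimum of an empty set would carry no
    information.\<close>
  have "transport {..<n} {..<n} sa_dist (\<lambda>i. real n * of_bool (i \<in> B)) (\<lambda>_. real (card B))
     (K * ((\<Sum>i<n. \<Sum>j<n. sa_dist i j * of_bool (i \<in> B)) / K))"
    using K assms(1) by (intro transportI[where f = "\<lambda>i j. of_bool (i \<in> B)"])
      (auto simp: Int_absorb1)
  then have "?T ((\<Sum>i<n. \<Sum>j<n. sa_dist i j * of_bool (i \<in> B)) / K)"
    using transport_rows_iff[OF assms(1,2)] unfolding K_def by blast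
  then have ne: "?C \<noteq> {}" unfolding transport_def is_flow_def by blast
  have "t < x / K" using x K by (simp add: K_def pos_less_divide_eq mult.commute)
  then have "Inf ?C < x / K" using assms(3) unfolding t_close_def EMD_def by linarith
  then obtain f where f: "is_flow S (sa_distribution m (subtable rs B)) (sa_distribution m (mset rs)) f"
    "(\<Sum>i\<in>S. \<Sum>j\<in>S. d i j * f i j) < x / K" using cInf_lessD[OF ne] by blast
  define c where "c = (\<Sum>i\<in>S. \<Sum>j\<in>S. d i j * f i j)"
  have "?T c" using f unfolding transport_def is_flow_def c_def by blast
  then have "transport {..<n} {..<n} sa_dist (\<lambda>i. real n * of_bool (i \<in> B)) (\<lambda>_. real (card B)) (K * c)"
    using transport_rows_iff[OF assms(1,2)] unfolding K_def by blast
  from transport_tree_cost[OF this] obtain r c' where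
    "tree_cost (excess B) sa_dist {..<n} r c'" "c' \<le> K * c"
    using n d_nonneg d_sym by (auto simp: sa_dist_def excess_def[abs_def])
  moreover have "K * c < x" using f(2) K by (simp add: c_def pos_less_divide_eq mult.commute)
  ultimately show False using assms(4) by fastforce
qed

end

sublocale t_closeness_instance \<subseteq> time_bounds n m .

context t_closeness_instance
begin

lemma iterations_bound: "k \<le> 4 ^ n \<Longrightarrow> \<not> column_loop b \<Longrightarrow> k \<le> iterations n m b"
  by (simp add: iterations_def)

lemma n_le_four: "n \<le> 4 ^ n" and two_le_four: "j \<le> n \<Longrightarrow> 2 ^ j \<le> (4::nat) ^ n"
proof -
  have "n \<le> 2 ^ n" by (simp add: less_imp_le)
  also have "(2::nat) ^ n \<le> 4 ^ n" by (intro power_mono) auto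
  finally show "n \<le> 4 ^ n" .
  assume "j \<le> n"
  then have "(2::nat) ^ j \<le> 2 ^ n" by (intro power_increasing) auto
  also have "(2::nat) ^ n \<le> 4 ^ n" by (intro power_mono) auto
  finally show "2 ^ j \<le> (4::nat) ^ n" .
qed

section \<open>Memory contents; the tables of digits and inclusions\<close>

definition has_input :: "state \<Rightarrow> bool" where
  "has_input s \<longleftrightarrow> nmem s ''n'' 0 0 = n \<and> nmem s ''m'' 0 0 = m \<and>
     (\<forall>i<n. \<forall>j\<le>m. nmem s ''T'' i j = rs ! i ! j) \<and> rmem s ''t'' 0 0 = t \<and>
     (\<forall>a\<in>S. \<forall>b\<in>S. rmem s ''d'' a b = d a b)"

definition has_bits :: "state \<Rightarrow> bool" where
  "has_bits s \<longleftrightarrow> nmem s ''N'' 0 0 = 2 ^ n \<and> (\<forall>i<n. nmem s ''p'' 0 i = 2 ^ i) \<and>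
     (\<forall>x<2^n. \<forall>i<n. nmem s ''b'' x i = of_bool (i \<in> set_decode x))"

definition bits_upto :: "nat \<Rightarrow> state \<Rightarrow> bool" where
  "bits_upto k s \<longleftrightarrow> (\<forall>x<k. \<forall>i<n. nmem s ''b'' x i = of_bool (i \<in> set_decode x))"

lemma copy_row:
  assumes "nmem s ''n'' 0 0 = n" "nmem s ''A'' 0 0 < nmem s ''N'' 0 0"
  shows "wp copy_row (\<lambda>s'. \<forall>x i. nmem s' ''b'' x i =
    (if x = nmem s ''N'' 0 0 + nmem s ''A'' 0 0 \<and> i < n then nmem s ''b''
      (nmem s ''A'' 0 0) i else nmem s ''b'' x i)) s"
  unfolding copy_row_def
proof (rule wp_For[where N = n and I = "\<lambda>k s'. \<forall>x i. nmem s' ''b'' x i =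
    (if x = nmem s ''N'' 0 0 + nmem s ''A'' 0 0 \<and> i < k then nmem s ''b''
      (nmem s ''A'' 0 0) i else nmem s ''b'' x i)"],
    goal_cases)
  case (6 i s')
  then show ?case using assms by (intro wp_Assign) (auto simp: agree_def less_Suc_eq)
qed (use assms n_le_four in \<open>auto simp: agree_def column_loop_def intro!: iterations_bound\<close>)

lemma double_rows:
  assumes "nmem s ''n'' 0 0 = n" "nmem s ''N'' 0 0 = 2 ^ j" "nmem s ''j'' 0 0
    = j" "j < n" "bits_upto (2 ^ j) s"
  shows "wp double_rows (bits_upto (2 ^ Suc j)) s"
  unfolding double_rows_def
proof (rule wp_For[where N = "2 ^ j" and I = "\<lambda>a. bits_upto (2 ^ j + a)"], goal_cases)
  case (6 a s1)
  have c: "nmem s1 ''n'' 0 0 = n" "nmem s1 ''N'' 0 0 = 2 ^ j" "nmem s1 ''j'' 0 0 = j"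
    using 6 assms by (auto simp: agree_def)
  show ?case
  proof (rule wp_Seq, rule wp_conseq[OF copy_row], goal_cases)
    case (3 s2)
    have "nmem s2 ''n'' 0 0 = n" "nmem s2 ''N'' 0 0 = 2 ^ j" "nmem s2 ''j'' 0 0 = j" "nmem s2 ''A'' 0 0 = a"
      using 3 c 6 by (auto simp: agree_def)
    then show ?case using 3 6 c \<open>j < n\<close>
      by (intro wp_Assign) (auto simp: bits_upto_def less_Suc_eq set_decode_add_power)
  qed (use c 6 in auto)
qed (use assms two_le_four[of j] in \<open>auto simp: agree_def column_loop_def bits_upto_def mult_2
  intro!: iterations_bound\<close>)

text \<open>Only row 0 of \<open>b\<close> has to vanish at the start: every other row is a copy of
  a lower row with one digit added.\<close>

lemma bits_prog:
  assumes "nmem s ''n'' 0 0 = n" "\<And>i. nmem s ''b'' 0 i = 0"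
  shows "wp bits_prog has_bits s"
  unfolding bits_prog_def
proof (rule wp_Seq, rule wp_Assign,
    rule wp_For[where N = n and I = "\<lambda>j s. nmem s ''N'' 0 0 = 2 ^ j \<and> (\<forall>i<j. nmem s ''p'' 0 i
      = 2 ^ i) \<and> bits_upto (2 ^ j) s"],
    goal_cases)
  case (6 j s1)
  show ?case
  proof (rule wp_Seq, rule wp_Assign, rule wp_Seq, rule wp_conseq[OF double_rows[where j = j]], goal_cases)
    case (6 s2)
    then show ?case using \<open>j < n\<close> \<open>nmem s1 ''N'' 0 0 = 2 ^ j \<and> _\<close> \<open>nmem s1 ''j'' 0 0 = j\<close>
      by (intro wp_Assign) (auto simp: agree_def less_Suc_eq bits_upto_def)
  qed (use 6 assms in \<open>auto simp: agree_def bits_upto_def\<close>)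
qed (use assms n_le_four in \<open>auto simp: agree_def has_bits_def bits_upto_def column_loop_def intro!:
  iterations_bound\<close>)

lemma has_bits_agree: "agree X s s' \<Longrightarrow> {''N'', ''p'', ''b''} \<inter> X = {} \<Longrightarrow> has_bits s' = has_bits s"
  by (auto simp: agree_def has_bits_def)

lemma has_input_agree:
  "agree X s s' \<Longrightarrow> {''n'', ''m'', ''T'', ''t'', ''d''} \<inter> X = {} \<Longrightarrow> has_input s' = has_input s"
  by (auto simp: agree_def has_input_def)

lemma has_bits_N: "has_bits s \<Longrightarrow> nmem s ''N'' 0 0 = 2 ^ n"
  by (simp add: has_bits_def)

lemma has_input_n: "has_input s \<Longrightarrow> nmem s ''n'' 0 0 = n"
  and has_input_m: "has_input s \<Longrightarrow> nmem s ''m'' 0 0 = m"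
  by (simp_all add: has_input_def)

lemmas loop_simps = agree_def column_loop_def iterations_def n_le_four two_le_four has_bits_N
  has_input_n has_input_m

lemma bval_in_code:
  "has_bits s \<Longrightarrow> nmem s A 0 0 < 2 ^ n \<Longrightarrow> nmem s i 0 0 < n \<Longrightarrow>
    bval (in_code A i) s \<longleftrightarrow> nmem s i 0 0 \<in> set_decode (nmem s A 0 0)"
  by (simp add: has_bits_def in_code_def)

definition has_subsets :: "state \<Rightarrow> bool" where
  "has_subsets s \<longleftrightarrow> (\<forall>x<2^n. \<forall>y<2^n. 0 < nmem s ''s'' x y \<longleftrightarrow> set_decode x \<subseteq> set_decode y)"

lemma has_subsets_agree: "agree X s s' \<Longrightarrow> ''s'' \<notin> X \<Longrightarrow> has_subsets s' = has_subsets s"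
  by (auto simp: agree_def has_subsets_def)

lemma subset_test:
  assumes "has_bits s" "nmem s ''n'' 0 0 = n" "nmem s ''A'' 0 0 = a" "nmem s ''B'' 0 0 = b"
    and "a < 2 ^ n" "b < 2 ^ n"
  shows "wp subset_test (\<lambda>s'. \<forall>x y. nmem s' ''s'' x y =
    (if x = b \<and> y = a then of_bool (set_decode b \<subseteq> set_decode a) else nmem s ''s'' x y)) s"
  unfolding subset_test_def
proof (rule wp_Seq, rule wp_Assign, rule wp_For[where N = n and I = "\<lambda>k s'. \<forall>x y. nmem s' ''s'' x y =
    (if x = b \<and> y = a then of_bool (\<forall>i<k. i \<in> set_decode b
      \<longrightarrow> i \<in> set_decode a) else nmem s ''s'' x y)"], goal_cases)
  case (6 i s1)
  have "has_bits s1" using has_bits_agree[OF 6(4)] assms(1) by (simp add: has_bits_def)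
  moreover have "nmem s1 ''A'' 0 0 = a" "nmem s1 ''B'' 0 0 = b" using 6(4) assms by (auto simp: agree_def)
  ultimately show ?case using assms 6
    by (intro wp_intros) (auto simp: bval_in_code less_Suc_eq)
next
  case (7 s1)
  have "(\<forall>i<n. i \<in> set_decode b \<longrightarrow> i \<in> set_decode a) \<longleftrightarrow> set_decode b \<subseteq> set_decode a"
    using set_decode_bounded[OF assms(6)] by auto
  then show ?case using 7 by simp
qed (use assms in \<open>simp_all add: loop_simps\<close>)

lemma subset_prog:
  assumes "has_bits s" "nmem s ''n'' 0 0 = n"
  shows "wp subset_prog has_subsets s"
  unfolding subset_prog_def
proof (rule wp_For[where N = "2^n" and I = "\<lambda>b s. \<forall>x<b. \<forall>y<2^n. 0 < nmem s ''s'' x y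
  \<longleftrightarrow> set_decode x \<subseteq> set_decode y"], goal_cases)
  case (6 b s1)
  show ?case
  proof (rule wp_For[where N = "2^n" and I = "\<lambda>a s. \<forall>x<Suc b. \<forall>y<2^n. x < b \<or> y < a \<longrightarrow>
    (0 < nmem s ''s'' x y \<longleftrightarrow> set_decode x \<subseteq> set_decode y)"], goal_cases)
    case (6 a s2)
    have c: "has_bits s2" "nmem s2 ''n'' 0 0 = n" "nmem s2 ''B'' 0 0 = b"
      using 6(4) \<open>agree _ s s1\<close> \<open>nmem s1 ''B'' 0 0 = b\<close> assms has_bits_agree[OF 6(4)]
        has_bits_agree[OF \<open>agree _ s s1\<close>]
      by (auto simp: agree_def)
    show ?case
      by (rule wp_conseq[OF subset_test[OF c(1,2) 6(3) c(3)]]) (use 6 \<open>b < 2^n\<close> in \<open>auto simp: less_Suc_eq\<close>)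
  next
    case 4
    show ?case using 6(2) by auto
  next
    case (7 s2)
    then show ?case by blast
  qed (use 6(4) assms in \<open>simp_all add: loop_simps\<close>)
next
  case (7 s1)
  then show ?case by (simp add: has_subsets_def)
qed (use assms in \<open>simp_all add: loop_simps\<close>)

section \<open>Suppression costs\<close>

text \<open>Disagreement is phrased by the strict order, which the machine can test; both orders of
  a pair are tried, so no disagreement is missed.\<close>

definition differs :: "nat set \<Rightarrow> nat \<Rightarrow> bool" where
  "differs B j \<longleftrightarrow> (\<exists>i\<in>B. \<exists>q\<in>B. rs ! i ! j < rs ! q ! j)"

lemma suppression_cost_subtable:
  assumes "finite B"
  shows "suppression_cost m (subtable rs B) = card B * card {j. j < m \<and> differs B j}"
proof -
  have "(\<forall>r\<in>#subtable rs B. \<forall>r'\<in>#subtable rs B. r ! j = r' ! j) \<longleftrightarrow> \<not> differs B j" for j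
  proof -
    have "(\<forall>r\<in>#subtable rs B. \<forall>r'\<in>#subtable rs B. r ! j = r' ! j) \<longleftrightarrow>
        (\<forall>i\<in>B. \<forall>q\<in>B. rs ! i ! j = rs ! q ! j)" using assms by (simp add: subtable_def)
    also have "\<dots> \<longleftrightarrow> \<not> differs B j" unfolding differs_def by (metis less_irrefl linorder_neqE_nat)
    finally show ?thesis .
  qed
  then show ?thesis using assms by (simp add: suppression_cost_def subtable_def)
qed

definition has_costs :: "state \<Rightarrow> bool" where
  "has_costs s \<longleftrightarrow> (\<forall>x<2^n. nmem s ''c'' 0 x = suppression_cost m (subtable rs (set_decode x)))"

lemma find_difference:
  assumes "has_bits s" "has_input s" "nmem s ''A'' 0 0 = a" "nmem s ''j'' 0 0 = j" "a < 2 ^ n" "j < m"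
  shows "wp find_difference (\<lambda>s'. nmem s' ''f'' 0 0 = of_bool (differs (set_decode a) j)) s"
  unfolding find_difference_def
proof (rule wp_Seq, rule wp_Assign, rule wp_For[where N = n and I = "\<lambda>k s'. nmem s' ''f'' 0 0 =
    of_bool (\<exists>i\<in>set_decode a. \<exists>q\<in>set_decode a. rs ! i ! j < rs ! q ! j \<and> i < k)"], goal_cases)
  case (6 i s1)
  show ?case
  proof (rule wp_For[where N = n and I = "\<lambda>k s'. nmem s' ''f'' 0 0 =
    of_bool (\<exists>i'\<in>set_decode a. \<exists>q\<in>set_decode a. rs ! i' ! j < rs ! q ! j \<and> (i' < i \<or> i' = i
      \<and> q < k))"], goal_cases)
    case (6 q s2)
    have 1: "has_bits s2" "has_input s2" "nmem s2 ''A'' 0 0 = a" "nmem s2 ''j'' 0 0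
      = j" "nmem s2 ''i'' 0 0 = i"
      using 6(4) \<open>agree _ _ s1\<close> assms has_bits_agree[OF 6(4)] has_bits_agree[OF \<open>agree _ _ s1\<close>]
        has_input_agree[OF 6(4)] has_input_agree[OF \<open>agree _ _ s1\<close>] \<open>nmem s1 ''i'' 0 0 = i\<close>
      by (auto simp: agree_def has_bits_def has_input_def)
    then have "nmem s2 ''T'' i j = rs ! i ! j" "nmem s2 ''T'' q j = rs ! q ! j"
      using assms(6) \<open>i < n\<close> 6 by (auto simp: has_input_def)
    then show ?case using 1 6 assms \<open>i < n\<close>
      by (intro wp_intros) (auto simp: bval_in_code less_Suc_eq)
  next
    case (7 s2)
    have "set_decode a \<subseteq> {..<n}" using set_decode_bounded assms by simp
    then have "(\<exists>i'\<in>set_decode a. \<exists>q\<in>set_decode a. rs ! i' ! j < rs ! q ! j \<and> (i' < i \<or> i' = i \<and> q < n))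
      \<longleftrightarrow> (\<exists>i'\<in>set_decode a. \<exists>q\<in>set_decode a. rs ! i' ! j < rs ! q ! j \<and> i' < Suc i)"
      by (auto simp: less_Suc_eq)
    then show ?case using 7 by simp
  qed (use 6 assms in \<open>simp_all add: loop_simps\<close>)
next
  case (7 s1)
  have "set_decode a \<subseteq> {..<n}" using set_decode_bounded assms by simp
  then have "(\<exists>i\<in>set_decode a. \<exists>q\<in>set_decode a. rs ! i ! j < rs ! q ! j \<and> i < n) \<longleftrightarrow> differs (set_decode a) j"
    unfolding differs_def by auto
  then show ?case using 7 by simp
qed (use assms in \<open>simp_all add: loop_simps\<close>)

lemma card_Int_lessThan_Suc: "card (A \<inter> {..<Suc i}) = card (A \<inter> {..<i}) + of_bool (i \<in> A)"
proof -
  have "A \<inter> {..<Suc i} = (if i \<in> A then insert i (A \<inter> {..<i}) else A \<inter> {..<i})" by (auto simp: less_Suc_eq)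
  then show ?thesis by simp
qed

lemma add_column:
  assumes "has_bits s" "nmem s ''n'' 0 0 = n" "nmem s ''A'' 0 0 = a" "a < 2 ^ n"
  shows "wp add_column (\<lambda>s'. \<forall>x. nmem s' ''c'' 0 x = nmem s ''c'' 0 x +
    (if x = a then card (set_decode a) * nmem s ''f'' 0 0 else 0)) s"
  unfolding add_column_def
proof (rule wp_For[where N = n and I = "\<lambda>k s'. \<forall>x. nmem s' ''c'' 0 x = nmem s ''c'' 0 x +
    (if x = a then card (set_decode a \<inter> {..<k}) * nmem s ''f'' 0 0 else 0)"], goal_cases)
  case (6 i s1)
  have "has_bits s1" "nmem s1 ''A'' 0 0 = a" "nmem s1 ''f'' 0 0 = nmem s ''f'' 0 0"
    using 6(4) assms has_bits_agree[OF 6(4)] by (auto simp: agree_def)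
  then show ?case using 6 assms
    by (intro wp_intros) (auto simp: bval_in_code card_Int_lessThan_Suc)
next
  case (7 s1)
  then show ?case using set_decode_bounded[OF assms(4)] by (simp add: Int_absorb2)
qed (use assms in \<open>simp_all add: loop_simps\<close>)

lemma cost_prog:
  assumes "has_bits s" "has_input s"
  shows "wp cost_prog has_costs s"
  unfolding cost_prog_def
proof (rule wp_For[where N = "2 ^ n" and I = "\<lambda>a s. \<forall>x<a. nmem s ''c'' 0 x = suppression_cost m
  (subtable rs (set_decode x))"], goal_cases)
  case (6 a s1)
  have 1: "has_bits s1" "has_input s1" using 6(4) assms has_bits_agree[OF 6(4)] has_input_agree[OF 6(4)]
    by (auto simp: agree_def)
  show ?case
  proof (rule wp_Seq, rule wp_Assign, rule wp_For[where N = m and I = "\<lambda>j s. (\<forall>x<a. nmem s ''c'' 0 x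
    = suppression_cost m (subtable rs (set_decode x)))
     \<and> nmem s ''c'' 0 a = card (set_decode a) * card {j'. j' < j \<and> differs (set_decode a) j'}"], goal_cases)
    case (6 j s2)
    have 2: "has_bits s2" "has_input s2" "nmem s2 ''A'' 0 0 = a"
      using 1 6(4) has_bits_agree[OF 6(4)] has_input_agree[OF 6(4)] \<open>nmem s1 ''A'' 0 0 = a\<close>
      by (auto simp: agree_def has_bits_def has_input_def)
    show ?case
    proof (rule wp_Seq, rule wp_conseq[OF find_difference[OF 2 6(3) \<open>a < 2 ^ n\<close> 6(1)]], goal_cases)
      case (1 s3)
      have 3: "has_bits s3" "nmem s3 ''n'' 0 0 = n" "nmem s3 ''A'' 0 0 = a" "nmem s3 ''c'' = nmem s2 ''c''"
        using 2 1 has_bits_agree[OF 1(1)] by (auto simp: agree_def has_input_def)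
      have "{j'. j' < Suc j \<and> differs (set_decode a) j'} =
        (if differs (set_decode a) j then insert j {j'. j' < j \<and> differs
          (set_decode a) j'} else {j'. j' < j \<and> differs (set_decode a) j'})"
        by (auto simp: less_Suc_eq)
      then show ?case
        by (intro wp_conseq[OF add_column[OF 3(1,2,3) \<open>a < 2 ^ n\<close>]]) (use 1 3 6 in auto)
    qed
  next
    case (7 s2)
    then show ?case by (auto simp: less_Suc_eq suppression_cost_subtable)
  qed (use 1 6(1-3) in \<open>simp_all add: loop_simps\<close>)
qed (use assms in \<open>simp_all add: loop_simps has_costs_def\<close>)

section \<open>Least tree costs for a fixed group\<close>

text \<open>Since \<open>t \<le> 1\<close>, this exceeds every threshold \<open>n |B| t\<close>.\<close>

definition inf_value :: real where "inf_value = real (n * n + 1)"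

abbreviation tree :: "nat \<Rightarrow> nat \<Rightarrow> nat \<Rightarrow> real \<Rightarrow> bool" where
  "tree M x r c \<equiv> tree_cost (excess (set_decode M)) sa_dist (set_decode x) r c"

text \<open>Entries need not be exact minima, since trees dearer than \<open>inf_value\<close> may
  be cut off. What remains is that any other entry is the cost of an actual tree and, by
  \<open>entry_complete\<close>, that no tree is cheaper than the entry.\<close>

definition entry_sound :: "nat \<Rightarrow> nat \<Rightarrow> nat \<Rightarrow> real \<Rightarrow> bool" where
  "entry_sound M x r v \<longleftrightarrow> v = inf_value \<or> tree M x r v"

definition entry_complete :: "nat \<Rightarrow> nat \<Rightarrow> nat \<Rightarrow> real \<Rightarrow> bool" where
  "entry_complete M x r v \<longleftrightarrow> v \<le> inf_value \<and> (\<forall>c. tree M x r c \<longrightarrow> v \<le> c)"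

definition candidate :: "nat \<Rightarrow> (nat \<Rightarrow> nat \<Rightarrow> real) \<Rightarrow> nat \<Rightarrow> nat \<Rightarrow> nat \<Rightarrow> nat \<Rightarrow> real" where
  "candidate M F a r b q = F (a - b) r + F b q + \<bar>sum (excess (set_decode M)) (set_decode b)\<bar> * sa_dist r q"

abbreviation splits :: "nat \<Rightarrow> nat \<Rightarrow> bool" where
  "splits a b \<equiv> 0 < b \<and> b < a \<and> set_decode b \<subseteq> set_decode a"

lemma sa_dist_nonneg: "0 \<le> sa_dist i j"
  by (simp add: sa_dist_def d_nonneg)

lemma entry_sound_nonneg: "entry_sound M x r v \<Longrightarrow> 0 \<le> v"
  using tree_cost_nonneg sa_dist_nonneg by (force simp: entry_sound_def inf_value_def)

lemma entry_sound_min_candidate: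
  assumes "entry_sound M a r v" "v \<le> inf_value" "splits a b"
    and "entry_sound M (a - b) r (F (a - b) r)" "entry_sound M b q (F b q)"
  shows "entry_sound M a r (min v (candidate M F a r b q))"
proof (cases "candidate M F a r b q < v")
  case True
  \<comment> \<open>All summands are nonnegative, so a candidate below
    \<open>v \<le> inf_value\<close> has no infinite summand, and both entries are costs of actual
    trees.\<close>
  have nn: "0 \<le> F (a - b) r" "0 \<le> F b q"
    "0 \<le> \<bar>sum (excess (set_decode M)) (set_decode b)\<bar> * sa_dist r q"
    using assms(4,5) entry_sound_nonneg sa_dist_nonneg by auto
  then have "F (a - b) r < inf_value" "F b q < inf_value"
    using True assms(2) unfolding candidate_def by linarith+
  then have "tree M (a - b) r (F (a - b) r)" "tree M b q (F b q)"
    using assms(4,5) by (auto simp: entry_sound_def)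
  moreover have "set_decode (a - b) = set_decode a - set_decode b" using assms(3) set_decode_diff by blast
  ultimately have "tree_cost (excess (set_decode M)) sa_dist (set_decode a - set_decode b \<union> set_decode b) r
      (candidate M F a r b q)"
    unfolding candidate_def by (intro tree_cost.join) auto
  moreover have "set_decode a - set_decode b \<union> set_decode b = set_decode a" using assms(3) by blast
  ultimately show ?thesis using True by (simp add: entry_sound_def)
qed (use assms in simp)

text \<open>The last \<open>join\<close> of a tree on \<open>a\<close> splits off a hanging part
  with code \<open>b\<close> and root \<open>q\<close>. Both parts contain their roots, so
  \<open>b\<close> and \<open>a - b\<close> are smaller codes and their entries are already
  complete.\<close>

lemma entry_completeI:
  assumes "v \<le> inf_value" "a < 2 ^ n" "set_decode a = {r} \<Longrightarrow> v \<le> 0"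
    and cand: "\<And>b q. splits a b \<Longrightarrow> q < n \<Longrightarrow> v \<le> candidate M F a r b q"
    and F: "\<And>x q. x < a \<Longrightarrow> q < n \<Longrightarrow> entry_complete M x q (F x q)"
  shows "entry_complete M a r v"
  unfolding entry_complete_def
proof (intro conjI allI impI)
  fix c assume "tree M a r c"
  then show "v \<le> c"
  proof (cases rule: tree_cost.cases)
    case single
    then show ?thesis using assms(3) by simp
  next
    case (join A c1 B q c2)
    have fin: "finite A" "finite B" using tree_cost_finite[OF join(3)] tree_cost_finite[OF join(4)] by auto
    have root: "r \<in> A" "q \<in> B" using tree_cost_root[OF join(3)] tree_cost_root[OF join(4)] by auto
    define b where "b = set_encode B"
    have b: "set_decode b = B" using fin by (simp add: b_def)
    have le: "b \<le> a" using join(1) b by (intro subset_decode_imp_le) auto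
    have ab: "set_decode (a - b) = A" using set_decode_diff[of b a] b join(1,5) by auto
    have "a \<noteq> b" using b root join(1,5) by auto
    moreover have "0 < b" using b root by (metis empty_iff gr0I set_decode_zero)
    ultimately have sp: "splits a b" using le b join(1) by auto
    have "q < n" "r < n" using set_decode_bounded[OF assms(2)] join(1) root by auto
    then have "F (a - b) r \<le> c1" "F b q \<le> c2"
      using F[of "a - b" r] F[of b q] sp ab b join(3,4) by (auto simp: entry_complete_def)
    then have "candidate M F a r b q \<le> c" using join(2) b by (simp add: candidate_def)
    then show ?thesis using cand[OF sp \<open>q < n\<close>] by linarith
  qed
qed (rule assms(1))

definition env :: "nat \<Rightarrow> state \<Rightarrow> bool" where
  "env M s \<longleftrightarrow> has_bits s \<and> has_input s \<and> has_subsets s \<and> nmem s ''M'' 0 0 = M"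

lemma env_agree:
  "agree X s s' \<Longrightarrow> {''N'', ''p'', ''b'', ''n'', ''m'', ''T'', ''t'', ''d'', ''s'', ''M''} \<inter> X = {}
    \<Longrightarrow> env M s' = env M s"
  using has_bits_agree[of X s s'] has_input_agree[of X s s'] has_subsets_agree[of X s s']
    agree_nmem[of X s s' "''M''"] by (simp add: env_def)

lemma env_simps:
  "env M s \<Longrightarrow> has_bits s" "env M s \<Longrightarrow> nmem s ''N'' 0 0 = 2 ^ n" "env M s \<Longrightarrow> nmem s ''n'' 0 0 = n"
  "env M s \<Longrightarrow> nmem s ''M'' 0 0 = M"
  by (auto simp: env_def has_bits_def has_input_def)

lemma bval_in_code_update [simp]:
  "x \<notin> {''b'', A, i} \<Longrightarrow> bval (in_code A i) (set_ncell x j k v s) = bval (in_code A i) s"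
  "bval (in_code A i) (set_rcell y j k w s) = bval (in_code A i) s"
  by (auto simp: in_code_def)

lemma count_rows:
  assumes "env M s" "M < 2 ^ n"
  shows "wp count_rows (\<lambda>s'. nmem s' ''k'' 0 0 = card (set_decode M)) s"
  unfolding count_rows_def
proof (rule wp_Seq, rule wp_Assign, rule wp_For[where N = n and I = "\<lambda>k s'. nmem s' ''k'' 0 0 = card
  (set_decode M \<inter> {..<k})"], goal_cases)
  case (6 i s1)
  have "env M s1" using env_agree[OF 6(4)] assms(1) by
    (simp add: env_def has_bits_def has_input_def has_subsets_def)
  then show ?case using 6 assms
    by (intro wp_intros) (auto simp: bval_in_code env_simps card_Int_lessThan_Suc)
next
  case (7 s1)
  then show ?case using set_decode_bounded[OF assms(2)] by (simp add: Int_absorb2)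
qed (use assms in \<open>simp_all add: loop_simps env_simps\<close>)

text \<open>The bound \<open>4 ^ n\<close> is recorded because the entry serves as the number of
  rounds of the loop in \<open>relax\<close>.\<close>

definition has_weights :: "nat \<Rightarrow> nat \<Rightarrow> state \<Rightarrow> bool" where
  "has_weights M k s \<longleftrightarrow> (\<forall>x<k. nmem s ''w'' 0 x \<le> 4 ^ n \<and>
     real (nmem s ''w'' 0 x) = \<bar>sum (excess (set_decode M)) (set_decode x)\<bar>)"

lemma sum_excess:
  "finite B \<Longrightarrow> sum (excess A) B = real (n * card (A \<inter> B)) - real (card A * card B)"
  by (simp add: excess_def sum_subtractf sum_distrib_left[symmetric] Int_def conj_commute)

lemma of_nat_abs_diff: "real ((y - z) + (z - y)) = \<bar>real y - real z\<bar>" for y z :: nat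
  by (cases "z \<le> y") (auto simp: of_nat_diff)

lemma weigh:
  assumes "env M s" "M < 2 ^ n" "nmem s ''k'' 0 0 = card (set_decode M)" "nmem s ''B'' 0 0 = b" "b < 2 ^ n"
    and "has_weights M b s"
  shows "wp weigh (has_weights M (Suc b)) s"
  unfolding weigh_def
proof (intro wp_Seq wp_Assign, rule wp_For[where N = n and I = "\<lambda>k s'.
    nmem s' ''y'' 0 0 = n * card (set_decode M \<inter> set_decode b \<inter> {..<k}) \<and>
    nmem s' ''z'' 0 0 = card (set_decode M) * card (set_decode b \<inter> {..<k})"], goal_cases)
  case (6 i s1)
  have "env M s1" "nmem s1 ''k'' 0 0 = card (set_decode M)" "nmem s1 ''B'' 0 0 = b"
    using env_agree[OF 6(4)] 6(4) assms by (auto simp: env_def has_bits_def has_input_def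
      has_subsets_def agree_def)
  then show ?case using 6 assms
    by (intro wp_intros) (auto simp: bval_in_code env_simps card_Int_lessThan_Suc)
next
  case (7 s1)
  have sub: "set_decode M \<subseteq> {..<n}" "set_decode b \<subseteq> {..<n}" using set_decode_bounded assms by auto
  have w: "nmem s1 ''w'' = nmem s ''w''" "nmem s1 ''B'' 0 0 = b" using 7(2) assms by (auto simp: agree_def)
  let ?y = "n * card (set_decode M \<inter> set_decode b)" and ?z = "card (set_decode M) * card (set_decode b)"
  have yz: "nmem s1 ''y'' 0 0 = ?y" "nmem s1 ''z'' 0 0 = ?z" using 7(1) sub by
    (auto simp: Int_absorb2 le_infI1)
  have card_le: "card A \<le> n" if "A \<subseteq> {..<n}" for A using card_mono[OF _ that] by simp
  have "?y \<le> n * n" using card_le[of "set_decode M \<inter> set_decode b"] sub by (intro mult_mono) auto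
  moreover have "?z \<le> n * n" using card_le sub by (intro mult_mono) auto
  ultimately have "(?y - ?z) + (?z - ?y) \<le> n * n" by linarith
  also have "n * n \<le> 2 ^ n * 2 ^ n" by (intro mult_mono) (auto simp: less_imp_le)
  also have "(2::nat) ^ n * 2 ^ n = 4 ^ n" by (simp flip: power_mult_distrib)
  finally have "(?y - ?z) + (?z - ?y) \<le> 4 ^ n" .
  moreover have "real ((?y - ?z) + (?z - ?y)) = \<bar>sum (excess (set_decode M)) (set_decode b)\<bar>"
    unfolding sum_excess[OF finite_set_decode] by (rule of_nat_abs_diff)
  ultimately show ?case using assms(6) w yz
    by (intro wp_Assign) (auto simp: has_weights_def less_Suc_eq)
qed (use assms in \<open>simp_all add: loop_simps env_simps\<close>)

lemma weights_prog:
  assumes "env M s" "M < 2 ^ n"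
  shows "wp weights_prog (\<lambda>s'. nmem s' ''k'' 0 0 = card (set_decode M) \<and> has_weights M (2 ^ n) s') s"
  unfolding weights_prog_def
proof (rule wp_Seq, rule wp_conseq[OF count_rows[OF assms]], goal_cases)
  case (1 s1)
  have e: "env M s1" using env_agree[OF 1(1)] assms by simp
  show ?case
  proof (rule wp_For[where N = "2 ^ n" and I = "has_weights M"], goal_cases)
    case (6 b s2)
    have "env M s2" "nmem s2 ''k'' 0 0 = card (set_decode M)"
      using env_agree[OF 6(4)] e 6(4) 1(2) by (auto simp: agree_def)
    then show ?case using 6 assms weigh by blast
  next
    case (7 s2)
    then show ?case using 1(2) by (simp add: agree_def)
  qed (use e in \<open>simp_all add: loop_simps env_simps has_weights_def\<close>)
qed

lemma infinity_prog:
  assumes "nmem s ''n'' 0 0 = n"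
  shows "wp infinity_prog (\<lambda>s'. nmem s' ''g'' 0 0 = n * n + 1) s"
  unfolding infinity_prog_def
proof (rule wp_Seq, rule wp_Assign, rule wp_For[where N = n and I = "\<lambda>k s'. nmem s' ''g'' 0 0
  = k * n + 1"], goal_cases)
  case (6 i s1)
  then show ?case using assms by (intro wp_Assign) (simp add: agree_def)
qed (use assms in \<open>simp_all add: loop_simps\<close>)

lemma relax:
  assumes "env M s" "has_weights M (2 ^ n) s"
    and "nmem s ''A'' 0 0 = a" "nmem s ''B'' 0 0 = b" "nmem s ''r'' 0 0 = r" "nmem s ''q'' 0 0 = q"
    and "a < 2 ^ n" "b < 2 ^ n" "r < n" "q < n"
  shows "wp relax (\<lambda>s'. \<forall>x y. rmem s' ''F'' x y =
    (if x = a \<and> y = r \<and> splits a b then min (rmem s ''F'' a r) (candidate M (rmem s ''F'') a r b q)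
     else rmem s ''F'' x y)) s"
proof -
  have sub: "0 < nmem s ''s'' b a \<longleftrightarrow> set_decode b \<subseteq> set_decode a"
    using assms by (simp add: env_def has_subsets_def)
  have w: "nmem s ''w'' 0 b \<le> 4 ^ n"
    "real (nmem s ''w'' 0 b) = \<bar>sum (excess (set_decode M)) (set_decode b)\<bar>"
    using assms by (auto simp: has_weights_def)
  have T: "nmem s ''m'' 0 0 = m" "nmem s ''T'' r m = sa r" "nmem s ''T'' q m = sa q"
    "rmem s ''d'' (sa r) (sa q) = sa_dist r q"
    using assms sa_in by (auto simp: env_def has_input_def sa_def sa_dist_def)
  show ?thesis
    unfolding relax_def
  proof (rule wp_Cond)
    assume "bval (AndB (LessN (Num 0) (V ''B'')) (AndB (LessN (V ''B'') (V ''A'')) (LessN (Num 0)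
      (Cell ''s'' (V ''B'') (V ''A''))))) s"
    then have sp: "splits a b" using assms(3,4) sub by simp
    show "wp (Seq (RAssign ''e'' (Num 0) (Num 0) (RPlus (RCell ''F'' (Minus (V ''A'') (V ''B''))
      (V ''r'')) (RCell ''F'' (V ''B'') (V ''q''))))
     (Seq (For ''i'' (Cell ''w'' (Num 0) (V ''B'')) (RAssign ''e'' (Num 0) (Num 0) (RPlus
       (RCell ''e'' (Num 0) (Num 0))
         (RCell ''d'' (Cell ''T'' (V ''r'') (V ''m'')) (Cell ''T'' (V ''q'') (V ''m''))))))
     (Cond (LessR (RCell ''e'' (Num 0) (Num 0)) (RCell ''F'' (V ''A'') (V ''r'')))
         (RAssign ''F'' (V ''A'') (V ''r'') (RCell ''e'' (Num 0) (Num 0))) Skip)))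
       (\<lambda>s'. \<forall>x y. rmem s' ''F'' x y = (if x = a \<and> y = r \<and> splits a b
          then min (rmem s ''F'' a r) (candidate M (rmem s ''F'') a r b q) else rmem s ''F'' x y)) s"
    proof (intro wp_Seq wp_RAssign, rule wp_For[where N = "nmem s ''w'' 0 b" and
        I = "\<lambda>k s'. rmem s' ''e'' 0 0 = rmem s ''F''
          (a - b) r + rmem s ''F'' b q + real k * sa_dist r q"], goal_cases)
      case (6 i s1)
      then show ?case using assms(3-6) T by (intro wp_RAssign) (simp add: agree_def distrib_right)
    next
      case (7 s1)
      have "rmem s1 ''e'' 0 0 = candidate M (rmem s ''F'') a r b q" using 7(1) w by
        (simp add: candidate_def)
      moreover have "rmem s1 ''F'' = rmem s ''F''" "nmem s1 ''A'' 0 0 = a" "nmem s1 ''r'' 0 0 = r"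
        using 7(2) assms(3,5) by (auto simp: agree_def)
      ultimately show ?case using sp by (intro wp_intros) (auto simp: min_def)
    qed (use assms(3-6) w in \<open>simp_all add: loop_simps\<close>)
  next
    assume "\<not> bval (AndB (LessN (Num 0) (V ''B'')) (AndB (LessN (V ''B'') (V ''A'')) (LessN (Num 0)
      (Cell ''s'' (V ''B'') (V ''A''))))) s"
    then have "\<not> splits a b" using assms(3,4) sub by auto
    then show "wp Skip (\<lambda>s'. \<forall>x y. rmem s' ''F'' x y = (if x = a \<and> y = r \<and> splits a b
          then min (rmem s ''F'' a r) (candidate M (rmem s ''F'') a r b q) else rmem s ''F'' x y)) s"
      by (intro wp_Skip) auto
  qed
qed

lemma tree_init:
  assumes "env M s" "nmem s ''A'' 0 0 = a" "nmem s ''r'' 0 0 = r" "r < n" "nmem s ''g'' 0 0 = n * n + 1"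
  shows "wp tree_init (\<lambda>s'. \<forall>x y. rmem s' ''F'' x y =
    (if x = a \<and> y = r then if set_decode a = {r} then 0 else inf_value else rmem s ''F'' x y)) s"
proof -
  have "nmem s ''p'' 0 r = 2 ^ r" using assms by (simp add: env_def has_bits_def)
  then show ?thesis
    unfolding tree_init_def set_decode_singleton_iff using assms
    by (intro wp_intros) (auto simp: inf_value_def)
qed

lemma candidate_cong:
  "splits a b \<Longrightarrow> (\<And>x y. x \<noteq> a \<Longrightarrow> F x y = G x y) \<Longrightarrow> candidate M F a r b q = candidate M G a r b q"
  by (cases "a - b = a") (auto simp: candidate_def)

lemma tree_entry:
  assumes "env M s" "has_weights M (2 ^ n) s" "nmem s ''g'' 0 0 = n * n + 1"
    and "nmem s ''A'' 0 0 = a" "nmem s ''r'' 0 0 = r" "a < 2 ^ n" "r < n"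
    and ok: "\<And>x y. x < a \<Longrightarrow> y < n \<Longrightarrow> entry_sound M x y (rmem s ''F'' x y) \<and> entry_complete M x y
      (rmem s ''F'' x y)"
  shows "wp tree_entry (\<lambda>s'. (\<forall>x y. x \<noteq> a \<or> y \<noteq> r \<longrightarrow> rmem s' ''F'' x y = rmem s ''F'' x y) \<and>
    entry_sound M a r (rmem s' ''F'' a r) \<and> entry_complete M a r (rmem s' ''F'' a r)) s"
proof -
  let ?F = "rmem s ''F''"
  \<comment> \<open>\<open>P\<close> collects the pairs \<open>(b, q)\<close> tried so far.
    Candidates refer to the initial table \<open>?F\<close>: a proper split reads only rows
    \<open>a - b\<close> and \<open>b\<close>, which do not change while row \<open>a\<close> is
    filled.\<close>
  define J where "J P s' \<longleftrightarrow> (\<forall>x y. x \<noteq> a \<or> y \<noteq> r \<longrightarrow> rmem s' ''F'' x y = ?F x y) \<and>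
    entry_sound M a r (rmem s' ''F'' a r) \<and> rmem s' ''F'' a r \<le> inf_value \<and>
    (set_decode a = {r} \<longrightarrow> rmem s' ''F'' a r \<le> 0) \<and>
    (\<forall>(b, q)\<in>P. splits a b \<longrightarrow> rmem s' ''F'' a r \<le> candidate M ?F a r b q)"
    for P and s' :: state
  have J_set_ncell: "J P (set_ncell x i j v s') = J P s'" for P x i j v s' by (simp add: J_def)
  show ?thesis
    unfolding tree_entry_def
  proof (rule wp_Seq, rule wp_conseq[OF tree_init[OF assms(1,4,5,7,3)]], goal_cases)
    case (1 s1)
    have e1: "env M s1" "has_weights M (2 ^ n) s1" "nmem s1 ''A'' 0 0 = a" "nmem s1 ''r'' 0 0 = r"
      using env_agree[OF 1(1)] 1(1) assms by (auto simp: agree_def has_weights_def)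
    have J0: "J {} s1" using 1(2) tree_cost.single[of _ _ r]
      by (auto simp: J_def entry_sound_def inf_value_def)
    show ?case
    proof (rule wp_For[where N = "2 ^ n" and I = "\<lambda>b. J ({..<b} \<times> {..<n})"], goal_cases)
      case (6 b s2)
      have e2: "env M s2" "has_weights M (2 ^ n) s2" "nmem s2 ''A'' 0 0 = a" "nmem s2 ''r'' 0 0 = r"
        using env_agree[OF 6(4)] 6(4) e1 by (auto simp: agree_def has_weights_def)
      show ?case
      proof (rule wp_For[where N = n and I = "\<lambda>q. J ({..<b} \<times> {..<n} \<union> {b} \<times> {..<q})"], goal_cases)
        case (6 q s3)
        have e3: "env M s3" "has_weights M (2 ^ n) s3" "nmem s3 ''A'' 0 0 = a" "nmem s3 ''r'' 0 0
          = r" "nmem s3 ''B'' 0 0 = b"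
          using env_agree[OF 6(4)] 6(4) e2 \<open>nmem s2 ''B'' 0 0 = b\<close> by (auto simp: agree_def has_weights_def)
        show ?case
        proof (rule wp_conseq[OF relax[OF e3(1-3) e3(5) e3(4) 6(3) assms(6) \<open>b < 2 ^ n\<close> assms(7)
          6(1)]], goal_cases)
          case (1 s4)
          have J3: "J ({..<b} \<times> {..<n} \<union> {b} \<times> {..<q}) s3" by fact
          have P: "{..<b} \<times> {..<n} \<union> {b} \<times> {..<Suc q} = insert (b, q) ({..<b} \<times> {..<n} \<union> {b} \<times> {..<q})"
            by (auto simp: less_Suc_eq)
          show ?case
          proof (cases "splits a b")
            case True
            have c: "candidate M (rmem s3 ''F'') a r b q = candidate M ?F a r b q"
              by (rule candidate_cong[OF True]) (use J3 in \<open>simp add: J_def\<close>)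
            have F4: "rmem s4 ''F'' a r = min (rmem s3 ''F'' a r) (candidate M ?F a r b q)"
              "\<And>x y. x \<noteq> a \<or> y \<noteq> r \<Longrightarrow> rmem s4 ''F'' x y = ?F x y"
              using 1(2) True J3 unfolding c[symmetric] by (auto simp: J_def)
            have "entry_sound M a r (rmem s4 ''F'' a r)"
              unfolding F4(1)
              by (rule entry_sound_min_candidate) (use J3 True ok assms 6(1) in \<open>auto simp: J_def\<close>)
            moreover have le: "rmem s4 ''F'' a r \<le> rmem s3 ''F'' a r"
              "rmem s4 ''F'' a r \<le> candidate M ?F a r b q" unfolding F4(1) by simp_all
            moreover have "\<forall>(b', q')\<in>{..<b} \<times> {..<n} \<union> {b} \<times> {..<q}.
                splits a b' \<longrightarrow> rmem s4 ''F'' a r \<le> candidate M ?F a r b' q'"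
              using J3 order_trans[OF le(1)] unfolding J_def by blast
            ultimately show ?thesis using J3 F4(2) order_trans[OF le(1)] unfolding J_def P by simp
          next
            case False
            then have "rmem s4 ''F'' = rmem s3 ''F''"
              using 1(2) by (intro ext) (simp only: simp_thms if_False)
            then show ?thesis using J3 False unfolding J_def P by auto
          qed
        qed
      next
        case (7 s3)
        moreover have "{..<b} \<times> {..<n} \<union> {b} \<times> {..<n} = {..<Suc b} \<times> {..<n}" by (auto simp: less_Suc_eq)
        ultimately show ?case by simp
      qed (use 6(2) e2 in \<open>simp_all add: loop_simps env_simps J_set_ncell\<close>)
    next
      case (7 s2)
      let ?v = "rmem s2 ''F'' a r"
      have "entry_complete M a r ?v"
      proof (rule entry_completeI[where F = ?F])
        show "?v \<le> candidate M ?F a r b q" if "splits a b" "q < n" for b q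
          using 7(1) that assms(6) by (auto simp: J_def)
      qed (use 7(1) assms(6) ok in \<open>auto simp: J_def\<close>)
      then show ?case using 7(1) by (simp add: J_def)
    qed (use J0 e1 in \<open>simp_all add: loop_simps env_simps J_set_ncell\<close>)
  qed
qed

definition has_trees :: "nat \<Rightarrow> nat \<Rightarrow> nat \<Rightarrow> state \<Rightarrow> bool" where
  "has_trees M a r s \<longleftrightarrow> (\<forall>x y. y < n \<and> (x < a \<or> x = a \<and> y < r) \<longrightarrow>
     entry_sound M x y (rmem s ''F'' x y) \<and> entry_complete M x y (rmem s ''F'' x y))"

lemma has_trees_set_ncell [simp]: "has_trees M a r (set_ncell x i j v s) = has_trees M a r s"
  by (simp add: has_trees_def)

lemma tree_prog:
  assumes "env M s" "has_weights M (2 ^ n) s" "nmem s ''g'' 0 0 = n * n + 1"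
  shows "wp tree_prog (has_trees M (2 ^ n) 0) s"
  unfolding tree_prog_def
proof (rule wp_For[where N = "2 ^ n" and I = "\<lambda>a. has_trees M a 0"], goal_cases)
  case (6 a s1)
  have e1: "env M s1" "has_weights M (2 ^ n) s1" "nmem s1 ''g'' 0 0 = n * n + 1"
    using env_agree[OF 6(4)] 6(4) assms by (auto simp: agree_def has_weights_def)
  show ?case
  proof (rule wp_For[where N = n and I = "has_trees M a"], goal_cases)
    case (6 r s2)
    have e2: "env M s2" "has_weights M (2 ^ n) s2" "nmem s2 ''g'' 0 0 = n * n + 1" "nmem s2 ''A'' 0 0 = a"
      using env_agree[OF 6(4)] 6(4) e1 \<open>nmem s1 ''A'' 0 0 = a\<close> by (auto simp: agree_def has_weights_def)
    show ?case
      by (rule wp_conseq[OF tree_entry[OF e2 6(3) \<open>a < 2 ^ n\<close> 6(1)]])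
        (use 6(2) in \<open>auto simp: has_trees_def less_Suc_eq\<close>)
  next
    case (7 s2)
    then show ?case by (auto simp: has_trees_def less_Suc_eq)
  qed (use 6(2) e1 in \<open>simp_all add: loop_simps env_simps\<close>)
qed (use assms in \<open>simp_all add: loop_simps env_simps has_trees_def\<close>)

lemma threshold:
  assumes "env M s" "M < 2 ^ n"
  shows "wp threshold (\<lambda>s'. rmem s' ''u'' 0 0 = real n * real (card (set_decode M)) * t) s"
  unfolding threshold_def
proof (rule wp_Seq, rule wp_RAssign, rule wp_For[where N = n and I = "\<lambda>k s'. rmem s' ''u'' 0 0
  = real n * real (card (set_decode M \<inter> {..<k})) * t"], goal_cases)
  case (6 i s1)
  have e1: "env M s1" using env_agree[OF 6(4)] assms(1)
    by (simp add: env_def has_bits_def has_input_def has_subsets_def)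
  show ?case
  proof (rule wp_Cond)
    assume "bval (in_code ''M'' ''i'') s1"
    then have i: "i \<in> set_decode M" using e1 6 assms by (simp add: bval_in_code env_simps)
    show "wp (For ''q'' (V ''n'') (RAssign ''u'' (Num 0) (Num 0) (RPlus (RCell ''u'' (Num 0)
      (Num 0)) (RCell ''t'' (Num 0) (Num 0)))))
      (\<lambda>s'. rmem s' ''u'' 0 0 = real n * real (card (set_decode M \<inter> {..<Suc i})) * t) s1"
    proof (rule wp_For[where N = n and I = "\<lambda>k s'. rmem s' ''u'' 0 0 = real n * real (card
      (set_decode M \<inter> {..<i})) * t + real k * t"], goal_cases)
      case (6 q s2)
      moreover have "rmem s1 ''t'' 0 0 = t" using e1 by (simp add: env_def has_input_def)
      ultimately show ?case by (intro wp_RAssign) (simp add: agree_def distrib_right)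
    next
      case (7 s2)
      then show ?case using i by (simp add: card_Int_lessThan_Suc algebra_simps)
    qed (use 6(2) e1 in \<open>simp_all add: loop_simps env_simps\<close>)
  next
    assume "\<not> bval (in_code ''M'' ''i'') s1"
    then have "i \<notin> set_decode M" using e1 6 assms by (simp add: bval_in_code env_simps)
    then show "wp Skip (\<lambda>s'. rmem s' ''u'' 0 0 = real n * real (card (set_decode M \<inter> {..<Suc i})) * t) s1"
      using 6(2) by (intro wp_Skip) (simp add: card_Int_lessThan_Suc)
  qed
next
  case (7 s1)
  then show ?case using set_decode_bounded[OF assms(2)] by (simp add: Int_absorb2)
qed (use assms in \<open>simp_all add: loop_simps env_simps\<close>)

text \<open>From \<open>card (set_decode M) \<le> n\<close> and \<open>t \<le> 1\<close> the
  threshold lies below \<open>inf_value\<close>, so an entry within it belongs to a tree.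
  Conversely, the least entry of the row bounds all trees from below, whatever their root. The code
  \<open>2 ^ n - 1\<close> is the set of all rows.\<close>

lemma close_iff_entry:
  assumes M: "M < 2 ^ n" "M \<noteq> 0"
    and F: "\<And>r. r < n \<Longrightarrow> entry_sound M (2 ^ n - 1) r (F r) \<and> entry_complete M (2 ^ n - 1) r (F r)"
  shows "close (set_decode M) \<longleftrightarrow> (\<exists>r<n. F r \<le> real n * real (card (set_decode M)) * t)"
proof -
  let ?M = "set_decode M"
  have sub: "?M \<subseteq> {..<n}" using set_decode_bounded M by blast
  have ne: "?M \<noteq> {}" using M by (metis set_decode_inverse set_encode_empty)
  then have n0: "n \<noteq> 0" using sub by auto
  show ?thesis
  proof
    assume "\<exists>r<n. F r \<le> real n * real (card ?M) * t"
    then obtain r where r: "r < n" "F r \<le> real n * real (card ?M) * t" by blast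
    have "card ?M \<le> n" using card_mono[OF _ sub] by simp
    then have "real n * real (card ?M) \<le> real n * real n" by (intro mult_left_mono) auto
    then have "real n * real (card ?M) * t \<le> real n * real n * 1"
      by (rule mult_mono) (use t01 in auto)
    also have "\<dots> < inf_value" by (simp add: inf_value_def)
    finally have "F r \<noteq> inf_value" using r by linarith
    then have "tree_cost (excess ?M) sa_dist {..<n} r (F r)"
      using F[OF r(1)] by (simp add: entry_sound_def set_decode_full[of n, unfolded One_nat_def])
    then show "close ?M" using r sub ne close_if_tree_cost by blast
  next
    assume c: "close ?M"
    let ?x = "Min (F ` {..<n})"
    have "?x \<le> real n * real (card ?M) * t"
    proof (rule tree_cost_bound_if_close[OF sub ne c])
      fix r c assume tc: "tree_cost (excess ?M) sa_dist {..<n} r c"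
      then have r: "r < n" using tree_cost_root by fastforce
      then have "F r \<le> c" using F[OF r] tc by (simp add: entry_complete_def set_decode_full[of n,
        unfolded One_nat_def])
      moreover have "?x \<le> F r" using r by simp
      ultimately show "?x \<le> c" by simp
    qed
    moreover have "?x \<in> F ` {..<n}" using n0 by (intro Min_in) auto
    ultimately show "\<exists>r<n. F r \<le> real n * real (card ?M) * t" by auto
  qed
qed

text \<open>The code 0 is exempt: the distribution of the empty group is the junk value \<open>0 / 0 = 0\<close>.\<close>

definition has_close :: "nat \<Rightarrow> state \<Rightarrow> bool" where
  "has_close k s \<longleftrightarrow> (\<forall>x<k. x \<noteq> 0 \<longrightarrow> (0 < nmem s ''o'' 0 x \<longleftrightarrow> close (set_decode x)))"

lemma has_close_set_ncell: "x \<noteq> ''o'' \<Longrightarrow> has_close k (set_ncell x i j v s) = has_close k s"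
  by (simp add: has_close_def)

lemma close_test:
  assumes "env M s" "has_trees M (2 ^ n) 0 s" "has_close M s" "M < 2 ^ n"
  shows "wp close_test (has_close (Suc M)) s"
  unfolding close_test_def
proof (rule wp_Seq, rule wp_conseq[OF threshold[OF assms(1,4)]], goal_cases)
  case (1 s1)
  have e1: "env M s1" "rmem s1 ''F'' = rmem s ''F''" "nmem s1 ''o'' = nmem s ''o''"
    using env_agree[OF 1(1)] 1(1) assms by (auto simp: agree_def)
  let ?F = "rmem s ''F'' (2 ^ n - 1)" and ?u = "real n * real (card (set_decode M)) * t"
  show ?case
  proof (rule wp_Seq, rule wp_Assign, rule wp_For[where N = n and I = "\<lambda>k s'. \<forall>x. 0 < nmem s' ''o'' 0 x \<longleftrightarrow>
      (if x = M then \<exists>r<k. ?F r \<le> ?u else 0 < nmem s ''o'' 0 x)"], goal_cases)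
    case (6 r s2)
    have "nmem s2 ''M'' 0 0 = M" "nmem s2 ''N'' 0 0 = 2 ^ n" "rmem s2 ''u'' 0 0 = ?u" "rmem s2 ''F''
      = rmem s ''F''"
      using 6(4) e1 1(2) by (auto simp: agree_def env_simps)
    then show ?case using 6(2,3) by (intro wp_intros) (auto simp: less_Suc_eq not_less)
  next
    case (7 s2)
    have "close (set_decode M) \<longleftrightarrow> (\<exists>r<n. ?F r \<le> ?u)" if "M \<noteq> 0"
      using assms(2) that by (intro close_iff_entry assms) (auto simp: has_trees_def)
    then show ?case using 7(1) assms(3) by (auto simp: has_close_def less_Suc_eq)
  qed (use e1 in \<open>simp_all add: loop_simps env_simps\<close>)
qed

lemma close_prog:
  assumes "has_bits s" "has_input s" "has_subsets s"
  shows "wp close_prog (has_close (2 ^ n)) s"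
  unfolding close_prog_def
proof (rule wp_Seq, rule wp_conseq[OF infinity_prog[OF has_input_n[OF assms(2)]]], goal_cases)
  case (1 s1)
  have e1: "has_bits s1" "has_input s1" "has_subsets s1"
    using has_bits_agree[OF 1(1)] has_input_agree[OF 1(1)] has_subsets_agree[OF 1(1)] assms by auto
  show ?case
  proof (rule wp_For[where N = "2 ^ n" and I = has_close], goal_cases)
    case (6 M s2)
    have e2: "env M s2" "nmem s2 ''g'' 0 0 = n * n + 1"
      using has_bits_agree[OF 6(4)] has_input_agree[OF 6(4)] has_subsets_agree[OF 6(4)] e1 6(3,4) 1(2)
      by (auto simp: env_def agree_def)
    show ?case
    proof (rule wp_Seq, rule wp_conseq[OF weights_prog[OF e2(1) 6(1)]], rule wp_Seq, goal_cases)
      case (1 s3)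
      have e3: "env M s3" "has_weights M (2 ^ n) s3" "nmem s3 ''g'' 0 0 = n * n + 1" "nmem s3 ''o''
        = nmem s2 ''o''"
        using env_agree[OF 1(1)] e2 1 by (auto simp: agree_def)
      show ?case
      proof (rule wp_conseq[OF tree_prog[OF e3(1-3)]], goal_cases)
        case (1 s4)
        have "env M s4" "nmem s4 ''o'' = nmem s3 ''o''" using env_agree[OF 1(1)] e3 1 by
          (auto simp: agree_def)
        then show ?case using 1 6 e3 by (intro close_test) (auto simp: has_close_def)
      qed
    qed
  qed (use e1 in \<open>simp_all add: loop_simps has_close_set_ncell has_close_def[of 0]\<close>)
qed

section \<open>Optimal partitions by splitting off one group\<close>

abbreviation group_cost :: "nat set \<Rightarrow> nat" where
  "group_cost B \<equiv> suppression_cost m (subtable rs B)"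

definition admissible :: "nat \<Rightarrow> nat \<Rightarrow> bool" where
  "admissible a b \<longleftrightarrow> 0 < b \<and> set_decode b \<subseteq> set_decode a \<and> close (set_decode b)"

lemma admissible_le: "admissible a b \<Longrightarrow> b \<le> a"
  by (simp add: admissible_def subset_decode_imp_le)

lemma best_infinity:
  assumes "has_input s"
  shows "wp best_infinity (\<lambda>s'. nmem s' ''g'' 0 0 = n * m + 1) s"
  unfolding best_infinity_def
proof (rule wp_Seq, rule wp_Assign, rule wp_For[where N = n and I = "\<lambda>k s'. nmem s' ''g'' 0 0
  = k * m + 1"], goal_cases)
  case (6 i s1)
  then show ?case using has_input_m[OF assms] by (intro wp_Assign) (simp add: agree_def)
qed (use assms in \<open>simp_all add: loop_simps\<close>)

text \<open>The codes below \<open>k\<close> have been tried as first group. The marker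
  \<open>n * m + 1\<close> stays where nothing cheaper was found; for other values at a nonempty
  set, \<open>h a\<close> is a group that realises \<open>v a\<close>.\<close>

definition best_entry :: "(nat \<Rightarrow> nat) \<Rightarrow> (nat \<Rightarrow> nat) \<Rightarrow> nat \<Rightarrow> nat \<Rightarrow> bool" where
  "best_entry v h k a \<longleftrightarrow> v a \<le> n * m + 1 \<and> (a = 0 \<longrightarrow> v a = 0 \<and> h a = 0) \<and>
     (a \<noteq> 0 \<longrightarrow> v a = n * m + 1 \<or> admissible a (h a) \<and> v a = group_cost (set_decode (h a)) + v (a - h a)) \<and>
     (\<forall>b<k. admissible a b \<longrightarrow> v a \<le> group_cost (set_decode b) + v (a - b))"

definition group_data :: "state \<Rightarrow> bool" where
  "group_data s \<longleftrightarrow> nmem s ''N'' 0 0 = 2 ^ n \<and> has_subsets s \<and> has_close (2 ^ n) s \<and> has_costs s"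

lemma group_data_agree:
  "agree X s s' \<Longrightarrow> {''N'', ''s'', ''o'', ''c''} \<inter> X = {} \<Longrightarrow> group_data s' = group_data s"
  using has_subsets_agree[of X s s'] by (simp add: agree_def group_data_def has_close_def has_costs_def)

lemma best_init:
  assumes "nmem s ''A'' 0 0 = a" "nmem s ''g'' 0 0 = n * m + 1"
  shows "wp best_init (\<lambda>s'. (\<forall>x. x \<noteq> a \<longrightarrow> nmem s' ''v'' 0 x = nmem s ''v'' 0 x \<and> nmem s' ''h'' 0 x
    = nmem s ''h'' 0 x) \<and>
    best_entry (nmem s' ''v'' 0) (nmem s' ''h'' 0) 0 a) s"
  unfolding best_init_def using assms by (intro wp_intros) (auto simp: best_entry_def)

lemma best_relax:
  assumes "group_data s" "nmem s ''A'' 0 0 = a" "nmem s ''B'' 0 0 = b" "a < 2 ^ n" "b < 2 ^ n"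
    and "best_entry (nmem s ''v'' 0) (nmem s ''h'' 0) b a"
  shows "wp best_relax (\<lambda>s'. (\<forall>x. x \<noteq> a \<longrightarrow> nmem s' ''v'' 0 x = nmem s ''v'' 0 x \<and> nmem s' ''h'' 0 x
    = nmem s ''h'' 0 x) \<and>
    best_entry (nmem s' ''v'' 0) (nmem s' ''h'' 0) (Suc b) a) s"
proof -
  have data: "0 < nmem s ''s'' b a \<longleftrightarrow> set_decode b \<subseteq> set_decode a"
    "0 < b \<Longrightarrow> 0 < nmem s ''o'' 0 b \<longleftrightarrow> close (set_decode b)"
    "nmem s ''c'' 0 b = group_cost (set_decode b)"
    using assms by (auto simp: group_data_def has_subsets_def has_close_def has_costs_def)
  define w where "w = group_cost (set_decode b) + nmem s ''v'' 0 (a - b)"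
  have better: "best_entry ((nmem s ''v'' 0)(a := w)) ((nmem s ''h'' 0)(a := b)) (Suc b) a"
    if adm: "admissible a b" and less: "w < nmem s ''v'' 0 a"
  proof -
    have pos: "0 < b" "b \<le> a" using adm admissible_le by (auto simp: admissible_def)
    \<comment> \<open>An admissible code is positive and at most \<open>a\<close>, so
      \<open>a - b\<close> is a different cell, and overwriting cell \<open>a\<close> leaves all
      candidates unchanged.\<close>
    have neq: "x - y \<noteq> x" if "0 < y" "y \<le> x" for x y :: nat using that by simp
    have "w \<le> group_cost (set_decode b') + nmem s ''v'' 0 (a - b')" if "b' < Suc b" "admissible a b'" for b'
      using that assms(6) less by (auto simp: best_entry_def less_Suc_eq w_def intro: order_trans[OF
        less_imp_le])
    then show ?thesis
      using pos less assms(6) adm neq[OF _ admissible_le[of a]] by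
        (auto simp: best_entry_def w_def admissible_def)
  qed
  have worse: "best_entry (nmem s ''v'' 0) (nmem s ''h'' 0) (Suc b) a"
    if "\<not> (admissible a b \<and> w < nmem s ''v'' 0 a)"
    using that assms(6) by (auto simp: best_entry_def w_def less_Suc_eq not_less)
  have upd: "nmem (set_ncell ''h'' 0 a b (set_ncell ''v'' 0 a w s)) ''v'' 0 = (nmem s ''v'' 0)(a := w)"
    "nmem (set_ncell ''h'' 0 a b (set_ncell ''v'' 0 a w s)) ''h'' 0 = (nmem s ''h'' 0)(a := b)" by auto
  show ?thesis unfolding best_relax_def
  proof (rule wp_Cond, goal_cases)
    case 1
    then have "admissible a b" "w < nmem s ''v'' 0 a" using assms(2,3) data by
      (auto simp: admissible_def w_def)
    from better[OF this] show ?case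
      using assms(2,3) data(3) upd by (intro wp_Seq wp_Assign) (simp add: w_def[symmetric])
  next
    case 2
    then have "\<not> (admissible a b \<and> w < nmem s ''v'' 0 a)"
      using assms(2,3) data by (auto simp: admissible_def w_def)
    from worse[OF this] show ?case by (intro wp_Skip) simp
  qed
qed

lemma best_entry_cong:
  assumes "\<And>x. x \<le> a \<Longrightarrow> v' x = v x" "h' a = h a"
  shows "best_entry v' h' k a = best_entry v h k a"
  using assms(1) assms(2) by (cases "a = 0") (simp_all add: best_entry_def)

definition has_best :: "nat \<Rightarrow> state \<Rightarrow> bool" where
  "has_best k s \<longleftrightarrow> (\<forall>a<k. best_entry (nmem s ''v'' 0) (nmem s ''h'' 0) (2 ^ n) a)"

lemma best_prog:
  assumes "group_data s" "has_input s"
  shows "wp best_prog (has_best (2 ^ n)) s"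
  unfolding best_prog_def
proof (rule wp_Seq, rule wp_conseq[OF best_infinity[OF assms(2)]], goal_cases)
  case (1 s1)
  have e1: "group_data s1" using group_data_agree[OF 1(1)] assms by simp
  show ?case
  proof (rule wp_For[where N = "2 ^ n" and I = has_best], goal_cases)
    case (6 a s2)
    have e2: "group_data s2" "nmem s2 ''g'' 0 0 = n * m + 1"
      using group_data_agree[OF 6(4)] e1 1(2) 6(4) by (auto simp: agree_def)
    show ?case
    proof (rule wp_Seq, rule wp_conseq[OF best_init[OF 6(3) e2(2)]], goal_cases)
      case (1 s3)
      have e3: "group_data s3" "nmem s3 ''A'' 0 0 = a"
        using group_data_agree[OF 1(1)] e2 6(3) 1(1) by (auto simp: agree_def)
      have old: "has_best a s'" if "\<forall>x. x \<noteq> a \<longrightarrow> nmem s' ''v'' 0 x = nmem s3 ''v'' 0 x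
        \<and> nmem s' ''h'' 0 x = nmem s3 ''h'' 0 x" for s' :: state
      proof -
        have "best_entry (nmem s' ''v'' 0) (nmem s' ''h'' 0) (2 ^ n) x
            = best_entry (nmem s2 ''v'' 0) (nmem s2 ''h'' 0) (2 ^ n) x" if "x < a" for x
          using \<open>\<forall>x. _\<close> 1(2) that by (intro best_entry_cong) auto
        then show ?thesis using 6(2) by (simp add: has_best_def)
      qed
      show ?case
      proof (rule wp_For[where N = "2 ^ n" and I = "\<lambda>b s'. (\<forall>x. x \<noteq> a \<longrightarrow> nmem s' ''v'' 0 x
        = nmem s3 ''v'' 0 x \<and> nmem s' ''h'' 0 x = nmem s3 ''h'' 0 x) \<and>
          best_entry (nmem s' ''v'' 0) (nmem s' ''h'' 0) b a"], goal_cases)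
        case (6 b s4)
        have e4: "group_data s4" "nmem s4 ''A'' 0 0 = a"
          using group_data_agree[OF 6(4)] e3 6(4) by (auto simp: agree_def)
        show ?case
          by (rule wp_conseq[OF best_relax[OF e4 6(3) \<open>a < 2 ^ n\<close> 6(1)]]) (use 6(2) in auto)
      next
        case (7 s4)
        then have "has_best a s4" using old by blast
        then show ?case using 7(1) by (auto simp: has_best_def less_Suc_eq)
      qed (use 1(2) e3 in \<open>simp_all add: loop_simps group_data_def\<close>)
    qed
  qed (use e1 in \<open>simp_all add: loop_simps group_data_def has_best_def\<close>)
qed

text \<open>The whole table has excess 0 at every row, so some tree costs at most 0. This makes the
  one-group partition feasible.\<close>

lemma close_all: "0 < n \<Longrightarrow> close {..<n}"
proof -
  assume n: "0 < n"
  let ?X = "\<lambda>i::nat. real n"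
  have "transport {..<n} {..<n} sa_dist ?X ?X 0"
    by (rule transport_refl) (use sa_in d_self in \<open>auto simp: sa_dist_def\<close>)
  then have "\<exists>r c. tree_cost (\<lambda>i. ?X i - ?X i) sa_dist {..<n} r c \<and> c \<le> 0"
    by (rule transport_tree_cost) (use n sa_dist_nonneg d_sym in \<open>auto simp: sa_dist_def\<close>)
  then obtain r c where rc: "tree_cost (\<lambda>i. ?X i - ?X i) sa_dist {..<n} r c" "c \<le> 0" by blast
  have "tree_cost (excess {..<n}) sa_dist {..<n} r c"
    by (rule tree_cost_cong[OF rc(1)]) (simp add: excess_def)
  then show "close {..<n}" by (rule close_if_tree_cost[rotated 2])
    (use n rc t01 in \<open>auto intro: order_trans\<close>)
qed

lemma suppression_cost_le: "B \<subseteq> {..<n} \<Longrightarrow> group_cost B \<le> n * m"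
proof -
  assume B: "B \<subseteq> {..<n}"
  then have fin: "finite B" using finite_subset by blast
  have "card B \<le> n" using card_mono[OF _ B] by simp
  moreover have "card {j. j < m \<and> differs B j} \<le> card {..<m}" by (intro card_mono) auto
  ultimately show ?thesis unfolding suppression_cost_subtable[OF fin] by (intro mult_mono) auto
qed

text \<open>Induction over the groups, any of which may come first: it is lifted to a set of
  positions with code \<open>b\<close>, and the other groups form a partition of
  \<open>a - b\<close>.\<close>

lemma best_le_partition_cost:
  assumes best: "\<And>x. x < 2 ^ n \<Longrightarrow> best_entry v h (2 ^ n) x"
    and "a < 2 ^ n" "\<Sum>\<^sub># Q = subtable rs (set_decode a)"
    and "\<And>M. M \<in># Q \<Longrightarrow> M \<noteq> {#} \<and> t_close m S d t (mset rs) M"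
  shows "v a \<le> partition_cost m Q"
  using assms(2-)
proof (induction Q arbitrary: a)
  case empty
  then have "set_decode a = {}" by (simp add: subtable_def mset_set_empty_iff)
  then have "a = 0" by (metis set_decode_inverse set_encode_empty)
  then show ?case using best[of 0] by (simp add: best_entry_def)
next
  case (add M Q)
  have "M \<subseteq># subtable rs (set_decode a)" using add.prems(2)[symmetric] by simp
  then obtain B where B: "B \<subseteq> set_decode a" "subtable rs B = M"
    using subtable_sub_multiset[OF finite_set_decode] by metis
  define b where "b = set_encode B"
  have b: "set_decode b = B" using B(1) finite_subset[OF _ finite_set_decode] by (simp add: b_def)
  have "B \<noteq> {}" using add.prems(3)[of M] B(2) by (auto simp: subtable_def)
  then have "0 < b" using b by (metis gr0I set_decode_zero)
  then have adm: "admissible a b" using b B add.prems(3)[of M] by (simp add: admissible_def)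
  have "subtable rs (set_decode (a - b)) = \<Sum>\<^sub># Q"
    using subtable_diff[OF finite_set_decode, of B a rs] set_decode_diff[of b a] b B add.prems(2) by auto
  then have "v (a - b) \<le> partition_cost m Q"
    using add.prems by (intro add.IH) auto
  moreover have "v a \<le> group_cost B + v (a - b)"
    using best[OF add.prems(1)] adm b add.prems(1) admissible_le[OF adm] by (auto simp: best_entry_def)
  ultimately show ?case using B(2) by (simp add: partition_cost_def)
qed

text \<open>The one-group partition is feasible and costs at most \<open>n * m\<close>, so the entry
  of the full set is not the marker.\<close>

lemma best_full_finite:
  assumes best: "\<And>x. x < 2 ^ n \<Longrightarrow> best_entry v h (2 ^ n) x"
  shows "v (2 ^ n - 1) < n * m + 1"
proof (cases "n = 0")
  case True
  then show ?thesis using best[of 0] by (simp add: best_entry_def)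
next
  case False
  define a where "a = (2::nat) ^ n - 1"
  have pos: "0 < a" using one_less_power[of "2::nat" n] False by (simp add: a_def)
  have full: "set_decode a = {..<n}" unfolding a_def by (rule set_decode_full)
  have "admissible a a" using pos full close_all False by (simp add: admissible_def)
  moreover have "a < 2 ^ n" by (simp add: a_def)
  ultimately have "v a \<le> group_cost {..<n} + v 0" using best[of a] full by (force simp: best_entry_def)
  moreover have "v 0 = 0" using best[of 0] by (simp add: best_entry_def)
  ultimately show ?thesis using suppression_cost_le[of "{..<n}"] by (simp add: a_def)
qed

section \<open>Reading the partition off the table\<close>

definition label_class :: "(nat \<Rightarrow> nat) \<Rightarrow> nat set \<Rightarrow> nat \<Rightarrow> nat set" where
  "label_class g A a = {i \<in> A. g i = a}"

text \<open>All labels in use lie below \<open>l\<close>, so \<open>l\<close> itself is fresh for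
  the next group.\<close>

definition partial_labelling :: "(nat \<Rightarrow> nat) \<Rightarrow> nat set \<Rightarrow> nat \<Rightarrow> nat \<Rightarrow> bool" where
  "partial_labelling g A l c \<longleftrightarrow> (\<forall>i\<in>A. g i < l) \<and> (\<forall>a\<in>g ` A. close (label_class g A a)) \<and>
     (\<Sum>a\<in>g ` A. group_cost (label_class g A a)) = c"

lemma partial_labelling_extend:
  assumes "partial_labelling g A l c" "finite A" "B \<noteq> {}" "A \<inter> B = {}" "close B"
  shows "partial_labelling (\<lambda>i. if i \<in> B then l else g i) (A \<union> B) (Suc l) (c + group_cost B)"
proof -
  let ?g = "\<lambda>i. if i \<in> B then l else g i"
  have lt: "\<And>i. i \<in> A \<Longrightarrow> g i < l" using assms(1) by (simp add: partial_labelling_def)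
  have dis: "\<And>i. i \<in> A \<Longrightarrow> i \<notin> B" using assms(4) by blast
  have img: "?g ` (A \<union> B) = insert l (g ` A)" using assms(3) dis by force
  have fresh: "l \<notin> g ` A" using lt by force
  have new: "label_class ?g (A \<union> B) l = B" using lt dis by (force simp: label_class_def)
  have old: "label_class ?g (A \<union> B) a = label_class g A a" if "a \<in> g ` A" for a
    using that lt dis by (force simp: label_class_def)
  have "(\<Sum>a\<in>insert l (g ` A). group_cost (label_class ?g (A \<union> B) a))
      = group_cost B + (\<Sum>a\<in>g ` A. group_cost (label_class ?g (A \<union> B) a))"
    using fresh assms(2) by (simp add: new)
  also have "(\<Sum>a\<in>g ` A. group_cost (label_class ?g (A \<union> B) a)) = c"
    using assms(1) old by (simp add: partial_labelling_def)
  finally show ?thesis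
    using assms(1,5) new old lt dis unfolding partial_labelling_def img by (auto simp: less_Suc_eq)
qed

lemma label_group:
  assumes "has_bits s" "nmem s ''n'' 0 0 = n" "nmem s ''h'' 0 (nmem s ''x'' 0 0)
    = b" "b < 2 ^ n" "nmem s ''l'' 0 0 = l"
  shows "wp label_group (\<lambda>s'. nmem s' ''out'' 0 = (\<lambda>i.
    if i \<in> set_decode b then l else nmem s ''out'' 0 i)) s"
  unfolding label_group_def
proof (rule wp_For[where N = n and I = "\<lambda>k s'. \<forall>i. nmem s' ''out'' 0 i = (if i \<in> set_decode b
  \<and> i < k then l else nmem s ''out'' 0 i)"], goal_cases)
  case (6 i s1)
  have "0 < nmem s1 ''b'' b i \<longleftrightarrow> i \<in> set_decode b" "nmem s1 ''h'' 0 (nmem s1 ''x'' 0 0)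
    = b" "nmem s1 ''l'' 0 0 = l"
    using has_bits_agree[OF 6(4)] assms 6(1,4) by (auto simp: has_bits_def agree_def)
  then show ?case using 6(2,3) by (intro wp_intros) (auto simp: less_Suc_eq)
next
  case (7 s1)
  then show ?case using set_decode_bounded[OF assms(4)] by (intro ext) auto
qed (use assms in \<open>simp_all add: loop_simps\<close>)

lemma extract_prog:
  assumes "has_bits s" "nmem s ''n'' 0 0 = n" "has_best (2 ^ n) s"
  shows "wp extract_prog (\<lambda>s'. partial_labelling (nmem s' ''out'' 0) {..<n} n (nmem s ''v'' 0
    (2 ^ n - 1))) s"
proof -
  let ?v = "nmem s ''v'' 0" and ?h = "nmem s ''h'' 0"
  have best: "\<And>a. a < 2 ^ n \<Longrightarrow> best_entry ?v ?h (2 ^ n) a" using assms(3) by (simp add: has_best_def)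
  \<comment> \<open>\<open>card U \<le> n - l\<close> ensures that no row is left after
    \<open>n\<close> rounds, \<open>?v x < n * m + 1\<close> that \<open>?h x\<close> is an
    admissible group unless \<open>x = 0\<close>, and \<open>?v x \<le> ?v (2 ^ n - 1)\<close> that
    the difference of naturals is not truncated.\<close>
  define I where "I l s' \<longleftrightarrow> (let x = nmem s' ''x'' 0 0; U = set_decode x in
      x < 2 ^ n \<and> ?v x < n * m + 1 \<and> card U \<le> n - l \<and> ?v x \<le> ?v (2 ^ n - 1) \<and>
      partial_labelling (nmem s' ''out'' 0) ({..<n} - U) l (?v (2 ^ n - 1) - ?v x))" for l and s' :: state
  show ?thesis
    unfolding extract_prog_def
  proof (rule wp_Seq, rule wp_Assign, rule wp_For[where N = n and I = I], goal_cases)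
    case 4
    have "?v (2 ^ n - 1) < n * m + 1" using best best_full_finite by blast
    then show ?case using assms(1) set_decode_full[of n]
      by (simp add: I_def has_bits_N partial_labelling_def)
  next
    case (6 l s1)
    define x where "x = nmem s1 ''x'' 0 0"
    define b where "b = ?h x"
    define U where "U = set_decode x"
    have I: "x < 2 ^ n" "?v x < n * m + 1" "card U \<le> n - l" "?v x \<le> ?v (2 ^ n - 1)"
      "partial_labelling (nmem s1 ''out'' 0) ({..<n} - U) l (?v (2 ^ n - 1) - ?v x)"
      using 6(2) by (simp_all add: I_def x_def U_def Let_def)
    have e: "has_bits s1" "nmem s1 ''n'' 0 0 = n" "nmem s1 ''h'' = nmem s ''h''"
      using has_bits_agree[OF 6(4)] assms 6(4) by (auto simp: agree_def has_bits_def)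
    have U: "U \<subseteq> {..<n}" "finite U" using set_decode_bounded[OF I(1)] by (auto simp: U_def)
    have "b < 2 ^ n \<and> x - b < 2 ^ n \<and> ?v (x - b) < n * m + 1 \<and> card (set_decode (x - b)) \<le> n - Suc l \<and>
        ?v (x - b) \<le> ?v (2 ^ n - 1) \<and> partial_labelling (\<lambda>i.
          if i \<in> set_decode b then l else nmem s1 ''out'' 0 i)
          ({..<n} - set_decode (x - b)) (Suc l) (?v (2 ^ n - 1) - ?v (x - b))"
    proof (cases "x = 0")
      \<comment> \<open>An idle round: \<open>?h 0 = 0\<close> decodes to the empty set, so no label
        changes.\<close>
      case True
      then have "b = 0" using best[OF I(1)] by (simp add: best_entry_def b_def)
      then show ?thesis using I True by (auto simp: U_def partial_labelling_def less_Suc_eq)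
    next
      case False
      then have adm: "admissible x b" and vx: "?v x = group_cost (set_decode b) + ?v (x - b)"
        using best[OF I(1)] I(2) by (auto simp: best_entry_def b_def)
      have "set_decode b \<noteq> set_decode 0"
        using adm by (metis admissible_def less_irrefl set_decode_inverse)
      then have B: "set_decode b \<subseteq> U" "close (set_decode b)" "b \<le> x" "set_decode b \<noteq> {}"
        using adm admissible_le[OF adm] by (simp_all add: admissible_def U_def)
      have xb: "set_decode (x - b) = U - set_decode b" using B(1) set_decode_diff by (simp add: U_def)
      have "U - set_decode b \<subset> U" using B by blast
      then have "card (U - set_decode b) < card U" using U(2) by (rule psubset_card_mono[rotated])
      moreover have "{..<n} - (U - set_decode b) = ({..<n} - U) \<union> set_decode b" using B(1) U(1) by blast
      moreover have "partial_labelling (\<lambda>i. if i \<in> set_decode b then l else nmem s1 ''out'' 0 i)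
          (({..<n} - U) \<union> set_decode b) (Suc l) (?v (2 ^ n - 1) - ?v x + group_cost (set_decode b))"
        by (rule partial_labelling_extend[OF I(5)]) (use B in auto)
      moreover have "?v (2 ^ n - 1) - ?v x + group_cost (set_decode b) = ?v (2 ^ n - 1) - ?v (x - b)"
        using vx I(4) by simp
      ultimately show ?thesis using I vx B(3) xb by auto
    qed
    note next_state = this
    have hx: "nmem s1 ''h'' 0 (nmem s1 ''x'' 0 0) = b" using e by (simp add: b_def x_def)
    show ?case
    proof (rule wp_Seq, rule wp_conseq[OF label_group[OF e(1,2) hx _ 6(3)]], goal_cases)
      case (2 s2)
      have "nmem s2 ''x'' 0 0 = x" "nmem s2 ''h'' 0 x = b" using 2(1) e by
        (auto simp: agree_def x_def b_def)
      then show ?case using next_state 2(2) by (intro wp_Assign) (simp add: I_def)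
    qed (use next_state in simp)
  next
    case (7 s1)
    define x where "x = nmem s1 ''x'' 0 0"
    have I: "card (set_decode x) \<le> 0" "x < 2 ^ n"
      "partial_labelling (nmem s1 ''out'' 0) ({..<n} - set_decode x) n (?v (2 ^ n - 1) - ?v x)"
      using 7(1) by (simp_all only: I_def x_def Let_def diff_self_eq_0)
    then have "set_decode x = {}" by simp
    then have "x = 0" by (metis set_decode_inverse set_encode_empty)
    then show ?case using I best[of 0] by (simp add: best_entry_def)
  qed (use assms in \<open>simp_all add: loop_simps I_def Let_def\<close>)
qed

lemma partition_of_labels_optimal:
  assumes lab: "partial_labelling g {..<n} l c"
    and opt: "\<And>Q. t_close_partition m S d t (mset rs) Q \<Longrightarrow> c \<le> partition_cost m Q"
  shows "optimal_t_close_partition m S d t (mset rs) (partition_of_labels rs g)"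
proof -
  have group: "group_of_label rs g = (\<lambda>a. subtable rs (label_class g {..<n} a))"
    by (intro ext) (simp add: group_of_label_def subtable_def label_class_def n_def)
  have eq: "partition_of_labels rs g = image_mset (\<lambda>a. subtable rs (label_class g {..<n} a))
    (mset_set (g ` {..<n}))"
    by (simp add: partition_of_labels_def group n_def)
  have fin: "finite (label_class g {..<n} a)" for a by (simp add: label_class_def)
  have "\<Sum>\<^sub># (partition_of_labels rs g) = (\<Sum>a\<in>g ` {..<n}. subtable rs (label_class g {..<n} a))"
    unfolding eq by (simp add: sum_unfold_sum_mset)
  also have "\<dots> = mset rs"
    unfolding label_class_def by (subst sum_subtable_classes) (simp_all add: mset_eq_subtable n_def)
  finally have sum: "\<Sum>\<^sub># (partition_of_labels rs g) = mset rs" .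
  have "subtable rs (label_class g {..<n} a) \<noteq> {#}" if "a \<in> g ` {..<n}" for a
    using that fin[of a] by (auto simp: subtable_def mset_set_empty_iff label_class_def)
  then have "{#} \<notin># partition_of_labels rs g" unfolding eq by auto
  moreover have "t_close m S d t (mset rs) M" if "M \<in># partition_of_labels rs g" for M
    using that lab unfolding eq by (auto simp: partial_labelling_def)
  moreover have "partition_cost m (partition_of_labels rs g) = c"
    using lab unfolding eq
    by (simp add: partition_cost_def partial_labelling_def sum_unfold_sum_mset
      image_mset.compositionality comp_def)
  ultimately show ?thesis
    using sum opt by (simp add: optimal_t_close_partition_def t_close_partition_def is_partition_def)
qed

lemma t_closeness_prog:
  assumes "has_input s" "\<And>i. nmem s ''b'' 0 i = 0"
  shows "wp t_closeness_prog (\<lambda>s'. optimal_t_close_partition m S d t (mset rs) (output_partition rs s')) s"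
  unfolding t_closeness_prog_def
proof (rule wp_Seq, rule wp_conseq[OF bits_prog[OF has_input_n[OF assms(1)] assms(2)]], goal_cases)
  case (1 s1)
  have e1: "has_bits s1" "has_input s1" using 1 has_input_agree[OF 1(1)] assms by auto
  show ?case
  proof (rule wp_Seq, rule wp_conseq[OF subset_prog[OF e1(1) has_input_n[OF e1(2)]]], goal_cases)
    case (1 s2)
    have e2: "has_bits s2" "has_input s2" "has_subsets s2"
      using 1 has_bits_agree[OF 1(1)] has_input_agree[OF 1(1)] e1 by auto
    show ?case
    proof (rule wp_Seq, rule wp_conseq[OF cost_prog[OF e2(1,2)]], goal_cases)
      case (1 s3)
      have e3: "has_bits s3" "has_input s3" "has_subsets s3" "has_costs s3"
        using 1 has_bits_agree[OF 1(1)] has_input_agree[OF 1(1)] has_subsets_agree[OF 1(1)] e2 by auto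
      show ?case
      proof (rule wp_Seq, rule wp_conseq[OF close_prog[OF e3(1-3)]], goal_cases)
        case (1 s4)
        have e4: "has_bits s4" "has_input s4" "has_subsets s4"
          using has_bits_agree[OF 1(1)] has_input_agree[OF 1(1)] has_subsets_agree[OF 1(1)] e3 by auto
        have "has_costs s4" using 1(1) e3(4) by (simp add: agree_def has_costs_def)
        then have g4: "group_data s4" using e4 1(2) by (simp add: group_data_def has_bits_N)
        show ?case
        proof (rule wp_Seq, rule wp_conseq[OF best_prog[OF g4 e4(2)]], goal_cases)
          case (1 s5)
          have e5: "has_bits s5" "has_input s5"
            using has_bits_agree[OF 1(1)] has_input_agree[OF 1(1)] e4 by auto
          show ?case
          proof (rule wp_conseq[OF extract_prog[OF e5(1) has_input_n[OF e5(2)] 1(2)]], goal_cases)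
            case (1 s6)
            show ?case unfolding output_partition_def
            proof (rule partition_of_labels_optimal)
              fix Q assume "t_close_partition m S d t (mset rs) Q"
              then show "nmem s5 ''v'' 0 (2 ^ n - 1) \<le> partition_cost m Q"
                using \<open>has_best (2 ^ n) s5\<close> set_decode_full[of n, unfolded One_nat_def]
                by (intro best_le_partition_cost[where h = "nmem s5 ''h'' 0"])
                  (auto simp: has_best_def t_close_partition_def is_partition_def mset_eq_subtable n_def)
            qed (use 1(2) in simp)
          qed
        qed
      qed
    qed
  qed
qed

section \<open>The running time of the whole program\<close>

lemma input_state_ok: "has_input (input_state m rs S d t)" "nmem (input_state m rs S d t) ''b'' 0 i = 0"
  by (auto simp: has_input_def input_state_def n_def)

lemma exec_t_closeness_prog:
  "\<exists>k s. exec t_closeness_prog (input_state m rs S d t) k s \<and>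
     k \<le> time_bound (length rs) m t_closeness_prog \<and>
     optimal_t_close_partition m S d t (mset rs) (output_partition rs s)"
  using t_closeness_prog[OF input_state_ok, unfolded wp_def] unfolding n_def by blast

end

text \<open>Decided by unfolding: the only guard that compares with \<open>m\<close> is that of the
  loop over \<open>j\<close> in \<open>cost_prog\<close>, whose body loops over rows only.\<close>

lemma column_linear_t_closeness_prog: "column_linear t_closeness_prog"
  by (simp add: t_closeness_prog_def bits_prog_def copy_row_def double_rows_def subset_prog_def
      subset_test_def cost_prog_def find_difference_def add_column_def close_prog_def
      infinity_prog_def weights_prog_def count_rows_def weigh_def tree_prog_def tree_entry_def
      tree_init_def relax_def close_test_def threshold_def best_prog_def best_infinity_def
      best_init_def best_relax_def extract_prog_def label_group_def For_def column_loop_def)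

theorem theorem8:
  "\<exists>(prog :: com) (f :: nat \<Rightarrow> real) (g :: nat \<Rightarrow> real).
     f \<in> O(\<lambda>n. real n) \<and> g \<in> O(\<lambda>m. real m) \<and>
     (\<forall>(m :: nat) (\<Sigma> :: nat set) (S :: nat set) (d :: nat \<Rightarrow> nat \<Rightarrow> real) (t :: real) (rs :: row list).
        is_table m \<Sigma> S (mset rs) \<and> sa_space S d \<and> 0 \<le> t \<and> t \<le> 1 \<longrightarrow>
        (\<exists>k s. exec prog (input_state m rs S d t) k s \<and>
               real k \<le> 2 powr (f (length rs)) * g m \<and>
               optimal_t_close_partition m S d t (mset rs) (output_partition rs s)))"
proof -
  obtain F where F: "exp_bounded F" "\<forall>n m. time_bound n m t_closeness_prog \<le> F n * (m + 1)"
    using time_bound_column_linear[OF column_linear_t_closeness_prog] by blast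
  then obtain a where a: "\<And>n. F n \<le> 2 ^ (a * (n + 1))" unfolding exp_bounded_def by blast
  \<comment> \<open>The factor \<open>2 * a\<close> comes from \<open>n + 1 \<le> 2 * n\<close> for
    \<open>n \<ge> 1\<close>. The growth conditions concern large arguments only, so both functions
    may be nonzero at 0, as the running time demands.\<close>
  have "(\<lambda>n. real (a * (n + 1))) \<in> O(\<lambda>n. real n)"
    by (rule bigoI[of _ "real (2 * a)"], rule eventually_mono[OF eventually_ge_at_top[of 1]])
      (simp flip: of_nat_mult of_nat_add of_nat_Suc)
  moreover have "(\<lambda>m. real (m + 1)) \<in> O(\<lambda>m. real m)"
    by (rule bigoI[of _ 2], rule eventually_mono[OF eventually_ge_at_top[of 1]]) simp
  moreover have "\<exists>k s. exec t_closeness_prog (input_state m rs S d t) k s \<and>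
      real k \<le> 2 powr (real (a * (length rs + 1))) * real (m + 1) \<and>
      optimal_t_close_partition m S d t (mset rs) (output_partition rs s)"
    if "is_table m \<Sigma> S (mset rs) \<and> sa_space S d \<and> 0 \<le> t \<and> t \<le> 1" for m \<Sigma> S d t rs
  proof -
    interpret t_closeness_instance m \<Sigma> S d t rs using that by unfold_locales auto
    obtain k s where ks: "exec t_closeness_prog (input_state m rs S d t) k s"
      "k \<le> time_bound (length rs) m t_closeness_prog"
      "optimal_t_close_partition m S d t (mset rs) (output_partition rs s)"
      using exec_t_closeness_prog by blast
    have "k \<le> 2 ^ (a * (length rs + 1)) * (m + 1)"
      using ks(2) F(2) mult_right_mono[OF a[of "length rs"], of "m + 1"] by (meson order_trans zero_le)
    then have "real k \<le> real (2 ^ (a * (length rs + 1)) * (m + 1))" by (rule of_nat_mono)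
    also have "\<dots> = 2 powr (real (a * (length rs + 1))) * real (m + 1)"
      by (subst of_nat_mult) (simp only: powr_realpow zero_less_numeral of_nat_power of_nat_numeral)
    finally show ?thesis using ks by blast
  qed
  ultimately show ?thesis by blast
qed

end
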